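(* Suppose the probability space $(\Omega,\mathcal F,\mathbb P)$ is atomless, and let $\Phi$ be a (finite coercive) Young function (not a priori assumed to satisfy the $\Delta_2$-condition). Then the following are equivalent: (1) $\Phi\in\Delta_2$; (2) every norm bounded sequence in $L_{\Phi^*}$ has a subsequence whose Cesàro means converge in $\tau(L_{\Phi^*},L_\Phi)$; (3) every norm bounded sequence $(\xi_n)_n$ in $L_{\Phi^*}$ has a $\sigma(L_{\Phi^*},L_\Phi)$-convergent sequence of forward convex combinations; (4) every norm bounded sequence $(\xi_n)_n$ in $L_{\Phi^*}$ has an order bounded sequence of forward convex combinations.
   Context: $L_0$ is the space of $\mathbb P$-a.s. equivalence classes of finite real measurable functions, $\mathbb E$ is expectation. A (finite coercive) Young function is an even convex function $\Phi:\mathbb R\to\mathbb R$ with $\Phi(0)=0$ and $\lim_{x\to+\infty}\Phi(x)/x=+\infty$; its conjugate $\Phi^*(y)=\sup_x(xy-\Phi(x))$ is again such a function. $\Phi\in\Delta_2$ means $\limsup_{x\to\infty}\Phi(2x)/\Phi(x)<\infty$. For a Young function $\Psi$, $\mathbb B_\Psi=\{\xi\in L_0:\mathbb E[\Psi(\xi)]\le 1\}$, and the Orlicz space is $L_\Psi=\bigcup_{\lambda>0}\lambda\mathbb B_\Psi$ with norm $\|\xi\|_\Psi=\inf\{\lambda>0:\xi\in\lambda\mathbb B_\Psi\}$ and the a.s. pointwise order. $\sigma(L_{\Phi^*},L_\Phi)$ and $\tau(L_{\Phi^*},L_\Phi)$ are the weak and Mackey topologies on $L_{\Phi^*}$ for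 the duality $\langle\eta,\xi\rangle=\mathbb E[\eta\xi]$, $\eta\in L_\Phi$, $\xi\in L_{\Phi^*}$. A sequence of forward convex combinations of $(\xi_n)_n$ is a sequence $(\bar\xi_n)_n$ with $\bar\xi_n\in\operatorname{conv}(\xi_k;k\ge n)$ for all $n\geq 1$. A sequence $(\zeta_n)_n$ is order bounded in $L_{\Phi^*}$ if $\sup_n|\zeta_n|\in L_{\Phi^*}$. The Cesàro means of $(\zeta_n)_n$ are $\frac1N\sum_{i\le N}\zeta_i$, $N\ge1$. *)

theory Defs
  imports "HOL-Probability.Probability"
begin

text \<open>
  Elements of \<open>L\<^sub>0\<close> are represented by real-valued measurable functions. Orlicz spaces, norms and
  pairings respect almost sure equality, and the topologies below live on sets of functions and
  are the preimages, under the quotient map, of the topologies on equivalence classes. Convex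
  combinations are formed pointwise from representatives.
\<close>

definition atomless :: "'a measure \<Rightarrow> bool" where
  "atomless M \<longleftrightarrow>
     \<not> (\<exists>A\<in>sets M. measure M A > 0 \<and>
          (\<forall>B\<in>sets M. B \<subseteq> A \<longrightarrow> measure M B = 0 \<or> measure M B = measure M A))"

definition young_function :: "(real \<Rightarrow> real) \<Rightarrow> bool" where
  "young_function \<Phi> \<longleftrightarrow>
     (\<forall>x. \<Phi> (- x) = \<Phi> x) \<and> convex_on UNIV \<Phi> \<and> \<Phi> 0 = 0 \<and>
     filterlim (\<lambda>x. \<Phi> x / x) at_top at_top"

text \<open>The supremum is taken in the reals; coercivity makes the set bounded above.\<close>

definition young_conjugate :: "(real \<Rightarrow> real) \<Rightarrow> real \<Rightarrow> real" where
  "young_conjugate \<Phi> y = (SUP x. x * y - \<Phi> x)"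

text \<open>
  A Young function is positive for large arguments, so the convention \<open>x / 0 = 0\<close> does not affect
  the limit superior.
\<close>

definition delta2 :: "(real \<Rightarrow> real) \<Rightarrow> bool" where
  "delta2 \<Phi> \<longleftrightarrow> Limsup at_top (\<lambda>x. ereal (\<Phi> (2 * x) / \<Phi> x)) < \<infinity>"

text \<open>
  Young functions are nonnegative, so the possibly infinite expectation is the nonnegative
  integral.
\<close>

definition orlicz_ball :: "'a measure \<Rightarrow> (real \<Rightarrow> real) \<Rightarrow> ('a \<Rightarrow> real) set" where
  "orlicz_ball M \<Psi> = {\<xi> \<in> borel_measurable M. (\<integral>\<^sup>+\<omega>. ennreal (\<Psi> (\<xi> \<omega>)) \<partial>M) \<le> 1}"

definition scaled_orlicz_ball :: "'a measure \<Rightarrow> (real \<Rightarrow> real) \<Rightarrow> real \<Rightarrow> ('a \<Rightarrow> real) set" where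
  "scaled_orlicz_ball M \<Psi> l = (\<lambda>\<xi> \<omega>. l * \<xi> \<omega>) ` orlicz_ball M \<Psi>"

definition orlicz_space :: "'a measure \<Rightarrow> (real \<Rightarrow> real) \<Rightarrow> ('a \<Rightarrow> real) set" where
  "orlicz_space M \<Psi> = (\<Union>l\<in>{0<..}. scaled_orlicz_ball M \<Psi> l)"

definition orlicz_norm :: "'a measure \<Rightarrow> (real \<Rightarrow> real) \<Rightarrow> ('a \<Rightarrow> real) \<Rightarrow> real" where
  "orlicz_norm M \<Psi> \<xi> = Inf {l. l > 0 \<and> \<xi> \<in> scaled_orlicz_ball M \<Psi> l}"

definition norm_bounded_seq ::
    "'a measure \<Rightarrow> (real \<Rightarrow> real) \<Rightarrow> (nat \<Rightarrow> 'a \<Rightarrow> real) \<Rightarrow> bool" where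
  "norm_bounded_seq M \<Psi> \<xi> \<longleftrightarrow>
     (\<forall>n. \<xi> n \<in> orlicz_space M \<Psi>) \<and> (\<exists>C. \<forall>n. orlicz_norm M \<Psi> (\<xi> n) \<le> C)"

text \<open>
  The pointwise supremum of representatives may be infinite on a null set, hence it is formed in
  the extended reals and required to agree almost surely with an element of the space.
\<close>

definition order_bounded_seq ::
    "'a measure \<Rightarrow> (real \<Rightarrow> real) \<Rightarrow> (nat \<Rightarrow> 'a \<Rightarrow> real) \<Rightarrow> bool" where
  "order_bounded_seq M \<Psi> \<zeta> \<longleftrightarrow>
     (\<forall>n. \<zeta> n \<in> orlicz_space M \<Psi>) \<and>
     (\<exists>\<eta>\<in>orlicz_space M \<Psi>. AE \<omega> in M. (SUP n. ereal \<bar>\<zeta> n \<omega>\<bar>) = ereal (\<eta> \<omega>))"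

definition pairing :: "'a measure \<Rightarrow> ('a \<Rightarrow> real) \<Rightarrow> ('a \<Rightarrow> real) \<Rightarrow> real" where
  "pairing M \<eta> \<xi> = (\<integral>\<omega>. \<eta> \<omega> * \<xi> \<omega> \<partial>M)"

text \<open>\<open>\<sigma>(X, Y)\<close>: the coarsest topology on \<open>X\<close> making all pairings with elements of \<open>Y\<close> continuous.\<close>

definition weak_topology ::
    "'a measure \<Rightarrow> ('a \<Rightarrow> real) set \<Rightarrow> ('a \<Rightarrow> real) set \<Rightarrow> ('a \<Rightarrow> real) topology" where
  "weak_topology M X Y =
     topology_generated_by {{\<xi> \<in> X. pairing M \<eta> \<xi> \<in> U} |\<eta> U. \<eta> \<in> Y \<and> open U}"

definition absolutely_convex :: "('a \<Rightarrow> real) set \<Rightarrow> bool" where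
  "absolutely_convex K \<longleftrightarrow>
     (\<forall>f\<in>K. \<forall>g\<in>K. \<forall>a b :: real. \<bar>a\<bar> + \<bar>b\<bar> \<le> 1 \<longrightarrow> (\<lambda>\<omega>. a * f \<omega> + b * g \<omega>) \<in> K)"

text \<open>
  \<open>\<tau>(X, Y)\<close>: uniform convergence on the absolutely convex \<open>\<sigma>(Y, X)\<close>-compact subsets of \<open>Y\<close>,
  generated by the balls of the seminorms \<open>\<xi> \<mapsto> sup {\<bar>\<langle>\<eta>, \<xi>\<rangle>\<bar> | \<eta> \<in> K}\<close>; the suprema are finite as
  \<open>K\<close> is weakly compact.
\<close>

definition mackey_topology ::
    "'a measure \<Rightarrow> ('a \<Rightarrow> real) set \<Rightarrow> ('a \<Rightarrow> real) set \<Rightarrow> ('a \<Rightarrow> real) topology" where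
  "mackey_topology M X Y =
     topology_generated_by
       {{\<zeta> \<in> X. (SUP \<eta>\<in>K. \<bar>pairing M \<eta> (\<lambda>\<omega>. \<zeta> \<omega> - \<xi> \<omega>)\<bar>) < \<epsilon>} |K \<xi> \<epsilon>.
          K \<noteq> {} \<and> absolutely_convex K \<and> compactin (weak_topology M Y X) K \<and>
          \<xi> \<in> X \<and> \<epsilon> > 0}"

definition converges_in :: "'b topology \<Rightarrow> (nat \<Rightarrow> 'b) \<Rightarrow> bool" where
  "converges_in T s \<longleftrightarrow> (\<exists>l. limitin T s l sequentially)"

definition conv_tail :: "(nat \<Rightarrow> 'a \<Rightarrow> real) \<Rightarrow> nat \<Rightarrow> ('a \<Rightarrow> real) set" where
  "conv_tail \<xi> n =
     {\<lambda>\<omega>. \<Sum>k\<in>F. c k * \<xi> k \<omega> |F c.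
        finite F \<and> F \<subseteq> {n..} \<and> (\<forall>k\<in>F. c k \<ge> 0) \<and> (\<Sum>k\<in>F. c k) = 1}"

definition forward_convex_combinations ::
    "(nat \<Rightarrow> 'a \<Rightarrow> real) \<Rightarrow> (nat \<Rightarrow> 'a \<Rightarrow> real) \<Rightarrow> bool" where
  "forward_convex_combinations \<xi> \<zeta> \<longleftrightarrow> (\<forall>n. \<zeta> n \<in> conv_tail \<xi> n)"

text \<open>Sequences start at index 0, so the entry at \<open>N\<close> averages the first \<open>N + 1\<close> terms.\<close>

definition cesaro_means :: "(nat \<Rightarrow> 'a \<Rightarrow> real) \<Rightarrow> nat \<Rightarrow> 'a \<Rightarrow> real" where
  "cesaro_means \<zeta> N = (\<lambda>\<omega>. (\<Sum>i\<le>N. \<zeta> i \<omega>) / real (Suc N))"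

end

theory Submission
  imports Defs "HOL-Library.Diagonal_Subsequence"
begin

text \<open>
  Write \<open>\<Psi> = \<Phi>\<^sup>*\<close>. The condition \<open>\<Phi> \<in> \<Delta>\<^sub>2\<close> says that \<open>N \<Psi>(x / N)\<close> is at most \<open>\<delta> \<Psi>(x)\<close> plus a
  multiple of \<open>|x|\<close> once \<open>N\<close> is large. Split a sequence in the ball of \<open>L\<^sub>\<Psi>\<close> by truncation
  into a bounded part, a part with uniformly integrable \<open>\<Psi>\<close>-values and nearly disjoint tails. Along
  a subsequence, the Cesaro means of the first part converge in \<open>L\<^sup>2\<close> because the inner products
  of its terms are almost constant; convexity controls those of the second; and the dual form of
  \<open>\<Delta>\<^sub>2\<close> makes those of the third vanish. Hence the Cesaro means \<open>m\<^sub>N\<close> converge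
  modularly: \<open>\<E>[\<Psi>(c (m\<^sub>N - f))] \<rightarrow> 0\<close> for some \<open>c > 0\<close>. A modularly null sequence has order bounded
  subsequences that tend to \<open>0\<close> almost surely, and decreasing null sequences in \<open>L\<^sub>\<Psi>\<close> are null
  uniformly on weakly compact sets by a gliding hump. This gives the Mackey convergence of the means,
  while block averages of the subsequence yield the forward convex combinations.

  Conversely, if \<open>\<Delta>\<^sub>2\<close> fails, choose \<open>y\<^sub>n\<close> with \<open>\<Phi>(2 y\<^sub>n) > 2\<^sup>n\<^sup>+\<^sup>1 \<Phi>(y\<^sub>n)\<close> and disjoint events
  \<open>A\<^sub>n\<close> of probability \<open>1 / \<Phi>(2 y\<^sub>n)\<close>. The sum of the \<open>y\<^sub>n 1\<^sub>A\<^sub>n\<close> lies in \<open>L\<^sub>\<Phi>\<close> and has pairing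
  \<open>1 / 2\<close> with each function \<open>\<Phi>(2 y\<^sub>n) / (2 y\<^sub>n) 1\<^sub>A\<^sub>n\<close>. These functions lie in the unit ball of \<open>L\<^sub>\<Psi>\<close>,
  and disjointness would force the pairing with a limit to vanish.
\<close>

section \<open>Young functions and their conjugates\<close>

text \<open>The target is modular convergence at a single scale because \<Psi> itself may fail the
  doubling condition: smallness of E[\<Psi>(c u)] for one c does not control the norm of u. One
  scale suffices, since a sequence whose modulars are summable at a fixed c is dominated by one
  element of the space, and domination is what both the order bound and the estimates on weakly
  compact sets consume. In \<open>nabla2\<close> the constant \<open>y0\<close> is chosen before
  \<delta>. It is the threshold beyond which the doubling inequality holds for \<Phi>; smaller
  arguments are bounded linearly. As it does not move with \<delta>, the linear terms of the tails
  add up to a fixed multiple of the average of E|tail|, which vanishes by coercivity, while \<delta>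
  stays free. In the converse, the secant slope \<Phi>(u) / u has conjugate value at most \<Phi>(u),
  so on an event of probability 1 / \<Phi>(u) it stays in the unit ball and pairs to 1 with the
  constant u. Taking u = 2 y and pairing with y instead keeps 1 / 2, while the failure of doubling
  makes \<Phi>(y) / \<Phi>(2 y) summable along the chosen points.\<close>

definition nabla2 :: "(real \<Rightarrow> real) \<Rightarrow> bool" where
  "nabla2 \<Psi> \<longleftrightarrow> (\<exists>y0\<ge>0. \<forall>\<delta>>0. \<exists>N0. \<forall>N\<ge>N0. \<forall>x.
     real N * \<Psi> (x / real N) \<le> \<delta> * \<Psi> x + y0 * \<bar>x\<bar>)"

locale young =
  fixes \<Psi> :: "real \<Rightarrow> real"
  assumes young: "young_function \<Psi>"
begin

lemma even [simp]: "\<Psi> (- x) = \<Psi> x"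
  and convex: "convex_on UNIV \<Psi>"
  and zero [simp]: "\<Psi> 0 = 0"
  and coercive: "filterlim (\<lambda>x. \<Psi> x / x) at_top at_top"
  using young by (auto simp: young_function_def)

lemma abs_arg [simp]: "\<Psi> \<bar>x\<bar> = \<Psi> x"
  by (cases "x \<ge> 0") auto

lemma convex_combination:
  assumes "0 \<le> t" "t \<le> 1"
  shows "\<Psi> ((1 - t) * x + t * y) \<le> (1 - t) * \<Psi> x + t * \<Psi> y"
  using convex_onD[OF convex assms, of x y] by simp

lemma nonneg [simp]: "0 \<le> \<Psi> x"
  using convex_combination[of "1/2" x "- x"] by simp

lemma scale_le: "0 \<le> t \<Longrightarrow> t \<le> 1 \<Longrightarrow> \<Psi> (t * x) \<le> t * \<Psi> x"
  using convex_combination[of t 0 x] by simp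

lemma mono_abs:
  assumes "\<bar>x\<bar> \<le> \<bar>y\<bar>"
  shows "\<Psi> x \<le> \<Psi> y"
proof (cases "y = 0")
  case False
  have "\<Psi> x = \<Psi> (\<bar>x\<bar> / \<bar>y\<bar> * \<bar>y\<bar>)"
    using False by simp
  also have "\<dots> \<le> \<bar>x\<bar> / \<bar>y\<bar> * \<Psi> y"
    using scale_le[of "\<bar>x\<bar> / \<bar>y\<bar>" "\<bar>y\<bar>"] assms False by simp
  also have "\<dots> \<le> 1 * \<Psi> y"
    using assms False by (intro mult_right_mono) auto
  finally show ?thesis by simp
qed (use assms in simp)

lemma midpoint: "\<Psi> ((x + y) / 2) \<le> (\<Psi> x + \<Psi> y) / 2"
  using convex_combination[of "1/2" x y] by (simp add: field_simps)

text \<open>Jensen's inequality for weights of total mass at most 1: the missing mass sits at 0,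
  where \<Psi> vanishes. This allows averages in which fewer than \<open>n\<close> terms are divided
  by \<open>n\<close>, as happens for partial sums of tails.\<close>

lemma sum_le:
  assumes "finite S" "\<And>i. i \<in> S \<Longrightarrow> 0 \<le> t i" "sum t S \<le> 1"
  shows "\<Psi> (\<Sum>i\<in>S. t i * x i) \<le> (\<Sum>i\<in>S. t i * \<Psi> (x i))"
proof (cases "sum t S = 0")
  case True
  then have "\<And>i. i \<in> S \<Longrightarrow> t i = 0"
    using assms sum_nonneg_eq_0_iff by blast
  then show ?thesis by simp
next
  case False
  define s where "s = sum t S"
  have s: "0 < s" "s \<le> 1"
    using False assms sum_nonneg[of S t] by (auto simp: s_def)
  have "\<Psi> (\<Sum>i\<in>S. t i * x i) = \<Psi> (s * (\<Sum>i\<in>S. (t i / s) *\<^sub>R x i))"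
    using s by (simp add: sum_distrib_left)
  also have "\<dots> \<le> s * \<Psi> (\<Sum>i\<in>S. (t i / s) *\<^sub>R x i)"
    using s by (intro scale_le) auto
  also have "\<dots> \<le> s * (\<Sum>i\<in>S. (t i / s) * \<Psi> (x i))"
  proof (intro mult_left_mono convex_on_sum[OF _ _ convex])
    show "S \<noteq> {}" using False by auto
    show "(\<Sum>i\<in>S. t i / s) = 1"
      using s by (simp add: s_def flip: sum_divide_distrib)
  qed (use assms s in auto)
  also have "\<dots> = (\<Sum>i\<in>S. t i * \<Psi> (x i))"
    using s by (simp add: sum_distrib_left)
  finally show ?thesis .
qed

lemma mean_le:
  assumes "finite S" "card S \<le> n" "0 < n"
  shows "\<Psi> ((\<Sum>i\<in>S. x i) / real n) \<le> (\<Sum>i\<in>S. \<Psi> (x i)) / real n"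
  using sum_le[OF assms(1), of "\<lambda>_. 1 / real n" x] assms by (simp add: sum_divide_distrib)

lemma continuous [continuous_intros]: "continuous_on S \<Psi>"
  using convex_on_continuous[OF open_UNIV convex] continuous_on_subset by blast

lemma measurable_young [measurable]: "\<Psi> \<in> borel_measurable borel"
  using continuous borel_measurable_continuous_onI by blast

text \<open>Coercivity in the form in which it is used: up to a constant, the absolute value is an
  arbitrarily small multiple of \<Psi>. Bounded modulars thus give bounded first moments.\<close>

lemma abs_le_eps:
  assumes "\<epsilon> > 0"
  obtains D where "D \<ge> 0" "\<And>x. \<bar>x\<bar> \<le> \<epsilon> * \<Psi> x + D"
proof -
  have "eventually (\<lambda>x. 1 / \<epsilon> \<le> \<Psi> x / x) at_top"
    using coercive by (simp add: filterlim_at_top)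
  then obtain D where D: "\<And>x. x \<ge> D \<Longrightarrow> 1 / \<epsilon> \<le> \<Psi> x / x"
    by (auto simp: eventually_at_top_linorder)
  show ?thesis
  proof (rule that[of "max D 1"])
    fix x :: real
    show "\<bar>x\<bar> \<le> \<epsilon> * \<Psi> x + max D 1"
    proof (cases "\<bar>x\<bar> \<le> max D 1")
      case True
      then show ?thesis using assms by (simp add: add_increasing)
    next
      case False
      then have "1 / \<epsilon> \<le> \<Psi> \<bar>x\<bar> / \<bar>x\<bar>" "\<bar>x\<bar> > 0" using D[of "\<bar>x\<bar>"] by auto
      then show ?thesis using assms by (simp add: field_simps)
    qed
  qed simp
qed

lemma abs_le_eps_large:
  assumes "\<epsilon> > 0"
  obtains k :: nat where "\<And>x. \<bar>x\<bar> > real k \<Longrightarrow> \<bar>x\<bar> \<le> \<epsilon> * \<Psi> x"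
proof -
  obtain D where D: "D \<ge> 0" "\<And>x. \<bar>x\<bar> \<le> \<epsilon> / 2 * \<Psi> x + D"
    using abs_le_eps[of "\<epsilon> / 2"] assms by auto
  obtain k :: nat where k: "2 * D \<le> real k" using real_arch_simple by blast
  show ?thesis
  proof (rule that[of k])
    fix x :: real assume "\<bar>x\<bar> > real k"
    then show "\<bar>x\<bar> \<le> \<epsilon> * \<Psi> x" using D(2)[of x] k by (simp add: field_simps)
  qed
qed

text \<open>On a bounded interval convexity puts \<Psi> below a line through 0, and the inequality
  of arithmetic and geometric means turns the line into \<epsilon> plus a multiple of the square.
  This converts convergence in L^2 of bounded functions into modular convergence.\<close>

lemma le_eps_plus_square:
  assumes "\<epsilon> > 0"
  obtains C where "C \<ge> 0" "\<And>x. \<bar>x\<bar> \<le> real k \<Longrightarrow> \<Psi> x \<le> \<epsilon> + C * x\<^sup>2"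
proof -
  define L where "L = \<Psi> k / k + 1"
  have L: "L > 0" unfolding L_def by (simp add: add_nonneg_pos)
  show ?thesis
  proof (rule that[of "L\<^sup>2 / (4 * \<epsilon>)"])
    fix x :: real assume x: "\<bar>x\<bar> \<le> real k"
    have "\<Psi> x \<le> L * \<bar>x\<bar>"
    proof (cases "k = 0")
      case False
      have "\<Psi> x = \<Psi> (\<bar>x\<bar> / k * k)" using False by simp
      also have "\<dots> \<le> \<bar>x\<bar> / k * \<Psi> k" using x False by (intro scale_le) auto
      also have "\<dots> \<le> L * \<bar>x\<bar>" unfolding L_def by (simp add: algebra_simps)
      finally show ?thesis .
    qed (use x in simp)
    also have "\<dots> \<le> \<epsilon> + L\<^sup>2 / (4 * \<epsilon>) * x\<^sup>2"
    proof -
      have "0 \<le> (L * \<bar>x\<bar> - 2 * \<epsilon>)\<^sup>2" by simp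
      then have "4 * \<epsilon> * (L * \<bar>x\<bar>) \<le> 4 * \<epsilon> * \<epsilon> + L\<^sup>2 * x\<^sup>2"
        by (simp add: power2_diff power_mult_distrib algebra_simps) (simp add: power2_eq_square)
      then show ?thesis using assms by (simp add: field_simps power2_eq_square)
    qed
    finally show "\<Psi> x \<le> \<epsilon> + L\<^sup>2 / (4 * \<epsilon>) * x\<^sup>2" .
  qed (use assms in auto)
qed

section \<open>The conjugate function and the growth conditions\<close>

text \<open>A real supremum has its intended value only for sets bounded above. Coercivity at slope
  |y| + 1 makes \<Psi> outgrow the linear term.\<close>

lemma conjugate_bdd: "bdd_above (range (\<lambda>x. x * y - \<Psi> x))"
proof -
  obtain D where D: "D \<ge> 0" "\<And>x. \<bar>x\<bar> \<le> 1 / (\<bar>y\<bar> + 1) * \<Psi> x + D"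
    using abs_le_eps[of "1 / (\<bar>y\<bar> + 1)"] by (auto simp: add_nonneg_pos)
  show ?thesis
  proof (intro bdd_aboveI2)
    fix x
    have "x * y \<le> \<bar>x\<bar> * (\<bar>y\<bar> + 1)"
      using abs_ge_self[of "x * y"] by (simp add: abs_mult algebra_simps)
    also have "\<dots> \<le> (1 / (\<bar>y\<bar> + 1) * \<Psi> x + D) * (\<bar>y\<bar> + 1)"
      using D by (intro mult_right_mono) auto
    also have "\<dots> = \<Psi> x + D * (\<bar>y\<bar> + 1)"
      by (simp add: field_simps)
    finally show "x * y - \<Psi> x \<le> D * (\<bar>y\<bar> + 1)" by simp
  qed
qed

lemma conjugate_ge: "x * y - \<Psi> x \<le> young_conjugate \<Psi> y"
  unfolding young_conjugate_def by (rule cSUP_upper[OF _ conjugate_bdd]) simp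

lemma conjugate_least: "(\<And>x. x * y - \<Psi> x \<le> z) \<Longrightarrow> young_conjugate \<Psi> y \<le> z"
  unfolding young_conjugate_def by (rule cSUP_least) auto

lemma young_ineq: "\<bar>x * y\<bar> \<le> \<Psi> x + young_conjugate \<Psi> y"
  using conjugate_ge[of x y] conjugate_ge[of "- x" y] by (simp add: abs_le_iff)

lemma young_conjugate: "young_function (young_conjugate \<Psi>)"
  unfolding young_function_def
proof (intro conjI allI)
  fix x
  have *: "young_conjugate \<Psi> (- y) \<le> young_conjugate \<Psi> y" for y
    by (rule conjugate_least) (use conjugate_ge[of "- _" y] in simp)
  show "young_conjugate \<Psi> (- x) = young_conjugate \<Psi> x"
    using *[of x] *[of "- x"] by simp
next
  show "convex_on UNIV (young_conjugate \<Psi>)"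
  proof (rule convex_onI)
    fix t :: real and x y :: real
    assume t: "0 < t" "t < 1"
    show "young_conjugate \<Psi> ((1 - t) *\<^sub>R x + t *\<^sub>R y)
        \<le> (1 - t) * young_conjugate \<Psi> x + t * young_conjugate \<Psi> y"
    proof (rule conjugate_least)
      fix z
      have "z * ((1 - t) *\<^sub>R x + t *\<^sub>R y) - \<Psi> z = (1 - t) * (z * x - \<Psi> z) + t * (z * y - \<Psi> z)"
        by (simp add: algebra_simps)
      also have "\<dots> \<le> (1 - t) * young_conjugate \<Psi> x + t * young_conjugate \<Psi> y"
        using t by (intro add_mono mult_left_mono conjugate_ge) auto
      finally show "z * ((1 - t) *\<^sub>R x + t *\<^sub>R y) - \<Psi> z
        \<le> (1 - t) * young_conjugate \<Psi> x + t * young_conjugate \<Psi> y" .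
    qed
  qed simp
next
  show "young_conjugate \<Psi> 0 = 0"
    using conjugate_least[of 0 0] conjugate_ge[of 0 0] by simp
next
  show "filterlim (\<lambda>x. young_conjugate \<Psi> x / x) at_top at_top"
    unfolding filterlim_at_top
  proof
    fix Z :: real
    \<comment> \<open>Testing the supremum at the single point \<open>t = Z + 1\<close> gives the
      lower bound t y - \<Psi>(t), which exceeds Z y as soon as y \<ge> \<Psi>(t).\<close>
    define t where "t = Z + 1"
    have "eventually (\<lambda>y. y \<ge> max 1 (\<Psi> t)) at_top" by (rule eventually_ge_at_top)
    then show "eventually (\<lambda>y. Z \<le> young_conjugate \<Psi> y / y) at_top"
    proof eventually_elim
      case (elim y)
      then have "Z * y \<le> t * y - \<Psi> t" by (simp add: t_def algebra_simps)
      also have "\<dots> \<le> young_conjugate \<Psi> y" by (rule conjugate_ge)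
      finally show ?case using elim by (simp add: field_simps)
    qed
  qed
qed

lemma positive_at_top: "eventually (\<lambda>x. 0 < \<Psi> x \<and> x > 0) at_top"
proof -
  have "eventually (\<lambda>x. 1 \<le> \<Psi> x / x) at_top"
    using coercive by (simp add: filterlim_at_top)
  then show ?thesis
    using eventually_gt_at_top[of "0::real"]
    by eventually_elim (auto simp: field_simps)
qed

lemma delta2D:
  assumes "delta2 \<Psi>"
  obtains C y0 where "C \<ge> 1" "y0 \<ge> 0" "\<And>y. y \<ge> y0 \<Longrightarrow> \<Psi> (2 * y) \<le> C * \<Psi> y"
proof -
  obtain C where "Limsup at_top (\<lambda>x. ereal (\<Psi> (2 * x) / \<Psi> x)) < ereal C"
    using assms less_PInf_Ex_of_nat unfolding delta2_def by (metis ereal_dense2)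
  then have "eventually (\<lambda>x. ereal (\<Psi> (2 * x) / \<Psi> x) < ereal C) at_top"
    by (rule Limsup_lessD)
  then have "eventually (\<lambda>x. \<Psi> (2 * x) \<le> max C 1 * \<Psi> x) at_top"
    using positive_at_top
  proof eventually_elim
    case (elim x)
    then have "\<Psi> (2 * x) \<le> C * \<Psi> x" by (simp add: field_simps)
    also have "\<dots> \<le> max C 1 * \<Psi> x" by (intro mult_right_mono) auto
    finally show ?case .
  qed
  then obtain y0 where "\<And>x. x \<ge> y0 \<Longrightarrow> \<Psi> (2 * x) \<le> max C 1 * \<Psi> x"
    by (auto simp: eventually_at_top_linorder)
  then show ?thesis by (intro that[of "max C 1" "max y0 0"]) auto
qed

lemma not_delta2D:
  assumes "\<not> delta2 \<Psi>"
  shows "\<exists>y\<ge>y0. y > 0 \<and> \<Psi> y > 0 \<and> \<Psi> (2 * y) > C * \<Psi> y"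
proof (rule ccontr)
  assume neg: "\<not> ?thesis"
  have "eventually (\<lambda>x. ereal (\<Psi> (2 * x) / \<Psi> x) \<le> ereal C) at_top"
    using positive_at_top eventually_ge_at_top[of y0]
  proof eventually_elim
    case (elim x)
    then have "\<Psi> (2 * x) \<le> C * \<Psi> x" using neg by (auto simp: not_less)
    then show ?case using elim by (simp add: field_simps)
  qed
  then have "Limsup at_top (\<lambda>x. ereal (\<Psi> (2 * x) / \<Psi> x)) \<le> ereal C"
    by (rule Limsup_bounded)
  then show False using assms unfolding delta2_def by auto
qed

text \<open>The quotients \<Psi>(x) / x increase for positive x. Hence x \<Psi>(u) / u is at most
  \<Psi>(u) for x \<le> u and at most \<Psi>(x) for x > u. This bound supplies the test functions
  when the growth condition fails.\<close>

lemma conjugate_slope_le: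
  assumes "u > 0"
  shows "young_conjugate \<Psi> (\<Psi> u / u) \<le> \<Psi> u"
proof (rule conjugate_least)
  fix x
  show "x * (\<Psi> u / u) - \<Psi> x \<le> \<Psi> u"
  proof (cases "x \<le> u")
    case True
    then have "x * (\<Psi> u / u) \<le> u * (\<Psi> u / u)" using assms by (intro mult_right_mono) auto
    then have "x * (\<Psi> u / u) \<le> \<Psi> u" using assms by simp
    then show ?thesis using nonneg[of x] by linarith
  next
    case False
    have "\<Psi> u = \<Psi> (u / x * x)" using False assms by simp
    also have "\<dots> \<le> u / x * \<Psi> x" using False assms by (intro scale_le) auto
    finally have "x * (\<Psi> u / u) \<le> \<Psi> x" using False assms by (simp add: field_simps)
    then show ?thesis using nonneg[of u] by linarith
  qed
qed

text \<open>The dual form of the \<open>\<Delta>\<^sub>2\<close>-condition: comparing the arguments \<open>y\<close> and \<open>2\<^sup>m y\<close> in the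
  suprema defining the conjugate at \<open>x / N\<close> and at \<open>x\<close> gains the factor \<open>2\<^sup>-\<^sup>m\<close>.\<close>

lemma delta2_conjugate:
  assumes "delta2 \<Psi>"
  shows "nabla2 (young_conjugate \<Psi>)"
proof -
  interpret conj: young "young_conjugate \<Psi>" by standard (rule young_conjugate)
  obtain C y0 where C: "C \<ge> 1" "y0 \<ge> 0" "\<And>y. y \<ge> y0 \<Longrightarrow> \<Psi> (2 * y) \<le> C * \<Psi> y"
    using delta2D[OF assms] by blast
  have pow: "\<Psi> (2 ^ m * y) \<le> C ^ m * \<Psi> y" if "y \<ge> y0" for y m
  proof (induction m)
    case (Suc m)
    have "y * 1 \<le> y * 2 ^ m" using that C by (intro mult_left_mono) auto
    then have "\<Psi> (2 * (2 ^ m * y)) \<le> C * \<Psi> (2 ^ m * y)"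
      using that C by (intro C(3)) (simp add: mult.commute)
    also have "\<dots> \<le> C * (C ^ m * \<Psi> y)" using Suc C by (intro mult_left_mono) auto
    finally show ?case by (simp add: mult.assoc)
  qed simp
  show ?thesis
    unfolding nabla2_def
  proof (rule exI[of _ y0], intro conjI allI impI)
    show "0 \<le> y0" by (rule C(2))
    fix \<delta> :: real assume \<delta>: "\<delta> > 0"
    then obtain m where m: "(1/2) ^ m < \<delta>"
      using real_arch_pow_inv[of \<delta> "1/2"] by auto
    \<comment> \<open>Iterating the doubling inequality m times costs C^m, and the rescaling by 2^-m
      reduces this to (C/2)^m. The term N \<Psi>(y) absorbs it once N exceeds that number.\<close>
    obtain N0 :: nat where N0: "(C / 2) ^ m \<le> real N0" using real_arch_simple by blast
    show "\<exists>N0. \<forall>N\<ge>N0. \<forall>x.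
       real N * young_conjugate \<Psi> (x / real N) \<le> \<delta> * young_conjugate \<Psi> x + y0 * \<bar>x\<bar>"
    proof (intro exI[of _ "N0 + 1"] allI impI)
      fix N :: nat and x :: real
      assume N: "N \<ge> N0 + 1"
      have "young_conjugate \<Psi> (\<bar>x\<bar> / N) \<le> (\<delta> * young_conjugate \<Psi> x + y0 * \<bar>x\<bar>) / N"
      proof (rule conjugate_least)
        fix y
        show "y * (\<bar>x\<bar> / N) - \<Psi> y \<le> (\<delta> * young_conjugate \<Psi> x + y0 * \<bar>x\<bar>) / N"
        proof (cases "y \<ge> y0")
          case True
          have "2 ^ m * y * \<bar>x\<bar> - C ^ m * \<Psi> y \<le> 2 ^ m * y * \<bar>x\<bar> - \<Psi> (2 ^ m * y)"
            using pow[OF True] by simp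
          also have "\<dots> \<le> young_conjugate \<Psi> x"
            using conjugate_ge[of "2 ^ m * y" "\<bar>x\<bar>"] by simp
          finally have "(1/2) ^ m * (2 ^ m * y * \<bar>x\<bar> - C ^ m * \<Psi> y) \<le> (1/2) ^ m * young_conjugate \<Psi> x"
            by (intro mult_left_mono) auto
          moreover have "(1/2) ^ m * (2 ^ m * y * \<bar>x\<bar> - C ^ m * \<Psi> y) = y * \<bar>x\<bar> - (C / 2) ^ m * \<Psi> y"
            by (simp add: power_divide algebra_simps)
          moreover have "(1/2) ^ m * young_conjugate \<Psi> x \<le> \<delta> * young_conjugate \<Psi> x"
            using m by (intro mult_right_mono) auto
          moreover have "(C / 2) ^ m * \<Psi> y \<le> real N * \<Psi> y"
            using N N0 by (intro mult_right_mono) auto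
          moreover have "0 \<le> y0 * \<bar>x\<bar>" using C by simp
          ultimately have "y * \<bar>x\<bar> - real N * \<Psi> y \<le> \<delta> * young_conjugate \<Psi> x + y0 * \<bar>x\<bar>"
            by linarith
          then have "(y * \<bar>x\<bar> - real N * \<Psi> y) / N \<le> (\<delta> * young_conjugate \<Psi> x + y0 * \<bar>x\<bar>) / N"
            by (intro divide_right_mono) auto
          then show ?thesis using N by (simp add: diff_divide_distrib)
        next
          case False
          have "y * \<bar>x\<bar> \<le> y0 * \<bar>x\<bar>" using False by (intro mult_right_mono) auto
          moreover have "0 \<le> \<delta> * young_conjugate \<Psi> x" "0 \<le> real N * \<Psi> y" using \<delta> by auto
          ultimately have "y * \<bar>x\<bar> - real N * \<Psi> y \<le> \<delta> * young_conjugate \<Psi> x + y0 * \<bar>x\<bar>"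
            by linarith
          then have "(y * \<bar>x\<bar> - real N * \<Psi> y) / N \<le> (\<delta> * young_conjugate \<Psi> x + y0 * \<bar>x\<bar>) / N"
            by (intro divide_right_mono) auto
          then show ?thesis using N by (simp add: diff_divide_distrib)
        qed
      qed
      moreover have "young_conjugate \<Psi> (\<bar>x\<bar> / N) = young_conjugate \<Psi> (x / N)"
        using conj.abs_arg[of "x / N"] by simp
      ultimately show "real N * young_conjugate \<Psi> (x / real N) \<le> \<delta> * young_conjugate \<Psi> x + y0 * \<bar>x\<bar>"
        using N by (simp add: field_simps)
    qed
  qed
qed

end

section \<open>Orlicz spaces and their duality\<close>

context prob_space
begin

abbreviation L :: "(real \<Rightarrow> real) \<Rightarrow> ('a \<Rightarrow> real) set" where
  "L \<equiv> orlicz_space M"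

end

locale young_space = prob_space M + young \<Psi> for M :: "'a measure" and \<Psi>
begin

lemma integrable_young_bound:
  assumes "f \<in> borel_measurable M" "integrable M g" "AE w in M. \<Psi> (f w) \<le> g w"
  shows "integrable M (\<lambda>w. \<Psi> (f w))"
  by (rule Bochner_Integration.integrable_bound[OF assms(2)]) (use assms in auto)

lemma orlicz_ball_iff:
  "f \<in> orlicz_ball M \<Psi> \<longleftrightarrow>
    f \<in> borel_measurable M \<and> integrable M (\<lambda>w. \<Psi> (f w)) \<and> (\<integral>w. \<Psi> (f w) \<partial>M) \<le> 1"
proof (cases "f \<in> borel_measurable M")
  case True
  note [measurable] = True
  have "(\<integral>\<^sup>+w. ennreal (\<Psi> (f w)) \<partial>M) \<le> 1 \<Longrightarrow> integrable M (\<lambda>w. \<Psi> (f w))"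
    by (rule integrableI_nonneg) (auto intro: le_less_trans)
  moreover have "integrable M (\<lambda>w. \<Psi> (f w)) \<Longrightarrow>
      (\<integral>\<^sup>+w. ennreal (\<Psi> (f w)) \<partial>M) \<le> 1 \<longleftrightarrow> (\<integral>w. \<Psi> (f w) \<partial>M) \<le> 1"
    by (subst nn_integral_eq_integral) auto
  ultimately show ?thesis using True by (auto simp: orlicz_ball_def)
qed (simp add: orlicz_ball_def)

lemma scaled_orlicz_ball_iff:
  assumes "l > 0"
  shows "f \<in> scaled_orlicz_ball M \<Psi> l \<longleftrightarrow> (\<lambda>w. f w / l) \<in> orlicz_ball M \<Psi>"
proof
  assume "(\<lambda>w. f w / l) \<in> orlicz_ball M \<Psi>"
  then have "(\<lambda>w. l * (f w / l)) \<in> scaled_orlicz_ball M \<Psi> l"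
    unfolding scaled_orlicz_ball_def by (rule imageI)
  then show "f \<in> scaled_orlicz_ball M \<Psi> l" using assms by simp
qed (use assms in \<open>auto simp: scaled_orlicz_ball_def\<close>)

text \<open>If the modular of c f is a finite number I, convexity lets the factor 1 / (1 + I) move
  it into the unit ball. Membership thus reduces to one finite modular at some scale, without
  reference to the norm.\<close>

lemma orlicz_space_iff:
  "f \<in> L \<Psi> \<longleftrightarrow>
    f \<in> borel_measurable M \<and> (\<exists>c>0. integrable M (\<lambda>w. \<Psi> (c * f w)))"
proof
  assume "f \<in> L \<Psi>"
  then obtain l where l: "l > 0" "(\<lambda>w. f w / l) \<in> orlicz_ball M \<Psi>"
    by (auto simp: orlicz_space_def scaled_orlicz_ball_iff)
  then have *: "(\<lambda>w. f w / l) \<in> borel_measurable M" "integrable M (\<lambda>w. \<Psi> (f w / l))"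
    by (auto simp: orlicz_ball_iff)
  have "(\<lambda>w. l * (f w / l)) \<in> borel_measurable M" using *(1) by measurable
  then show "f \<in> borel_measurable M \<and> (\<exists>c>0. integrable M (\<lambda>w. \<Psi> (c * f w)))"
    using l * by (auto intro!: exI[of _ "1 / l"])
next
  assume "f \<in> borel_measurable M \<and> (\<exists>c>0. integrable M (\<lambda>w. \<Psi> (c * f w)))"
  then obtain c where [measurable]: "f \<in> borel_measurable M"
    and c: "c > 0" "integrable M (\<lambda>w. \<Psi> (c * f w))" by blast
  define I where "I = (\<integral>w. \<Psi> (c * f w) \<partial>M)"
  define t where "t = 1 / (1 + I)"
  have I: "I \<ge> 0" by (simp add: I_def)
  then have t: "0 < t" "t \<le> 1" by (auto simp: t_def)
  have le: "\<Psi> (t * c * f w) \<le> t * \<Psi> (c * f w)" for w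
    using scale_le[of t "c * f w"] t by (simp add: mult.assoc)
  have int: "integrable M (\<lambda>w. \<Psi> (t * c * f w))"
    by (rule integrable_young_bound[of _ "\<lambda>w. t * \<Psi> (c * f w)"]) (use le c in auto)
  have "(\<integral>w. \<Psi> (t * c * f w) \<partial>M) \<le> (\<integral>w. t * \<Psi> (c * f w) \<partial>M)"
    by (intro integral_mono int le) (use c in auto)
  also have "\<dots> = I / (1 + I)" by (simp add: t_def I_def)
  also have "\<dots> \<le> 1" using I by simp
  finally have "f \<in> scaled_orlicz_ball M \<Psi> (1 / (t * c))"
    using t c int by (subst scaled_orlicz_ball_iff) (auto simp: orlicz_ball_iff mult.commute)
  then show "f \<in> L \<Psi>"
    using t c by (auto simp: orlicz_space_def intro!: bexI[of _ "1 / (t * c)"])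
qed

lemma orlicz_space_measurable [measurable_dest]: "f \<in> L \<Psi> \<Longrightarrow> f \<in> borel_measurable M"
  by (simp add: orlicz_space_iff)

lemma orlicz_space_solid:
  assumes "f \<in> L \<Psi>" and [measurable]: "g \<in> borel_measurable M"
    and "AE w in M. \<bar>g w\<bar> \<le> \<bar>f w\<bar>"
  shows "g \<in> L \<Psi>"
proof -
  obtain c where c: "c > 0" "integrable M (\<lambda>w. \<Psi> (c * f w))"
    using assms by (auto simp: orlicz_space_iff)
  have "integrable M (\<lambda>w. \<Psi> (c * g w))"
  proof (rule integrable_young_bound[OF _ c(2)])
    show "AE w in M. \<Psi> (c * g w) \<le> \<Psi> (c * f w)"
      using assms(3) by eventually_elim (use c in \<open>auto intro!: mono_abs simp: abs_mult\<close>)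
  qed simp
  then show ?thesis using c by (auto simp: orlicz_space_iff)
qed

lemma orlicz_space_cmult:
  assumes "f \<in> L \<Psi>"
  shows "(\<lambda>w. a * f w) \<in> L \<Psi>"
proof -
  obtain c where c: "c > 0" "integrable M (\<lambda>w. \<Psi> (c * f w))" and [measurable]: "f \<in> borel_measurable M"
    using assms by (auto simp: orlicz_space_iff)
  show ?thesis
  proof (cases "a = 0")
    case True
    then show ?thesis by (auto simp: orlicz_space_iff intro!: exI[of _ 1])
  next
    case False
    have "\<Psi> (c / \<bar>a\<bar> * (a * f w)) = \<Psi> (c * f w)" for w
      using False c mono_abs[of "c / \<bar>a\<bar> * (a * f w)" "c * f w"]
        mono_abs[of "c * f w" "c / \<bar>a\<bar> * (a * f w)"]
      by (simp add: abs_mult)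
    then show ?thesis using c False by (auto simp: orlicz_space_iff intro!: exI[of _ "c / \<bar>a\<bar>"])
  qed
qed

lemma orlicz_space_add:
  assumes "f \<in> L \<Psi>" "g \<in> L \<Psi>"
  shows "(\<lambda>w. f w + g w) \<in> L \<Psi>"
proof -
  note [measurable] = assms
  obtain c d where c: "c > 0" "integrable M (\<lambda>w. \<Psi> (c * f w))"
    and d: "d > 0" "integrable M (\<lambda>w. \<Psi> (d * g w))"
    using assms by (auto simp: orlicz_space_iff)
  define e where "e = min c d / 2"
  have "integrable M (\<lambda>w. \<Psi> (e * (f w + g w)))"
  proof (rule integrable_young_bound)
    show "integrable M (\<lambda>w. \<Psi> (c * f w) + \<Psi> (d * g w))" using c d by auto
    show "AE w in M. \<Psi> (e * (f w + g w)) \<le> \<Psi> (c * f w) + \<Psi> (d * g w)"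
    proof (rule AE_I2)
      fix w
      have "\<Psi> (e * (f w + g w)) = \<Psi> ((min c d * f w + min c d * g w) / 2)"
        by (simp add: e_def algebra_simps)
      also have "\<dots> \<le> (\<Psi> (min c d * f w) + \<Psi> (min c d * g w)) / 2" by (rule midpoint)
      also have "\<Psi> (min c d * f w) \<le> \<Psi> (c * f w)"
        using c d by (intro mono_abs) (auto simp: abs_mult intro!: mult_right_mono)
      also have "\<Psi> (min c d * g w) \<le> \<Psi> (d * g w)"
        using c d by (intro mono_abs) (auto simp: abs_mult intro!: mult_right_mono)
      also have "(\<Psi> (c * f w) + \<Psi> (d * g w)) / 2 \<le> \<Psi> (c * f w) + \<Psi> (d * g w)"
        by simp
      finally show "\<Psi> (e * (f w + g w)) \<le> \<Psi> (c * f w) + \<Psi> (d * g w)" by simp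
    qed
  qed simp
  moreover have "e > 0" using c d by (simp add: e_def)
  ultimately show ?thesis by (auto simp: orlicz_space_iff)
qed

lemma orlicz_space_diff:
  assumes "f \<in> L \<Psi>" "g \<in> L \<Psi>"
  shows "(\<lambda>w. f w - g w) \<in> L \<Psi>"
  using orlicz_space_add[OF assms(1) orlicz_space_cmult[OF assms(2), of "-1"]] by simp

lemma orlicz_space_zero: "(\<lambda>_. 0) \<in> L \<Psi>"
  by (auto simp: orlicz_space_iff intro!: exI[of _ 1])

lemma orlicz_space_sum:
  assumes "\<And>i. i \<in> I \<Longrightarrow> f i \<in> L \<Psi>"
  shows "(\<lambda>w. \<Sum>i\<in>I. f i w) \<in> L \<Psi>"
  using assms
  by (induction I rule: infinite_finite_induct) (auto intro: orlicz_space_zero orlicz_space_add)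

text \<open>The norm is an infimum that need not be known to be attained. A constant strictly above
  the bound is undercut by some admissible scale, and larger scales remain admissible by
  monotonicity.\<close>

lemma norm_bounded_seqD:
  assumes "norm_bounded_seq M \<Psi> \<xi>"
  obtains C where "C > 0" "\<And>n. (\<lambda>w. \<xi> n w / C) \<in> orlicz_ball M \<Psi>"
proof -
  obtain C where C: "\<And>n. \<xi> n \<in> L \<Psi>" "\<And>n. orlicz_norm M \<Psi> (\<xi> n) \<le> C"
    using assms by (auto simp: norm_bounded_seq_def)
  define C' where "C' = \<bar>C\<bar> + 1"
  show ?thesis
  proof (rule that[of C'])
    show "C' > 0" by (simp add: C'_def)
    fix n
    have ne: "{l. l > 0 \<and> \<xi> n \<in> scaled_orlicz_ball M \<Psi> l} \<noteq> {}"
      using C(1)[of n] by (auto simp: orlicz_space_def)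
    have "Inf {l. l > 0 \<and> \<xi> n \<in> scaled_orlicz_ball M \<Psi> l} < C'"
      using C(2)[of n] by (simp add: orlicz_norm_def C'_def)
    then obtain l where l: "l > 0" "\<xi> n \<in> scaled_orlicz_ball M \<Psi> l" "l < C'"
      using cInf_lessD[OF ne] by auto
    then have b: "(\<lambda>w. \<xi> n w / l) \<in> orlicz_ball M \<Psi>" by (simp add: scaled_orlicz_ball_iff)
    have [measurable]: "\<xi> n \<in> borel_measurable M" using C(1) by measurable
    have le: "\<Psi> (\<xi> n w / C') \<le> \<Psi> (\<xi> n w / l)" for w
      using l by (intro mono_abs) (auto intro!: divide_left_mono)
    have int: "integrable M (\<lambda>w. \<Psi> (\<xi> n w / C'))"
      by (rule integrable_young_bound[where g="\<lambda>w. \<Psi> (\<xi> n w / l)"])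
         (use b le in \<open>auto simp: orlicz_ball_iff\<close>)
    have "(\<integral>w. \<Psi> (\<xi> n w / C') \<partial>M) \<le> (\<integral>w. \<Psi> (\<xi> n w / l) \<partial>M)"
      by (intro integral_mono int le) (use b in \<open>auto simp: orlicz_ball_iff\<close>)
    then show "(\<lambda>w. \<xi> n w / C') \<in> orlicz_ball M \<Psi>"
      using b int by (auto simp: orlicz_ball_iff)
  qed
qed

lemma norm_bounded_seqI:
  assumes "\<And>n. \<xi> n \<in> orlicz_ball M \<Psi>"
  shows "norm_bounded_seq M \<Psi> \<xi>"
  unfolding norm_bounded_seq_def
proof (intro conjI allI exI[of _ 1])
  fix n
  have *: "\<xi> n \<in> scaled_orlicz_ball M \<Psi> 1" using assms by (simp add: scaled_orlicz_ball_iff)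
  then show "\<xi> n \<in> L \<Psi>" by (auto simp: orlicz_space_def)
  show "orlicz_norm M \<Psi> (\<xi> n) \<le> 1"
    unfolding orlicz_norm_def by (rule cInf_lower) (use * in \<open>auto intro!: bdd_belowI[of _ 0]\<close>)
qed

end

locale young_duality = young_space M \<Phi> for M :: "'a measure" and \<Phi> +
  fixes \<Psi> assumes conjugate: "\<Psi> = young_conjugate \<Phi>"
begin

sublocale dual: young_space M \<Psi>
  by standard (use young_conjugate conjugate in simp)

abbreviation weakly_compact :: "('a \<Rightarrow> real) set \<Rightarrow> bool" where
  "weakly_compact \<equiv> compactin (weak_topology M (L \<Phi>) (L \<Psi>))"

abbreviation weak_topo :: "('a \<Rightarrow> real) topology" where
  "weak_topo \<equiv> weak_topology M (L \<Psi>) (L \<Phi>)"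

abbreviation mackey_topo :: "('a \<Rightarrow> real) topology" where
  "mackey_topo \<equiv> mackey_topology M (L \<Psi>) (L \<Phi>)"

lemma integrable_pairing:
  assumes "\<eta> \<in> L \<Phi>" "\<xi> \<in> L \<Psi>"
  shows "integrable M (\<lambda>w. \<eta> w * \<xi> w)"
proof -
  note [measurable] = orlicz_space_measurable[OF assms(1)] dual.orlicz_space_measurable[OF assms(2)]
  obtain c d where c: "c > 0" "integrable M (\<lambda>w. \<Phi> (c * \<eta> w))"
    and d: "d > 0" "integrable M (\<lambda>w. \<Psi> (d * \<xi> w))"
    using assms by (auto simp: orlicz_space_iff dual.orlicz_space_iff)
  show ?thesis
  proof (rule Bochner_Integration.integrable_bound)
    show "integrable M (\<lambda>w. (\<Phi> (c * \<eta> w) + \<Psi> (d * \<xi> w)) / (c * d))" using c d by auto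
    show "AE w in M. norm (\<eta> w * \<xi> w) \<le> norm ((\<Phi> (c * \<eta> w) + \<Psi> (d * \<xi> w)) / (c * d))"
    proof (rule AE_I2)
      fix w
      have "c * d * \<bar>\<eta> w * \<xi> w\<bar> \<le> \<Phi> (c * \<eta> w) + \<Psi> (d * \<xi> w)"
        using young_ineq[of "c * \<eta> w" "d * \<xi> w"] c d by (simp add: conjugate abs_mult ac_simps)
      then show "norm (\<eta> w * \<xi> w) \<le> norm ((\<Phi> (c * \<eta> w) + \<Psi> (d * \<xi> w)) / (c * d))"
        using c d by (simp add: field_simps)
    qed
  qed simp
qed

lemma pairing_diff:
  assumes "\<eta> \<in> L \<Phi>" "\<xi> \<in> L \<Psi>" "\<zeta> \<in> L \<Psi>"
  shows "pairing M \<eta> (\<lambda>w. \<xi> w - \<zeta> w) = pairing M \<eta> \<xi> - pairing M \<eta> \<zeta>"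
  using integrable_pairing[OF assms(1,2)] integrable_pairing[OF assms(1,3)]
  by (simp add: pairing_def right_diff_distrib)

end

section \<open>Limits in topologies generated by a subbase\<close>

lemma pairing_commute: "pairing M f g = pairing M g f"
  by (simp add: pairing_def mult.commute)

text \<open>Being eventually inside a set that contains the limit survives finite intersections and
  arbitrary unions, so it only has to be checked on the subbase. The first premise places
  \<open>l\<close> in the underlying set, which is the union of the subbase.\<close>

lemma limitin_topology_generated_byI:
  assumes "l \<in> \<Union>S" "\<And>U. U \<in> S \<Longrightarrow> l \<in> U \<Longrightarrow> eventually (\<lambda>n. f n \<in> U) F"
  shows "limitin (topology_generated_by S) f l F"
  unfolding limitin_def
proof (intro conjI allI impI)
  fix U assume "openin (topology_generated_by S) U \<and> l \<in> U"
  then have "generate_topology_on S U" "l \<in> U" by (auto simp: openin_topology_generated_by_iff)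
  then show "eventually (\<lambda>n. f n \<in> U) F"
  proof induction
    case (Int a b)
    then show ?case by (auto intro: eventually_conj)
  next
    case (UN K)
    then obtain k where "k \<in> K" "l \<in> k" by blast
    with UN.IH have "eventually (\<lambda>n. f n \<in> k) F" by blast
    then show ?case by eventually_elim (use \<open>k \<in> K\<close> in blast)
  qed (use assms in auto)
qed (use assms in auto)

lemma topspace_weak_topology: "Y \<noteq> {} \<Longrightarrow> topspace (weak_topology M X Y) = X"
  unfolding weak_topology_def by auto

lemma openin_weak_topology:
  "\<eta> \<in> Y \<Longrightarrow> open U \<Longrightarrow> openin (weak_topology M X Y) {\<xi> \<in> X. pairing M \<eta> \<xi> \<in> U}"
  unfolding weak_topology_def by (intro topology_generated_by_Basis) blast

lemma limitin_weak_topologyD: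
  assumes "limitin (weak_topology M X Y) f l F" "\<eta> \<in> Y"
  shows "l \<in> X" "((\<lambda>n. pairing M \<eta> (f n)) \<longlongrightarrow> pairing M \<eta> l) F"
proof -
  show l: "l \<in> X"
    using assms limitin_topspace[OF assms(1)] topspace_weak_topology[of Y M X] by auto
  show "((\<lambda>n. pairing M \<eta> (f n)) \<longlongrightarrow> pairing M \<eta> l) F"
  proof (rule topological_tendstoI)
    fix U :: "real set" assume "open U" "pairing M \<eta> l \<in> U"
    then have "eventually (\<lambda>n. f n \<in> {\<xi> \<in> X. pairing M \<eta> \<xi> \<in> U}) F"
      using assms l openin_weak_topology[of \<eta> Y U M X] unfolding limitin_def by blast
    then show "eventually (\<lambda>n. pairing M \<eta> (f n) \<in> U) F" by eventually_elim auto
  qed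
qed

lemma limitin_weak_topologyI:
  assumes "l \<in> X" "Y \<noteq> {}" "\<And>n. f n \<in> X"
    "\<And>\<eta>. \<eta> \<in> Y \<Longrightarrow> ((\<lambda>n. pairing M \<eta> (f n)) \<longlongrightarrow> pairing M \<eta> l) F"
  shows "limitin (weak_topology M X Y) f l F"
  unfolding weak_topology_def
proof (rule limitin_topology_generated_byI)
  show "l \<in> \<Union>{{\<xi> \<in> X. pairing M \<eta> \<xi> \<in> U} |\<eta> U. \<eta> \<in> Y \<and> open U}"
    using assms topspace_weak_topology[of Y M X] unfolding weak_topology_def by auto
next
  fix V assume "V \<in> {{\<xi> \<in> X. pairing M \<eta> \<xi> \<in> U} |\<eta> U. \<eta> \<in> Y \<and> open U}" "l \<in> V"
  then obtain \<eta> U where V: "V = {\<xi> \<in> X. pairing M \<eta> \<xi> \<in> U}" "\<eta> \<in> Y" "open U" "pairing M \<eta> l \<in> U"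
    by auto
  have "eventually (\<lambda>n. pairing M \<eta> (f n) \<in> U) F"
    using topological_tendstoD[OF assms(4)[OF V(2)] V(3,4)] .
  then show "eventually (\<lambda>n. f n \<in> V) F"
    by eventually_elim (use V assms in auto)
qed

section \<open>Subsequences and truncation\<close>

text \<open>Bolzano-Weierstrass in every coordinate, combined by Cantor's diagonal argument: from
  index k + 1 on the diagonal is a subsequence of the k-th extraction.\<close>

lemma diagonal_convergent:
  fixes g :: "nat \<Rightarrow> nat \<Rightarrow> real"
  assumes "\<And>k. bounded (range (g k))"
  obtains s where "strict_mono (s :: nat \<Rightarrow> nat)" "\<And>k. convergent (\<lambda>n. g k (s n))"
proof -
  interpret subseqs "\<lambda>k s. convergent (\<lambda>n. g k (s n))"
  proof
    fix k and s :: "nat \<Rightarrow> nat"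
    have "bounded (range (\<lambda>n. g k (s n)))"
      by (rule bounded_subset[OF assms[of k]]) auto
    then obtain l r where "strict_mono r" "((\<lambda>n. g k (s n)) \<circ> r) \<longlonglongrightarrow> l"
      using bounded_imp_convergent_subsequence by blast
    then show "\<exists>r'. strict_mono r' \<and> convergent (\<lambda>n. g k ((s \<circ> r') n))"
      by (auto simp: convergent_def o_def)
  qed
  show ?thesis
  proof (rule that[OF subseq_diagseq])
    fix k
    have "convergent (\<lambda>n. g k ((diagseq \<circ> ((+) (Suc k))) n))"
    proof (rule diagseq_holds)
      fix r s :: "nat \<Rightarrow> nat" and n
      assume "strict_mono r" "convergent (\<lambda>m. g n (s m))"
      then show "convergent (\<lambda>m. g n ((s \<circ> r) m))"
        using convergent_subseq_convergent[of "\<lambda>m. g n (s m)" r] by (simp add: o_def)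
    qed
    then have "convergent (\<lambda>n. g k (diagseq (n + Suc k)))" by (simp add: add.commute)
    then show "convergent (\<lambda>n. g k (diagseq n))"
      using convergent_ignore_initial_segment[of "\<lambda>n. g k (diagseq n)" "Suc k"] by blast
  qed
qed

text \<open>The finitely many exceptional terms contribute a fixed amount S, which \<epsilon> (N +
  1) outweighs. An inequality is stated instead of a limit because the middle parts of the splitting
  are only eventually small, not convergent.\<close>

lemma cesaro_eventually_le:
  fixes u :: "nat \<Rightarrow> real"
  assumes "eventually (\<lambda>i. u i \<le> c) sequentially" "\<epsilon> > 0"
  shows "eventually (\<lambda>N. (\<Sum>i\<le>N. u i) / real (Suc N) \<le> c + \<epsilon>) sequentially"
proof -
  obtain n0 where n0: "\<And>i. i \<ge> n0 \<Longrightarrow> u i \<le> c"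
    using assms(1) by (auto simp: eventually_sequentially)
  define S where "S = (\<Sum>i<n0. \<bar>u i - c\<bar>)"
  have le: "(\<Sum>i\<le>N. u i - c) \<le> S" for N
  proof -
    have "(\<Sum>i\<le>N. u i - c) \<le> (\<Sum>i\<le>N. if i < n0 then \<bar>u i - c\<bar> else 0)"
      by (rule sum_mono) (use n0 in auto)
    also have "\<dots> = (\<Sum>i\<in>{i. i \<le> N \<and> i < n0}. \<bar>u i - c\<bar>)"
      by (subst sum.inter_filter [symmetric]) (auto intro: sum.cong)
    also have "\<dots> \<le> S" unfolding S_def by (rule sum_mono2) auto
    finally show ?thesis .
  qed
  obtain n1 :: nat where n1: "S / \<epsilon> \<le> real n1" using real_arch_simple by blast
  show ?thesis
    unfolding eventually_sequentially
  proof (intro exI[of _ n1] allI impI)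
    fix N assume "N \<ge> n1"
    then have "S / \<epsilon> \<le> real (Suc N)" using n1 by simp
    then have "S \<le> \<epsilon> * real (Suc N)" using assms(2) by (simp add: field_simps)
    moreover have "(\<Sum>i\<le>N. u i) \<le> S + c * real (Suc N)"
      using le[of N] by (simp add: sum_subtractf algebra_simps)
    ultimately have "(\<Sum>i\<le>N. u i) \<le> (c + \<epsilon>) * real (Suc N)" by (simp add: algebra_simps)
    then show "(\<Sum>i\<le>N. u i) / real (Suc N) \<le> c + \<epsilon>" by (simp add: divide_le_eq)
  qed
qed

lemma cesaro_null:
  fixes u :: "nat \<Rightarrow> real"
  assumes "u \<longlonglongrightarrow> 0"
  shows "(\<lambda>N. (\<Sum>i\<le>N. u i) / real (Suc N)) \<longlonglongrightarrow> 0"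
proof (rule LIMSEQ_I)
  fix e :: real assume e: "e > 0"
  have "eventually (\<lambda>i. \<bar>u i\<bar> \<le> e / 4) sequentially"
    using tendstoD[OF assms, of "e / 4"] e by (auto elim!: eventually_mono)
  then have "eventually (\<lambda>N. (\<Sum>i\<le>N. \<bar>u i\<bar>) / real (Suc N) \<le> e / 4 + e / 4) sequentially"
    by (rule cesaro_eventually_le) (use e in auto)
  then obtain n0 where n0: "\<And>N. N \<ge> n0 \<Longrightarrow> (\<Sum>i\<le>N. \<bar>u i\<bar>) / real (Suc N) \<le> e / 2"
    by (auto simp: eventually_sequentially)
  show "\<exists>no. \<forall>n\<ge>no. norm ((\<Sum>i\<le>n. u i) / real (Suc n) - 0) < e"
  proof (intro exI[of _ n0] allI impI)
    fix N assume "N \<ge> n0"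
    have "\<bar>\<Sum>i\<le>N. u i\<bar> / real (Suc N) \<le> (\<Sum>i\<le>N. \<bar>u i\<bar>) / real (Suc N)"
      by (intro divide_right_mono sum_abs) auto
    also have "\<dots> \<le> e / 2" by (rule n0[OF \<open>N \<ge> n0\<close>])
    also have "\<dots> < e" using e by simp
    finally show "norm ((\<Sum>i\<le>N. u i) / real (Suc N) - 0) < e" by simp
  qed
qed

text \<open>Large values are set to 0 and not clipped. Two truncations then differ only where the
  lower one vanishes, so \<Psi> is additive along the splitting and the modular of a difference is
  the difference of the modulars.\<close>

definition trunc :: "nat \<Rightarrow> real \<Rightarrow> real" where
  "trunc k x = (if \<bar>x\<bar> \<le> real k then x else 0)"

lemma measurable_trunc [measurable]: "trunc k \<in> borel_measurable borel"
  unfolding trunc_def by measurable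

lemma abs_trunc_le: "\<bar>trunc k x\<bar> \<le> real k" "\<bar>trunc k x\<bar> \<le> \<bar>x\<bar>"
  by (auto simp: trunc_def)

locale modular_sequence = young_space M \<Psi> for M :: "'a measure" and \<Psi> +
  fixes x :: "nat \<Rightarrow> 'a \<Rightarrow> real"
  assumes ball: "\<And>n. x n \<in> orlicz_ball M \<Psi>"
begin

lemma measurable_x [measurable]: "x n \<in> borel_measurable M"
  and integrable_x [simp, intro]: "integrable M (\<lambda>w. \<Psi> (x n w))"
  and modular_x: "(\<integral>w. \<Psi> (x n w) \<partial>M) \<le> 1"
  using ball[of n] by (auto simp: orlicz_ball_iff)

lemma modular_sequence_subseq: "modular_sequence M \<Psi> (\<lambda>n. x (r n))"
  by standard (rule ball)

lemma integrable_if [simp, intro]: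
  fixes G :: "'a \<Rightarrow> real"
  assumes "integrable M G" "Measurable.pred M P"
  shows "integrable M (\<lambda>w. if P w then G w else 0)"
  by (rule Bochner_Integration.integrable_bound[OF assms(1)]) (use assms in auto)

lemma integrable_bounded:
  assumes [measurable]: "f \<in> borel_measurable M" and "\<And>w. \<bar>f w\<bar> \<le> (C :: real)"
  shows "integrable M f"
  by (rule integrable_const_bound[of _ C]) (use assms in auto)

text \<open>The part of G above a height t has small integral by dominated convergence. Below t,
  Markov's inequality applies: coercivity bounds E|x n| by 1 + D, so the event has probability at
  most (1 + D) / B for every n at once.\<close>

lemma uniformly_small_tails:
  assumes [measurable, simp]: "integrable M G" and nn: "\<And>w. 0 \<le> (G w :: real)" and \<epsilon>: "\<epsilon> > 0"
  shows "\<exists>B0. \<forall>B\<ge>B0. \<forall>n. (\<integral>w. (if \<bar>x n w\<bar> > real B then G w else 0) \<partial>M) \<le> \<epsilon>"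
proof -
  have "(\<lambda>t. \<integral>w. (if G w > real t then G w else 0) \<partial>M) \<longlonglongrightarrow> (\<integral>w. 0 \<partial>M)"
  proof (rule integral_dominated_convergence[where w=G])
    show "AE w in M. (\<lambda>t. if G w > real t then G w else 0) \<longlonglongrightarrow> 0"
    proof (rule AE_I2)
      fix w
      obtain n :: nat where "G w \<le> real n" using real_arch_simple by blast
      then have "eventually (\<lambda>t. (if G w > real t then G w else 0) = 0) sequentially"
        by (auto simp: eventually_sequentially intro!: exI[of _ n])
      then show "(\<lambda>t. if G w > real t then G w else 0) \<longlonglongrightarrow> 0"
        by (rule tendsto_eventually)
    qed
  qed (use nn in \<open>auto intro!: AE_I2\<close>)
  then have "eventually (\<lambda>t. (\<integral>w. (if G w > real t then G w else 0) \<partial>M) < \<epsilon> / 2) sequentially"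
    using \<epsilon> by (auto dest: order_tendstoD(2)[of _ _ _ "\<epsilon> / 2"])
  then obtain t :: nat where t: "(\<integral>w. (if G w > real t then G w else 0) \<partial>M) < \<epsilon> / 2"
    by (auto simp: eventually_sequentially)
  obtain D where D: "D \<ge> 0" "\<And>y. \<bar>y\<bar> \<le> 1 * \<Psi> y + D" using abs_le_eps[of 1] by auto
  obtain B0 :: nat where B0: "2 * real t * (1 + D) / \<epsilon> \<le> real B0" using real_arch_simple by blast
  show ?thesis
  proof (intro exI[of _ "B0 + 1"] allI impI)
    fix B n :: nat assume "B0 + 1 \<le> B"
    then have B: "B > 0" "2 * real t * (1 + D) / \<epsilon> \<le> real B" using B0 by auto
    have "(\<integral>w. (if \<bar>x n w\<bar> > real B then G w else 0) \<partial>M)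
        \<le> (\<integral>w. (if G w > real t then G w else 0) + real t / real B * (\<Psi> (x n w) + D) \<partial>M)"
    proof (rule integral_mono)
      fix w
      have "real t \<le> real t / real B * (\<Psi> (x n w) + D)" if "\<bar>x n w\<bar> > real B"
      proof -
        have "real t = real t / real B * real B" using B by simp
        also have "\<dots> \<le> real t / real B * (\<Psi> (x n w) + D)"
          using that D(2)[of "x n w"] by (intro mult_left_mono) auto
        finally show ?thesis .
      qed
      moreover have "0 \<le> real t / real B * (\<Psi> (x n w) + D)" using D by simp
      ultimately show "(if \<bar>x n w\<bar> > real B then G w else 0)
        \<le> (if G w > real t then G w else 0) + real t / real B * (\<Psi> (x n w) + D)"
        using nn[of w] by auto
    qed auto
    also have "\<dots> = (\<integral>w. (if G w > real t then G w else 0) \<partial>M)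
        + real t / real B * ((\<integral>w. \<Psi> (x n w) \<partial>M) + D)"
      by (simp add: prob_space)
    also have "\<dots> \<le> \<epsilon> / 2 + real t / real B * (1 + D)"
      using t modular_x[of n] by (intro add_mono mult_left_mono) auto
    also have "real t / real B * (1 + D) \<le> \<epsilon> / 2"
      using B \<epsilon> by (simp add: field_simps)
    finally show "(\<integral>w. (if \<bar>x n w\<bar> > real B then G w else 0) \<partial>M) \<le> \<epsilon>" by simp
  qed
qed

abbreviation ip :: "nat \<Rightarrow> nat \<Rightarrow> nat \<Rightarrow> real" where
  "ip k i j \<equiv> \<integral>w. trunc k (x i w) * trunc k (x j w) \<partial>M"

lemma integrable_trunc_mult [simp, intro]:
  "integrable M (\<lambda>w. trunc k (x i w) * trunc k (x j w))"
  by (rule integrable_bounded[of _ "real k * real k"])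
     (auto simp: abs_mult intro!: mult_mono abs_trunc_le)

lemma abs_ip_le: "\<bar>ip k i j\<bar> \<le> real k * real k"
proof -
  have "\<bar>ip k i j\<bar> \<le> (\<integral>w. \<bar>trunc k (x i w) * trunc k (x j w)\<bar> \<partial>M)"
    by (rule integral_abs_bound)
  also have "\<dots> \<le> (\<integral>w. real k * real k \<partial>M)"
    by (rule integral_mono[OF integrable_abs[OF integrable_trunc_mult]])
       (auto simp: abs_mult intro!: mult_mono abs_trunc_le)
  finally show ?thesis by (simp add: prob_space)
qed

lemma integrable_young_trunc [simp, intro]: "integrable M (\<lambda>w. \<Psi> (trunc k (x n w)))"
  by (rule integrable_young_bound[of _ "\<lambda>w. \<Psi> (x n w)"]) (auto intro!: mono_abs abs_trunc_le)

lemma modular_trunc: "(\<integral>w. \<Psi> (trunc k (x n w)) \<partial>M) \<le> 1"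
proof -
  have "(\<integral>w. \<Psi> (trunc k (x n w)) \<partial>M) \<le> (\<integral>w. \<Psi> (x n w) \<partial>M)"
    by (rule integral_mono) (auto intro!: mono_abs abs_trunc_le)
  then show ?thesis using modular_x[of n] by linarith
qed

text \<open>Two extractions are composed: one makes the inner products with each fixed term
  converge, the other makes these limits converge in turn. In the result the matrix of inner
  products is nearly one constant away from the diagonal.\<close>

lemma convergent_subsequence:
  "\<exists>q \<alpha> \<alpha>' \<phi>. strict_mono (q :: nat \<Rightarrow> nat) \<and>
    (\<forall>k i. (\<lambda>j. ip k (q i) (q j)) \<longlonglongrightarrow> \<alpha> k i) \<and> (\<forall>k. \<alpha> k \<longlonglongrightarrow> \<alpha>' k) \<and>
    (\<forall>k. (\<lambda>n. \<integral>w. \<Psi> (trunc k (x (q n) w)) \<partial>M) \<longlonglongrightarrow> \<phi> k)"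
proof -
  \<comment> \<open>One countable family encodes both requirements: slot (k, 0) holds the modular of
    the truncation and slot (k, i + 1) the inner products with the i-th term.\<close>
  define g where "g = (\<lambda>p n. case prod_decode p of (k, i) \<Rightarrow>
    if i = 0 then \<integral>w. \<Psi> (trunc k (x n w)) \<partial>M else ip k (i - 1) n)"
  have "bounded (range (g p))" for p
  proof (cases "prod_decode p")
    case (Pair k i)
    have "norm (g p n) \<le> 1 + real k * real k" for n
      using Pair modular_trunc[of k n] abs_ip_le[of k "i - 1" n]
      by (auto simp: g_def intro: order_trans)
    then show ?thesis by (auto intro!: boundedI)
  qed
  then obtain s where s: "strict_mono (s :: nat \<Rightarrow> nat)" "\<And>p. convergent (\<lambda>n. g p (s n))"
    using diagonal_convergent[of g] by metis
  have "convergent (\<lambda>n. ip k i (s n))" for k i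
    using s(2)[of "prod_encode (k, i + 1)"] by (simp add: g_def)
  then obtain a where a: "\<And>k i. (\<lambda>n. ip k i (s n)) \<longlonglongrightarrow> a k i"
    unfolding convergent_def by metis
  have "convergent (\<lambda>n. \<integral>w. \<Psi> (trunc k (x (s n) w)) \<partial>M)" for k
    using s(2)[of "prod_encode (k, 0)"] by (simp add: g_def)
  then obtain \<phi> where \<phi>: "\<And>k. (\<lambda>n. \<integral>w. \<Psi> (trunc k (x (s n) w)) \<partial>M) \<longlonglongrightarrow> \<phi> k"
    unfolding convergent_def by metis
  have "\<bar>a k i\<bar> \<le> real k * real k" for k i
    by (rule LIMSEQ_le_const2[OF tendsto_rabs[OF a]]) (auto intro: abs_ip_le)
  then have "bounded (range (\<lambda>i. a k (s i)))" for k
    by (auto intro!: boundedI)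
  then obtain t where t: "strict_mono (t :: nat \<Rightarrow> nat)" "\<And>k. convergent (\<lambda>i. a k (s (t i)))"
    using diagonal_convergent[of "\<lambda>k i. a k (s i)"] by metis
  then obtain \<alpha>' where \<alpha>': "\<And>k. (\<lambda>i. a k (s (t i))) \<longlonglongrightarrow> \<alpha>' k"
    unfolding convergent_def by metis
  show ?thesis
  proof (intro exI conjI allI)
    show "strict_mono (s \<circ> t)" using s t by (simp add: strict_mono_o)
    show "(\<lambda>j. ip k ((s \<circ> t) i) ((s \<circ> t) j)) \<longlonglongrightarrow> a k (s (t i))" for k i
      using LIMSEQ_subseq_LIMSEQ[OF a t(1)] by (simp add: o_def)
    show "(\<lambda>n. \<integral>w. \<Psi> (trunc k (x ((s \<circ> t) n) w)) \<partial>M) \<longlonglongrightarrow> \<phi> k" for k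
      using LIMSEQ_subseq_LIMSEQ[OF \<phi> t(1)] by (simp add: o_def)
  qed (rule \<alpha>')
qed

end

lemma young_space_trunc_diff:
  assumes "young \<Psi>" "k \<le> b"
  shows "\<Psi> (trunc b x - trunc k x) = \<Psi> (trunc b x) - \<Psi> (trunc k x)"
  using assms young.zero by (auto simp: trunc_def)

text \<open>A subsequence splitting in the spirit of Kadec and Pelczynski. Each x i is cut at a
  fixed level k and at its own level b i. The error of the inner products depends on the smaller
  index only. The level k controlling the middle parts is the same for all late i. The last
  smallness condition says that the set where x l is large carries little modular of all earlier
  functions, a substitute for disjoint tails.\<close>

locale split_sequence = modular_sequence M \<Psi> x for M :: "'a measure" and \<Psi> x +
  fixes b :: "nat \<Rightarrow> nat"
  assumes level_ge: "\<And>l. l \<le> b l"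
    and almost_constant_ip:
      "\<And>k. \<exists>a \<delta>. \<delta> \<longlonglongrightarrow> 0 \<and> (\<forall>i j. i < j \<longrightarrow> \<bar>ip k i j - a\<bar> \<le> \<delta> i)"
    and small_middle: "\<And>\<epsilon>. \<epsilon> > 0 \<Longrightarrow> \<exists>k. eventually (\<lambda>i.
       (\<integral>w. \<Psi> (trunc (b i) (x i w) - trunc k (x i w)) \<partial>M) \<le> \<epsilon>) sequentially"
    and small_overlap: "\<And>l. l > 0 \<Longrightarrow>
       (\<Sum>i<l. \<integral>w. (if \<bar>x l w\<bar> > real (b l) then \<Psi> (x i w) else 0) \<partial>M) \<le> 1 / real l"
    and nabla2: "nabla2 \<Psi>"

section \<open>Extraction of the splitting subsequence\<close>

context modular_sequence
begin

text \<open>The limiting truncated modulars \<phi> k increase to some \<beta>. If the index is late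
  compared with the upper level, the modular carried by values between k and that level is nearly at
  most \<beta> - \<phi> k, which is small for large k. Modular that escapes to infinity ends up
  above the level, in the tail.\<close>

lemma splitting_subsequence:
  assumes "nabla2 \<Psi>"
  shows "\<exists>r b. strict_mono r \<and> split_sequence M \<Psi> (\<lambda>n. x (r n)) b"
proof -
  obtain q \<alpha> \<alpha>' \<phi> where *: "strict_mono (q :: nat \<Rightarrow> nat) \<and>
    (\<forall>k i. (\<lambda>j. ip k (q i) (q j)) \<longlonglongrightarrow> \<alpha> k i) \<and> (\<forall>k. \<alpha> k \<longlonglongrightarrow> \<alpha>' k) \<and>
    (\<forall>k. (\<lambda>n. \<integral>w. \<Psi> (trunc k (x (q n) w)) \<partial>M) \<longlonglongrightarrow> \<phi> k)"
    using convergent_subsequence by (elim exE)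
  then have q: "strict_mono q"
    and ip_lim: "\<And>k i. (\<lambda>j. ip k (q i) (q j)) \<longlonglongrightarrow> \<alpha> k i" and \<alpha>_lim: "\<And>k. \<alpha> k \<longlonglongrightarrow> \<alpha>' k"
    and \<phi>_lim: "\<And>k. (\<lambda>n. \<integral>w. \<Psi> (trunc k (x (q n) w)) \<partial>M) \<longlonglongrightarrow> \<phi> k"
    by simp_all
  define \<psi> where "\<psi> = (\<lambda>k n. \<integral>w. \<Psi> (trunc k (x (q n) w)) \<partial>M)"
  have \<phi>_le: "\<phi> k \<le> 1" for k
    by (rule LIMSEQ_le_const2[OF \<phi>_lim]) (auto intro: modular_trunc)
  have \<phi>_mono: "\<phi> k \<le> \<phi> k'" if "k \<le> k'" for k k'
  proof (rule LIMSEQ_le[OF \<phi>_lim \<phi>_lim], intro exI allI impI integral_mono)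
    fix n w show "\<Psi> (trunc k (x (q n) w)) \<le> \<Psi> (trunc k' (x (q n) w))"
      using that by (intro mono_abs) (auto simp: trunc_def)
  qed auto
  obtain \<beta> where \<beta>: "\<phi> \<longlonglongrightarrow> \<beta>" "\<And>k. \<phi> k \<le> \<beta>"
    using incseq_convergent[of \<phi> 1] \<phi>_le \<phi>_mono by (auto simp: incseq_def)
  \<comment> \<open>The bound holds for all \<open>n\<close> simultaneously, so the level
    \<open>B m\<close> can be fixed before the next function of the subsequence is chosen.\<close>
  define isB where "isB = (\<lambda>m B. m < B \<and> (\<forall>n.
    (\<integral>w. (if \<bar>x n w\<bar> > real B then \<Sum>i\<le>m. \<Psi> (x (q i) w) else 0) \<partial>M) \<le> 1 / real (Suc m)))"
  have "\<exists>B. isB m B" for m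
  proof -
    obtain B0 where "\<And>B n. B \<ge> B0 \<Longrightarrow>
        (\<integral>w. (if \<bar>x n w\<bar> > real B then \<Sum>i\<le>m. \<Psi> (x (q i) w) else 0) \<partial>M) \<le> 1 / real (Suc m)"
      using uniformly_small_tails[of "\<lambda>w. \<Sum>i\<le>m. \<Psi> (x (q i) w)" "1 / real (Suc m)"]
      by (auto simp: sum_nonneg)
    then show ?thesis by (intro exI[of _ "max B0 (Suc m)"]) (auto simp: isB_def)
  qed
  then obtain B where B: "\<And>m. isB m (B m)" by metis
  note B_gt = B[unfolded isB_def, THEN conjunct1]
    and B_small = B[unfolded isB_def, THEN conjunct2, rule_format]
  \<comment> \<open>The levels come first: only once \<open>B m\<close> is known can an index be
    found beyond which the truncated modulars at all levels up to \<open>B m\<close> are close to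
    their limits.\<close>
  define good where "good = (\<lambda>m n. (\<forall>k\<in>{..B m}. \<bar>\<psi> k n - \<phi> k\<bar> < 1 / real (Suc m)) \<and>
      (\<forall>i\<in>{..m}. \<forall>k\<in>{..m}. \<bar>ip k (q i) (q n) - \<alpha> k i\<bar> < 1 / real (Suc m)))"
  have "\<exists>R>m. \<forall>n\<ge>R. good m n" for m
  proof -
    have "eventually (good m) sequentially"
      unfolding good_def \<psi>_def dist_real_def [symmetric]
      by (intro eventually_conj eventually_ball_finite ballI tendstoD[OF \<phi>_lim] tendstoD[OF ip_lim]) auto
    then obtain R where "\<And>n. n \<ge> R \<Longrightarrow> good m n" by (auto simp: eventually_sequentially)
    then show ?thesis by (intro exI[of _ "max R (Suc m)"]) auto
  qed
  then obtain R where R_gt: "\<And>m. R m > m" and R: "\<And>m n. n \<ge> R m \<Longrightarrow> good m n" by metis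
  have R1: "\<bar>\<psi> k n - \<phi> k\<bar> < 1 / real (Suc m)" if "n \<ge> R m" "k \<le> B m" for m n k
    using R[OF that(1)] that(2) by (simp add: good_def)
  have R2: "\<bar>ip k (q i) (q n) - \<alpha> k i\<bar> < 1 / real (Suc m)" if "n \<ge> R m" "i \<le> m" "k \<le> m" for m n i k
    using R[OF that(1)] that(2,3) by (simp add: good_def)
  define p where "p = (\<lambda>l. (R ^^ l) 0)"
  have p_Suc: "p (Suc l) = R (p l)" for l by (simp add: p_def)
  have p: "strict_mono p" unfolding strict_mono_Suc_iff by (simp add: p_Suc R_gt)
  then have p_ge: "l \<le> p l" for l by (rule seq_suble)
  have p_mono: "i \<le> j \<Longrightarrow> p i \<le> p j" for i j using p by (simp add: strict_mono_less_eq)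
  \<comment> \<open>The level of a selected function belongs to the index selected before it.
    \<open>B (p l)\<close> limits the overlap with every index up to \<open>p l\<close>, and
    \<open>p (Suc l) = R (p l)\<close> is late enough for all levels up to \<open>B (p l)\<close>.
    The value at 0 is a default satisfying \<open>level_ge\<close>.\<close>
  define b where "b = (\<lambda>l. case l of 0 \<Rightarrow> 0 | Suc l' \<Rightarrow> B (p l'))"
  have b_Suc: "b (Suc l) = B (p l)" for l by (simp add: b_def)
  have b_ge: "l \<le> b l" for l
    using B_gt[of "p (l - 1)"] p_ge[of "l - 1"] by (cases l) (auto simp: b_def)
  have "split_sequence M \<Psi> (\<lambda>n. x ((q \<circ> p) n)) b"
  proof (intro split_sequence.intro modular_sequence_subseq split_sequence_axioms.intro)
    show "\<exists>a \<delta>. \<delta> \<longlonglongrightarrow> 0 \<and> (\<forall>i j. i < j \<longrightarrow> \<bar>ip k ((q \<circ> p) i) ((q \<circ> p) j) - a\<bar> \<le> \<delta> i)" for k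
    proof -
      \<comment> \<open>The estimate \<open>R2\<close> reaches level k only when k is at most the
        controlling index. The finitely many i < k receive the crude bound k^2 on inner products,
        which does not affect the limit.\<close>
      define \<delta> where "\<delta> = (\<lambda>i. if i < k then real k * real k + \<bar>\<alpha>' k\<bar> else 1 / real (Suc i) + \<bar>\<alpha> k (p i) - \<alpha>' k\<bar>)"
      have "(\<lambda>i. 1 / real (Suc i) + \<bar>\<alpha> k (p i) - \<alpha>' k\<bar>) \<longlonglongrightarrow> 0 + \<bar>\<alpha>' k - \<alpha>' k\<bar>"
        using LIMSEQ_subseq_LIMSEQ[OF \<alpha>_lim p] unfolding o_def
        by (intro tendsto_intros LIMSEQ_Suc[OF lim_1_over_n])
      moreover have "eventually (\<lambda>i. 1 / real (Suc i) + \<bar>\<alpha> k (p i) - \<alpha>' k\<bar> = \<delta> i) sequentially"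
        by (auto simp: \<delta>_def eventually_sequentially intro!: exI[of _ k])
      ultimately have "\<delta> \<longlonglongrightarrow> 0" using tendsto_cong by force
      moreover have "\<bar>ip k (q (p i)) (q (p j)) - \<alpha>' k\<bar> \<le> \<delta> i" if "i < j" for i j
      proof (cases "i < k")
        case True
        then show ?thesis using abs_ip_le[of k "q (p i)" "q (p j)"] by (simp add: \<delta>_def)
      next
        case False
        have "j > 0" using that by simp
        then obtain j' where j: "j = Suc j'" using gr0_implies_Suc by blast
        have "\<bar>ip k (q (p i)) (q (p j)) - \<alpha> k (p i)\<bar> < 1 / real (Suc (p j'))"
          using that False p_ge[of j'] by (intro R2) (auto simp: j p_Suc intro: p_mono)
        also have "\<dots> \<le> 1 / real (Suc i)"
          using that p_ge[of j'] by (intro divide_left_mono) (auto simp: j)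
        finally show ?thesis using False by (simp add: \<delta>_def)
      qed
      ultimately show ?thesis by auto
    qed
    show "\<exists>k. eventually (\<lambda>i. (\<integral>w. \<Psi> (trunc (b i) (x ((q \<circ> p) i) w) - trunc k (x ((q \<circ> p) i) w)) \<partial>M) \<le> \<epsilon>) sequentially"
      if \<epsilon>: "\<epsilon> > 0" for \<epsilon>
    proof -
      obtain k where k: "\<beta> - \<phi> k < \<epsilon> / 2"
      proof -
        have "\<exists>k. \<beta> - \<epsilon> / 2 < \<phi> k"
          using \<epsilon> by (intro eventually_happens'[OF _ order_tendstoD(1)[OF \<beta>(1)]]) auto
        then obtain k where "\<beta> - \<epsilon> / 2 < \<phi> k" ..
        then show thesis by (intro that[of k]) linarith
      qed
      obtain n0 :: nat where n0: "4 / \<epsilon> \<le> real n0" using real_arch_simple by blast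
      have "(\<integral>w. \<Psi> (trunc (b i) (x (q (p i)) w) - trunc k (x (q (p i)) w)) \<partial>M) \<le> \<epsilon>"
        if i: "i \<ge> max k (n0 + 1)" for i
      proof -
        obtain i' where i': "i = Suc i'" using i by (cases i) auto
        have kb: "k \<le> b i" using b_ge[of i] i by linarith
        have "(\<integral>w. \<Psi> (trunc (b i) (x (q (p i)) w) - trunc k (x (q (p i)) w)) \<partial>M) = \<psi> (b i) (p i) - \<psi> k (p i)"
          unfolding \<psi>_def young_space_trunc_diff[OF young_axioms kb]
          by (rule Bochner_Integration.integral_diff) auto
        \<comment> \<open>Each of the two levels k and \<open>b i = B (p i')\<close> contributes one
          error 1 / (p i' + 1).\<close>
        also have "\<dots> \<le> \<phi> (b i) - \<phi> k + 2 / real (Suc (p i'))"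
          using R1[of "p i'" "p i" "b i"] R1[of "p i'" "p i" k] kb unfolding i' b_Suc p_Suc
          by (simp add: abs_less_iff)
        also have "\<dots> \<le> \<epsilon> / 2 + 2 / real (Suc (p i'))"
          using k \<beta>(2)[of "b i"] by simp
        also have "2 / real (Suc (p i')) \<le> \<epsilon> / 2"
        proof -
          have "4 / \<epsilon> \<le> real (Suc (p i'))" using n0 i p_ge[of i'] by (simp add: i')
          then show ?thesis using \<epsilon> by (simp add: field_simps)
        qed
        finally show ?thesis by simp
      qed
      then have "eventually (\<lambda>i. (\<integral>w. \<Psi> (trunc (b i) (x (q (p i)) w) - trunc k (x (q (p i)) w)) \<partial>M) \<le> \<epsilon>) sequentially"
        by (rule eventually_sequentiallyI)
      then show ?thesis unfolding o_def by (rule exI)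
    qed
    show "(\<Sum>i<l. \<integral>w. (if \<bar>x ((q \<circ> p) l) w\<bar> > real (b l) then \<Psi> (x ((q \<circ> p) i) w) else 0) \<partial>M) \<le> 1 / real l"
      if l: "l > 0" for l
    proof -
      obtain l' where l': "l = Suc l'" using l by (cases l) auto
      define F where "F = (\<lambda>i. \<integral>w. (if \<bar>x (q (p l)) w\<bar> > real (b l) then \<Psi> (x (q i) w) else 0) \<partial>M)"
      have "(\<Sum>i<l. F (p i)) = sum F (p ` {..<l})"
        using strict_mono_imp_inj_on[OF p] by (subst sum.reindex) (auto intro: inj_on_subset)
      also have "\<dots> \<le> sum F {..p l'}"
        by (rule sum_mono2) (auto simp: F_def l' intro!: integral_nonneg_AE p_mono)
      also have "\<dots> = (\<integral>w. (\<Sum>i\<le>p l'. if \<bar>x (q (p l)) w\<bar> > real (b l) then \<Psi> (x (q i) w) else 0) \<partial>M)"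
        unfolding F_def by (rule Bochner_Integration.integral_sum [symmetric]) auto
      also have "\<dots> = (\<integral>w. (if \<bar>x (q (p l)) w\<bar> > real (b l) then \<Sum>i\<le>p l'. \<Psi> (x (q i) w) else 0) \<partial>M)"
        by (intro Bochner_Integration.integral_cong) auto
      also have "\<dots> \<le> 1 / real (Suc (p l'))" unfolding l' b_Suc by (rule B_small)
      also have "\<dots> \<le> 1 / real l" using p_ge[of l'] by (intro divide_left_mono) (auto simp: l')
      finally show ?thesis unfolding F_def o_def .
    qed
  qed (rule b_ge assms)+
  with strict_mono_o[OF q p] show ?thesis by (intro exI conjI)
qed

end

section \<open>Convergence of the Cesaro means\<close>

context split_sequence
begin

lemma measurable_cesaro [measurable]:
  assumes [measurable]: "\<And>i. u i \<in> borel_measurable M"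
  shows "cesaro_means u N \<in> borel_measurable M"
  unfolding cesaro_means_def by measurable

text \<open>If all off-diagonal inner products equalled a, the inner product of any two means would
  be a up to a diagonal contribution. In the expansion of the squared distance the constant then
  cancels: a - 2 a + a = 0. The error e collects the averaged deviations \<delta> and the diagonal,
  whose weight is of order 1 / (N + 1).\<close>

lemma truncated_cauchy:
  "\<exists>e. e \<longlonglongrightarrow> 0 \<and> (\<forall>N P. (\<integral>w. (cesaro_means (\<lambda>i w. trunc k (x i w)) N w
      - cesaro_means (\<lambda>i w. trunc k (x i w)) P w)\<^sup>2 \<partial>M) \<le> e N + e P)"
proof -
  obtain a \<delta> where \<delta>: "\<delta> \<longlonglongrightarrow> 0" and ip: "\<And>i j. i < j \<Longrightarrow> \<bar>ip k i j - a\<bar> \<le> \<delta> i"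
    using almost_constant_ip[of k] by blast
  define C where "C = real k * real k + \<bar>a\<bar>"
  define A where "A = (\<lambda>N. (\<Sum>i\<le>N. \<delta> i) / real (Suc N))"
  define e where "e = (\<lambda>N. A N + C / real (Suc N))"
  have \<delta>_nn: "0 \<le> \<delta> i" for i using ip[of i "Suc i"] by linarith
  have C: "C \<ge> 0" by (simp add: C_def)
  have A: "A \<longlonglongrightarrow> 0" unfolding A_def by (rule cesaro_null[OF \<delta>])
  have "(\<lambda>N. C / real (Suc N)) \<longlonglongrightarrow> 0" by (rule LIMSEQ_Suc[OF lim_const_over_n])
  then have e: "e \<longlonglongrightarrow> 0" unfolding e_def using tendsto_add[OF A] by fastforce
  define m where "m = cesaro_means (\<lambda>i w. trunc k (x i w))"
  have dev: "\<bar>ip k i j - a\<bar> \<le> \<delta> i + \<delta> j + (if i = j then C else 0)" for i j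
  proof -
    consider "i < j" | "j < i" | "i = j" by linarith
    then show ?thesis
    proof cases
      case 1 then show ?thesis using ip[OF 1] \<delta>_nn[of j] by simp
    next
      case 2 then show ?thesis using ip[OF 2] \<delta>_nn[of i] by (simp add: mult.commute)
    next
      case 3
      have "\<bar>ip k j j - a\<bar> \<le> C"
        using abs_ip_le[of k j j] abs_triangle_ineq4[of "ip k j j" a] unfolding C_def by linarith
      then show ?thesis using \<delta>_nn[of j] 3 by simp
    qed
  qed
  define G where "G = (\<lambda>N P. \<integral>w. m N w * m P w \<partial>M)"
  have m_mult: "m N w * m P w = (\<Sum>i\<le>N. \<Sum>j\<le>P. trunc k (x i w) * trunc k (x j w)) / (real (Suc N) * real (Suc P))"
    for N P w
    by (simp add: m_def cesaro_means_def sum_product del: of_nat_Suc)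
  have int_m: "integrable M (\<lambda>w. m N w * m P w)" for N P
    unfolding m_mult by auto
  have G_eq: "G N P = (\<Sum>i\<le>N. \<Sum>j\<le>P. ip k i j) / (real (Suc N) * real (Suc P))" for N P
    unfolding G_def m_mult by simp
  have G_dev: "\<bar>G N P - a\<bar> \<le> e N + e P" for N P
  proof -
    define n where "n = real (Suc N)"
    define p where "p = real (Suc P)"
    have np: "n > 0" "p > 0" by (auto simp: n_def p_def)
    have "(\<Sum>i\<le>N. \<Sum>j\<le>P. ip k i j - a) = (\<Sum>i\<le>N. \<Sum>j\<le>P. ip k i j) - n * p * a"
      by (simp add: sum_subtractf n_def p_def algebra_simps)
    then have "G N P - a = (\<Sum>i\<le>N. \<Sum>j\<le>P. ip k i j - a) / (n * p)"
      using np unfolding G_eq n_def[symmetric] p_def[symmetric] by (simp add: field_simps)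
    also have "\<bar>\<dots>\<bar> \<le> (\<Sum>i\<le>N. \<Sum>j\<le>P. \<delta> i + \<delta> j + (if i = j then C else 0)) / (n * p)"
    proof -
      have "\<bar>\<Sum>i\<le>N. \<Sum>j\<le>P. ip k i j - a\<bar> \<le> (\<Sum>i\<le>N. \<Sum>j\<le>P. \<bar>ip k i j - a\<bar>)"
        by (intro order_trans[OF sum_abs] sum_mono order_trans[OF sum_abs] order_refl)
      also have "\<dots> \<le> (\<Sum>i\<le>N. \<Sum>j\<le>P. \<delta> i + \<delta> j + (if i = j then C else 0))"
        by (intro sum_mono dev)
      finally show ?thesis using np by (simp add: abs_divide abs_mult divide_right_mono)
    qed
    also have "(\<Sum>i\<le>N. \<Sum>j\<le>P. \<delta> i + \<delta> j + (if i = j then C else 0))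
        = p * (\<Sum>i\<le>N. \<delta> i) + n * (\<Sum>j\<le>P. \<delta> j) + (\<Sum>i\<le>N. if i \<le> P then C else 0)"
      by (simp add: sum.distrib sum_distrib_left n_def p_def sum.delta)
    also have "(\<Sum>i\<le>N. if i \<le> P then C else 0) \<le> (\<Sum>i\<le>N. C)"
      using C by (intro sum_mono) auto
    also have "(\<Sum>i\<le>N. C) = n * C" by (simp add: n_def)
    also have "(p * (\<Sum>i\<le>N. \<delta> i) + n * (\<Sum>j\<le>P. \<delta> j) + n * C) / (n * p) = A N + A P + C / p"
      using np unfolding A_def n_def[symmetric] p_def[symmetric] by (simp add: field_simps)
    also have "A N + A P + C / p \<le> e N + e P"
      using C by (simp add: e_def p_def)
    finally show ?thesis using np by (simp add: divide_right_mono)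
  qed
  \<comment> \<open>The two squared norms deviate from a by 2 e N and 2 e P, and the doubled mixed
    term by 2 (e N + e P), hence the factor 4.\<close>
  have "(\<integral>w. (m N w - m P w)\<^sup>2 \<partial>M) \<le> 4 * e N + 4 * e P" for N P
  proof -
    have "(\<integral>w. (m N w - m P w)\<^sup>2 \<partial>M) = (\<integral>w. m N w * m N w - 2 * (m N w * m P w) + m P w * m P w \<partial>M)"
      by (intro Bochner_Integration.integral_cong) (auto simp: power2_eq_square algebra_simps)
    also have "\<dots> = G N N - 2 * G N P + G P P"
      using int_m by (simp add: G_def)
    also have "\<dots> \<le> 4 * e N + 4 * e P"
      using G_dev[of N N] G_dev[of N P] G_dev[of P P] by linarith
    finally show ?thesis .
  qed
  moreover have "(\<lambda>N. 4 * e N) \<longlonglongrightarrow> 0" using tendsto_mult_left[OF e, of 4] by simp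
  ultimately show ?thesis unfolding m_def by blast
qed

section \<open>Cesaro means of the tails\<close>

definition tail :: "nat \<Rightarrow> 'a \<Rightarrow> real" where
  "tail i w = x i w - trunc (b i) (x i w)"

lemma measurable_tail [measurable]: "tail i \<in> borel_measurable M"
  unfolding tail_def by measurable

lemma tail_eq: "tail i w = (if \<bar>x i w\<bar> > real (b i) then x i w else 0)"
  by (auto simp: tail_def trunc_def)

lemma young_tail_le: "\<Psi> (tail i w) \<le> \<Psi> (x i w)"
  by (simp add: tail_eq)

lemma integrable_young_tail [simp, intro]: "integrable M (\<lambda>w. \<Psi> (tail i w))"
  by (rule integrable_young_bound[of _ "\<lambda>w. \<Psi> (x i w)"]) (auto intro: young_tail_le)

lemma integrable_of_young:
  assumes "integrable M (\<lambda>w. \<Psi> (f w))" and [measurable]: "f \<in> borel_measurable M"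
  shows "integrable M f"
proof -
  obtain D where D: "D \<ge> 0" "\<And>y. \<bar>y\<bar> \<le> 1 * \<Psi> y + D" using abs_le_eps[of 1] by auto
  show ?thesis
    by (rule Bochner_Integration.integrable_bound[of _ "\<lambda>w. \<Psi> (f w) + D"])
       (use assms D in \<open>auto simp: abs_of_nonneg\<close>)
qed

text \<open>On the set where \<open>l\<close> is the last index with a nonvanishing tail, the tails with a smaller
  index contribute little because that set is small, and the \<open>l\<close>-th tail is divided by \<open>N\<close>.\<close>

lemma young_tail_mean_le:
  "\<Psi> (cesaro_means tail N w / 2) \<le>
     (\<Sum>l\<le>N. \<Psi> (tail l w / real (Suc N))) / 2 +
     (\<Sum>l\<le>N. \<Sum>i<l. if \<bar>x l w\<bar> > real (b l) then \<Psi> (x i w) else 0) / real (Suc N)"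
  (is "?lhs \<le> ?A / 2 + ?B / _")
proof (cases "\<exists>l\<le>N. \<bar>x l w\<bar> > real (b l)")
  case False
  then have "cesaro_means tail N w = 0" by (simp add: cesaro_means_def tail_eq)
  then show ?thesis by (auto intro!: add_nonneg_nonneg sum_nonneg divide_nonneg_nonneg)
next
  case True
  define l where "l = Max {l. l \<le> N \<and> \<bar>x l w\<bar> > real (b l)}"
  have "l \<in> {l. l \<le> N \<and> \<bar>x l w\<bar> > real (b l)}"
    unfolding l_def using True by (intro Max_in) auto
  then have l: "l \<le> N" "\<bar>x l w\<bar> > real (b l)" by auto
  have after: "tail i w = 0" if "i \<le> N" "l < i" for i
  proof -
    have "i \<le> l" if "\<bar>x i w\<bar> > real (b i)"
      unfolding l_def using that \<open>i \<le> N\<close> by (intro Max_ge) auto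
    then show ?thesis using that by (auto simp: tail_eq)
  qed
  have "(\<Sum>i\<le>N. tail i w) = (\<Sum>i\<le>l. tail i w)"
    using l after by (intro sum.mono_neutral_right) auto
  also have "\<dots> = (\<Sum>i<l. tail i w) + tail l w"
    by (simp flip: lessThan_Suc_atMost)
  finally have "?lhs = \<Psi> (((\<Sum>i<l. tail i w) / real (Suc N) + tail l w / real (Suc N)) / 2)"
    by (simp add: cesaro_means_def add_divide_distrib)
  \<comment> \<open>The halving in the claim pays for this convex separation of the last tail from
    the earlier ones. It is one of the two factors behind the scale 1 / 10 used later.\<close>
  also have "\<dots> \<le> (\<Psi> ((\<Sum>i<l. tail i w) / real (Suc N)) + \<Psi> (tail l w / real (Suc N))) / 2"
    by (rule midpoint)
  also have "\<Psi> ((\<Sum>i<l. tail i w) / real (Suc N)) \<le> (\<Sum>i<l. \<Psi> (tail i w)) / real (Suc N)"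
    using l by (intro mean_le) auto
  also have "(\<Sum>i<l. \<Psi> (tail i w)) \<le> (\<Sum>i<l. if \<bar>x l w\<bar> > real (b l) then \<Psi> (x i w) else 0)"
    using l young_tail_le by (intro sum_mono) auto
  also have "\<dots> \<le> ?B"
    using l by (intro member_le_sum[of l]) (auto intro!: sum_nonneg)
  also have "\<Psi> (tail l w / real (Suc N)) \<le> ?A"
    using l by (intro member_le_sum[of l]) auto
  finally have "?lhs \<le> (?B / real (Suc N) + ?A) / 2"
    by (simp add: divide_right_mono)
  moreover have "0 \<le> ?B / real (Suc N)"
    by (intro divide_nonneg_nonneg sum_nonneg) auto
  moreover have "s \<le> u / 2 + v" if "s \<le> (v + u) / 2" "0 \<le> v" for s u v :: real
    using that by simp
  ultimately show ?thesis by blast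
qed

text \<open>Integrating the pointwise bound leaves two averages. The overlaps are at most 1 / l and
  average to 0. For the rescaled single tails, \<open>nabla2\<close> gives a factor \<delta> times a
  modular of at most 1, plus \<open>y0\<close> times E|tail|.\<close>

lemma tail_mean_to_zero: "(\<lambda>N. \<integral>w. \<Psi> (cesaro_means tail N w / 2) \<partial>M) \<longlonglongrightarrow> 0"
  and integrable_tail_mean: "integrable M (\<lambda>w. \<Psi> (cesaro_means tail N w / 2))"
proof -
  obtain y0 where y0: "y0 \<ge> 0" and nabla: "\<And>\<delta>. \<delta> > 0 \<Longrightarrow> \<exists>N0. \<forall>N\<ge>N0. \<forall>z.
       real N * \<Psi> (z / real N) \<le> \<delta> * \<Psi> z + y0 * \<bar>z\<bar>"
    using nabla2 unfolding nabla2_def by blast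
  have int_tail: "integrable M (tail l)" for l
    by (rule integrable_of_young) auto
  have int_scaled: "integrable M (\<lambda>w. \<Psi> (tail l w / real (Suc N)))" for l N
  proof (rule integrable_young_bound[of _ "\<lambda>w. \<Psi> (tail l w)"])
    show "AE w in M. \<Psi> (tail l w / real (Suc N)) \<le> \<Psi> (tail l w)"
      by (rule AE_I2, rule mono_abs) (simp add: divide_le_eq mult_left_le mult_le_cancel_left1)
  qed auto
  have int_overlap: "integrable M (\<lambda>w. if \<bar>x l w\<bar> > real (b l) then \<Psi> (x i w) else 0)" for l i
    by (rule integrable_if) auto
  have int_bound: "integrable M (\<lambda>w. (\<Sum>l\<le>N. \<Psi> (tail l w / real (Suc N))) / 2 +
     (\<Sum>l\<le>N. \<Sum>i<l. if \<bar>x l w\<bar> > real (b l) then \<Psi> (x i w) else 0) / real (Suc N))" for N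
    by (intro Bochner_Integration.integrable_add integrable_divide Bochner_Integration.integrable_sum
        int_scaled int_overlap)
  show int: "integrable M (\<lambda>w. \<Psi> (cesaro_means tail N w / 2))" for N
    by (rule integrable_young_bound[OF _ int_bound AE_I2[OF young_tail_mean_le]]) measurable
  define o' where "o' = (\<lambda>l. \<Sum>i<l. \<integral>w. (if \<bar>x l w\<bar> > real (b l) then \<Psi> (x i w) else 0) \<partial>M)"
  have "o' \<longlonglongrightarrow> 0"
  proof (rule tendsto_sandwich[of "\<lambda>_. 0" _ _ "\<lambda>l. 1 / real l"])
    show "eventually (\<lambda>l. o' l \<le> 1 / real l) sequentially"
      using eventually_gt_at_top[of 0] by eventually_elim (auto simp: o'_def intro: small_overlap)
  qed (auto simp: o'_def intro!: sum_nonneg integral_nonneg_AE always_eventually lim_1_over_n)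
  then have o_lim: "(\<lambda>N. (\<Sum>l\<le>N. o' l) / real (Suc N)) \<longlonglongrightarrow> 0" by (rule cesaro_null)
  \<comment> \<open>A nonzero value of the l-th tail exceeds l in absolute value, where coercivity
    makes the absolute value a small multiple of \<Psi>. So these first moments vanish, and with
    them the linear term of \<open>nabla2\<close>.\<close>
  define \<tau> where "\<tau> = (\<lambda>l. \<integral>w. \<bar>tail l w\<bar> \<partial>M)"
  have "\<tau> \<longlonglongrightarrow> 0"
  proof (rule LIMSEQ_I)
    fix e :: real assume e: "e > 0"
    obtain k :: nat where k: "\<And>z. \<bar>z\<bar> > real k \<Longrightarrow> \<bar>z\<bar> \<le> e / 2 * \<Psi> z"
      using abs_le_eps_large[of "e / 2"] e by auto
    have "\<tau> l \<le> e / 2" if "l \<ge> k" for l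
    proof -
      have "\<tau> l \<le> (\<integral>w. e / 2 * \<Psi> (x l w) \<partial>M)"
        unfolding \<tau>_def
      proof (rule integral_mono)
        fix w
        show "\<bar>tail l w\<bar> \<le> e / 2 * \<Psi> (x l w)"
          using k[of "x l w"] level_ge[of l] that e by (auto simp: tail_eq)
      qed (use int_tail in auto)
      also have "\<dots> \<le> e / 2" using modular_x[of l] e by simp
      finally show ?thesis .
    qed
    moreover have "0 \<le> \<tau> l" for l by (simp add: \<tau>_def)
    ultimately have "norm (\<tau> n - 0) \<le> e / 2" if "n \<ge> k" for n using that by simp
    then have "norm (\<tau> n - 0) < e" if "n \<ge> k" for n using that e by force
    then show "\<exists>no. \<forall>n\<ge>no. norm (\<tau> n - 0) < e" by blast
  qed
  then have \<tau>_lim: "(\<lambda>N. (\<Sum>l\<le>N. \<tau> l) / real (Suc N)) \<longlonglongrightarrow> 0" by (rule cesaro_null)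
  show "(\<lambda>N. \<integral>w. \<Psi> (cesaro_means tail N w / 2) \<partial>M) \<longlonglongrightarrow> 0"
  proof (rule LIMSEQ_I)
    fix e :: real assume e: "e > 0"
    obtain N0 where N0: "\<And>N z. N \<ge> N0 \<Longrightarrow> real N * \<Psi> (z / real N) \<le> e / 2 * \<Psi> z + y0 * \<bar>z\<bar>"
      using nabla[of "e / 2"] e by auto
    have "(\<lambda>N. y0 / 2 * ((\<Sum>l\<le>N. \<tau> l) / real (Suc N)) + (\<Sum>l\<le>N. o' l) / real (Suc N)) \<longlonglongrightarrow> y0 / 2 * 0 + 0"
      by (intro tendsto_intros \<tau>_lim o_lim)
    then have "eventually (\<lambda>N. y0 / 2 * ((\<Sum>l\<le>N. \<tau> l) / real (Suc N)) + (\<Sum>l\<le>N. o' l) / real (Suc N) < e / 2) sequentially"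
      using e by (intro order_tendstoD) auto
    then have "eventually (\<lambda>N. (\<integral>w. \<Psi> (cesaro_means tail N w / 2) \<partial>M) < e) sequentially"
      using eventually_ge_at_top[of N0]
    proof eventually_elim
      case (elim N)
      define n where "n = real (Suc N)"
      have n: "n > 0" by (simp add: n_def)
      have one: "(\<integral>w. \<Psi> (tail l w / n) \<partial>M) \<le> (e / 2 + y0 * \<tau> l) / n" for l
      proof -
        have "(\<integral>w. \<Psi> (tail l w / n) \<partial>M) \<le> (\<integral>w. (e / 2 * \<Psi> (tail l w) + y0 * \<bar>tail l w\<bar>) / n \<partial>M)"
        proof (rule integral_mono)
          fix w
          show "\<Psi> (tail l w / n) \<le> (e / 2 * \<Psi> (tail l w) + y0 * \<bar>tail l w\<bar>) / n"
            using N0[of "Suc N" "tail l w"] elim n by (simp add: n_def field_simps)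
        qed (use int_tail int_scaled n_def in auto)
        also have "\<dots> = (e / 2 * (\<integral>w. \<Psi> (tail l w) \<partial>M) + y0 * \<tau> l) / n"
          using int_tail by (simp add: \<tau>_def)
        also have "(\<integral>w. \<Psi> (tail l w) \<partial>M) \<le> (\<integral>w. \<Psi> (x l w) \<partial>M)"
          by (rule integral_mono) (auto intro: young_tail_le)
        also have "\<dots> \<le> 1" by (rule modular_x)
        finally show ?thesis using n e by (simp add: divide_right_mono mult_left_mono)
      qed
      have "(\<integral>w. \<Psi> (cesaro_means tail N w / 2) \<partial>M) \<le> (\<integral>w. (\<Sum>l\<le>N. \<Psi> (tail l w / n)) / 2 +
     (\<Sum>l\<le>N. \<Sum>i<l. if \<bar>x l w\<bar> > real (b l) then \<Psi> (x i w) else 0) / n \<partial>M)"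
        unfolding n_def by (rule integral_mono[OF int int_bound young_tail_mean_le])
      also have "\<dots> = (\<Sum>l\<le>N. \<integral>w. \<Psi> (tail l w / n) \<partial>M) / 2 + (\<Sum>l\<le>N. o' l) / n"
        unfolding o'_def n_def
        by (simp add: int_scaled int_overlap Bochner_Integration.integrable_sum
            Bochner_Integration.integral_add Bochner_Integration.integral_sum del: of_nat_Suc)
      also have "(\<Sum>l\<le>N. \<integral>w. \<Psi> (tail l w / n) \<partial>M) \<le> (\<Sum>l\<le>N. (e / 2 + y0 * \<tau> l) / n)"
        by (intro sum_mono one)
      also have "\<dots> = e / 2 + y0 * ((\<Sum>l\<le>N. \<tau> l) / n)"
      proof -
        have "(\<Sum>l\<le>N. (e / 2 + y0 * \<tau> l) / n) = (\<Sum>l\<le>N. e / 2 + y0 * \<tau> l) / n"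
          by (simp add: sum_divide_distrib)
        also have "(\<Sum>l\<le>N. e / 2 + y0 * \<tau> l) = n * (e / 2) + y0 * (\<Sum>l\<le>N. \<tau> l)"
          by (simp add: sum.distrib sum_distrib_left n_def)
        finally show ?thesis using n by (simp add: add_divide_distrib)
      qed
      finally have "(\<integral>w. \<Psi> (cesaro_means tail N w / 2) \<partial>M)
          \<le> (e / 2 + y0 * ((\<Sum>l\<le>N. \<tau> l) / n)) / 2 + (\<Sum>l\<le>N. o' l) / n"
        by simp
      moreover have "y0 / 2 * ((\<Sum>l\<le>N. \<tau> l) / n) = y0 * ((\<Sum>l\<le>N. \<tau> l) / n) / 2" by simp
      moreover have "X < e" if "X \<le> (e / 2 + t) / 2 + u" "s = t / 2" "s + u < e / 2" for X t u s
        using that e by (simp add: field_simps)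
      ultimately show ?case using elim(1) unfolding n_def[symmetric] by blast
    qed
    then show "\<exists>no. \<forall>n\<ge>no. norm ((\<integral>w. \<Psi> (cesaro_means tail n w / 2) \<partial>M) - 0) < e"
      by (auto simp: eventually_sequentially)
  qed
qed

section \<open>Cauchy estimates and the limit of the means\<close>

lemma young_mean5: "\<Psi> ((u1 + u2 + u3 + u4 + u5) / 5) \<le> (\<Psi> u1 + \<Psi> u2 + \<Psi> u3 + \<Psi> u4 + \<Psi> u5) / 5"
  using mean_le[of "{..<5}" 5 "\<lambda>i. [u1, u2, u3, u4, u5] ! i"]
  by (simp add: eval_nat_numeral lessThan_Suc algebra_simps)

lemma abs_truncated_mean_le: "\<bar>cesaro_means (\<lambda>i w. trunc k (x i w)) N w\<bar> \<le> real k"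
proof -
  have "\<bar>\<Sum>i\<le>N. trunc k (x i w)\<bar> \<le> (\<Sum>i\<le>N. real k)"
    by (intro order_trans[OF sum_abs] sum_mono abs_trunc_le)
  then show ?thesis by (simp add: cesaro_means_def divide_le_eq mult.commute del: of_nat_Suc)
qed

lemma integrable_truncated_square:
  "integrable M (\<lambda>w. (cesaro_means (\<lambda>i w. trunc k (x i w)) N w
     - cesaro_means (\<lambda>i w. trunc k (x i w)) P w)\<^sup>2)" (is "integrable M (\<lambda>w. (?m N w - ?m P w)\<^sup>2)")
proof (rule integrable_bounded[of _ "(2 * real k)\<^sup>2"])
  fix w
  have "\<bar>?m N w - ?m P w\<bar> \<le> 2 * real k"
    using abs_truncated_mean_le[of k N w] abs_truncated_mean_le[of k P w] by linarith
  then show "\<bar>(?m N w - ?m P w)\<^sup>2\<bar> \<le> (2 * real k)\<^sup>2"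
    using abs_le_square_iff[of "?m N w - ?m P w" "2 * real k"] by simp
qed measurable

lemma integrable_young_mean: "integrable M (\<lambda>w. \<Psi> (cesaro_means x N w))"
proof (rule integrable_young_bound[of _ "\<lambda>w. (\<Sum>i\<le>N. \<Psi> (x i w)) / real (Suc N)"])
  show "AE w in M. \<Psi> (cesaro_means x N w) \<le> (\<Sum>i\<le>N. \<Psi> (x i w)) / real (Suc N)"
    unfolding cesaro_means_def by (intro AE_I2 mean_le) auto
qed (auto simp del: of_nat_Suc)

lemma integrable_mean: "integrable M (cesaro_means x N)"
  by (rule integrable_of_young[OF integrable_young_mean]) measurable

text \<open>A difference of two means has five parts: one difference of truncated means, two middle
  parts and two tails. Convexity over five parts, each at half scale because the tails are
  controlled only there, explains 10 = 5 * 2. The truncated part is small in L^2, the middle parts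
  by averaging their modulars, the tails by the preceding limit.\<close>

lemma modular_cauchy:
  assumes e: "e > 0"
  shows "\<exists>N0. \<forall>N\<ge>N0. \<forall>P\<ge>N0. (\<integral>w. \<Psi> ((cesaro_means x N w - cesaro_means x P w) / 10) \<partial>M) \<le> 2 * e"
proof -
  obtain k where k: "eventually (\<lambda>i. (\<integral>w. \<Psi> (trunc (b i) (x i w) - trunc k (x i w)) \<partial>M) \<le> e) sequentially"
    using small_middle[OF e] by blast
  obtain \<epsilon> where \<epsilon>: "\<epsilon> \<longlonglongrightarrow> 0" "\<And>N P. (\<integral>w. (cesaro_means (\<lambda>i w. trunc k (x i w)) N w
      - cesaro_means (\<lambda>i w. trunc k (x i w)) P w)\<^sup>2 \<partial>M) \<le> \<epsilon> N + \<epsilon> P"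
    using truncated_cauchy[of k] by blast
  obtain C where C: "C \<ge> 0" "\<And>y. \<bar>y\<bar> \<le> real k \<Longrightarrow> \<Psi> y \<le> e + C * y\<^sup>2"
    using le_eps_plus_square[OF e, of k] by blast
  define mid where "mid = (\<lambda>i w. trunc (b i) (x i w) - trunc k (x i w))"
  define m where "m = cesaro_means (\<lambda>i w. trunc k (x i w))"
  define W where "W = cesaro_means mid"
  define V where "V = cesaro_means tail"
  have mid_meas [measurable]: "mid i \<in> borel_measurable M" for i unfolding mid_def by measurable
  have [measurable]: "m N \<in> borel_measurable M" "W N \<in> borel_measurable M" "V N \<in> borel_measurable M" for N
    unfolding m_def W_def V_def by measurable
  have split: "cesaro_means x N w = m N w + W N w + V N w" for N w
    by (simp add: m_def W_def V_def cesaro_means_def mid_def tail_def flip: add_divide_distrib sum.distrib)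
  have mid_int: "integrable M (\<lambda>w. \<Psi> (mid i w))" for i
  proof (rule integrable_young_bound[of _ "\<lambda>w. \<Psi> (x i w)"])
    show "AE w in M. \<Psi> (mid i w) \<le> \<Psi> (x i w)"
      by (rule AE_I2, rule mono_abs) (auto simp: mid_def trunc_def)
  qed auto
  define A where "A = (\<lambda>N. (\<Sum>i\<le>N. \<integral>w. \<Psi> (mid i w) \<partial>M) / real (Suc N))"
  have W_le: "\<Psi> (W N w / 2) \<le> (\<Sum>i\<le>N. \<Psi> (mid i w)) / real (Suc N)" for N w
  proof -
    have "\<Psi> (W N w / 2) \<le> \<Psi> (W N w)" by (rule mono_abs) simp
    also have "\<dots> \<le> (\<Sum>i\<le>N. \<Psi> (mid i w)) / real (Suc N)"
      unfolding W_def cesaro_means_def by (rule mean_le) auto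
    finally show ?thesis .
  qed
  have W_bound_int: "integrable M (\<lambda>w. (\<Sum>i\<le>N. \<Psi> (mid i w)) / real (Suc N))" for N
    by (intro integrable_divide Bochner_Integration.integrable_sum mid_int)
  have W_bound: "(\<integral>w. (\<Sum>i\<le>N. \<Psi> (mid i w)) / real (Suc N) \<partial>M) = A N" for N
    unfolding A_def by (simp add: mid_int Bochner_Integration.integral_sum del: of_nat_Suc)
  have V_int: "integrable M (\<lambda>w. \<Psi> (V N w / 2))" for N
    unfolding V_def by (rule integrable_tail_mean)
  have m_le: "\<Psi> ((m N w - m P w) / 2) \<le> e + C * (m N w - m P w)\<^sup>2" for N P w
  proof -
    have "\<Psi> ((m N w - m P w) / 2) \<le> e + C * ((m N w - m P w) / 2)\<^sup>2"
      using abs_truncated_mean_le[of k N w] abs_truncated_mean_le[of k P w]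
      by (intro C(2)) (auto simp: m_def abs_le_iff)
    also have "\<dots> \<le> e + C * (m N w - m P w)\<^sup>2"
      using C by (intro add_left_mono mult_left_mono) (auto simp: power_divide)
    finally show ?thesis .
  qed
  have m_int: "integrable M (\<lambda>w. (m N w - m P w)\<^sup>2)" for N P
    unfolding m_def by (rule integrable_truncated_square)
  define R where "R = (\<lambda>N P w. (e + C * (m N w - m P w)\<^sup>2 + (\<Sum>i\<le>N. \<Psi> (mid i w)) / real (Suc N)
      + (\<Sum>i\<le>P. \<Psi> (mid i w)) / real (Suc P) + \<Psi> (V N w / 2) + \<Psi> (V P w / 2)) / 5)"
  have R_int: "integrable M (R N P)" for N P
    unfolding R_def
    by (intro integrable_divide Bochner_Integration.integrable_add integrable_mult_right
        m_int W_bound_int V_int) simp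
  have le_R: "\<Psi> ((cesaro_means x N w - cesaro_means x P w) / 10) \<le> R N P w" for N P w
  proof -
    have eq: "(cesaro_means x N w - cesaro_means x P w) / 10 =
        ((m N w - m P w) / 2 + W N w / 2 + - (W P w / 2) + V N w / 2 + - (V P w / 2)) / 5"
      by (simp add: split field_simps)
    show ?thesis
      unfolding eq R_def
      using m_le[of N w P] W_le[of N w] W_le[of P w]
      by (intro order_trans[OF young_mean5] divide_right_mono add_mono)
         (simp_all del: of_nat_Suc)
  qed
  have int: "integrable M (\<lambda>w. \<Psi> ((cesaro_means x N w - cesaro_means x P w) / 10))" for N P
    by (rule integrable_young_bound[OF _ R_int AE_I2[OF le_R]]) measurable
  define v where "v = (\<lambda>N. \<integral>w. \<Psi> (V N w / 2) \<partial>M)"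
  have bound: "(\<integral>w. \<Psi> ((cesaro_means x N w - cesaro_means x P w) / 10) \<partial>M)
      \<le> (e + C * (\<epsilon> N + \<epsilon> P) + A N + A P + v N + v P) / 5" for N P
  proof -
    have "(\<integral>w. \<Psi> ((cesaro_means x N w - cesaro_means x P w) / 10) \<partial>M) \<le> (\<integral>w. R N P w \<partial>M)"
      by (rule integral_mono[OF int R_int le_R])
    also have "\<dots> = (e + C * (\<integral>w. (m N w - m P w)\<^sup>2 \<partial>M) + A N + A P + v N + v P) / 5"
      unfolding R_def v_def W_bound[symmetric]
      by (simp add: m_int W_bound_int V_int prob_space del: of_nat_Suc)
    also have "\<dots> \<le> (e + C * (\<epsilon> N + \<epsilon> P) + A N + A P + v N + v P) / 5"
      using \<epsilon>(2)[of N P] C by (intro divide_right_mono add_right_mono add_left_mono mult_left_mono)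
        (auto simp: m_def)
    finally show ?thesis .
  qed
  have "eventually (\<lambda>N. A N \<le> e + e) sequentially"
    unfolding A_def by (rule cesaro_eventually_le[OF _ e]) (use k in \<open>simp add: mid_def\<close>)
  moreover have "eventually (\<lambda>N. v N < e) sequentially"
    unfolding v_def V_def using tail_mean_to_zero e by (rule order_tendstoD)
  moreover have "eventually (\<lambda>N. C * \<epsilon> N < e) sequentially"
    using tendsto_mult_left[OF \<epsilon>(1), of C] e by (intro order_tendstoD) auto
  ultimately have "eventually (\<lambda>N. A N \<le> e + e \<and> v N < e \<and> C * \<epsilon> N < e) sequentially"
    by (intro eventually_conj)
  then obtain N0 where N0: "\<And>N. N \<ge> N0 \<Longrightarrow> A N \<le> e + e \<and> v N < e \<and> C * \<epsilon> N < e"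
    unfolding eventually_sequentially by blast
  show ?thesis
  proof (intro exI[of _ N0] allI impI)
    fix N P assume "N \<ge> N0" "P \<ge> N0"
    \<comment> \<open>The five parts contribute at most e + 2 e, 4 e and 2 e in total, and 9 e / 5
      \<le> 2 e.\<close>
    then show "(\<integral>w. \<Psi> ((cesaro_means x N w - cesaro_means x P w) / 10) \<partial>M) \<le> 2 * e"
      using N0[of N] N0[of P] e by (intro order_trans[OF bound]) (simp add: distrib_left)
  qed
qed

text \<open>\<Psi> may vanish near 0, so a small modular alone does not make a difference small. In
  L^1, truncation at a level beyond which |y| \<le> e \<Psi>(y) costs at most e on average, and |y|
  \<le> e + y^2 / e transfers the L^2 estimate to the truncated means.\<close>

lemma mean_cauchy:
  assumes e: "e > 0"
  shows "\<exists>N0. \<forall>N\<ge>N0. \<forall>P\<ge>N0. (\<integral>w. norm (cesaro_means x N w - cesaro_means x P w) \<partial>M) < 8 * e"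
proof -
  obtain k :: nat where k: "\<And>y. \<bar>y\<bar> > real k \<Longrightarrow> \<bar>y\<bar> \<le> e * \<Psi> y"
    using abs_le_eps_large[OF e] by blast
  obtain \<epsilon> where \<epsilon>: "\<epsilon> \<longlonglongrightarrow> 0" "\<And>N P. (\<integral>w. (cesaro_means (\<lambda>i w. trunc k (x i w)) N w
      - cesaro_means (\<lambda>i w. trunc k (x i w)) P w)\<^sup>2 \<partial>M) \<le> \<epsilon> N + \<epsilon> P"
    using truncated_cauchy[of k] by blast
  define m where "m = cesaro_means (\<lambda>i w. trunc k (x i w))"
  have [measurable]: "m N \<in> borel_measurable M" for N unfolding m_def by measurable
  have m_int: "integrable M (\<lambda>w. (m N w - m P w)\<^sup>2)" for N P
    unfolding m_def by (rule integrable_truncated_square)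
  have one: "\<bar>cesaro_means x N w - m N w\<bar> \<le> (\<Sum>i\<le>N. e * \<Psi> (x i w)) / real (Suc N)" for N w
  proof -
    have "cesaro_means x N w - m N w = (\<Sum>i\<le>N. x i w - trunc k (x i w)) / real (Suc N)"
      by (simp add: m_def cesaro_means_def sum_subtractf diff_divide_distrib)
    also have "\<bar>\<dots>\<bar> \<le> (\<Sum>i\<le>N. \<bar>x i w - trunc k (x i w)\<bar>) / real (Suc N)"
      unfolding abs_divide by (simp add: divide_right_mono del: of_nat_Suc)
    also have "\<dots> \<le> (\<Sum>i\<le>N. e * \<Psi> (x i w)) / real (Suc N)"
    proof (intro divide_right_mono sum_mono)
      fix i show "\<bar>x i w - trunc k (x i w)\<bar> \<le> e * \<Psi> (x i w)"
        using k[of "x i w"] e by (simp add: trunc_def)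
    qed simp
    finally show ?thesis .
  qed
  have amgm: "\<bar>y\<bar> \<le> e + y\<^sup>2 / e" for y
  proof -
    have "(\<bar>y\<bar> - e)\<^sup>2 = y\<^sup>2 - 2 * \<bar>y\<bar> * e + e * e" by (simp add: power2_diff) (simp add: power2_eq_square)
    then have "2 * \<bar>y\<bar> * e \<le> y\<^sup>2 + e * e" using zero_le_power2[of "\<bar>y\<bar> - e"] by linarith
    moreover have "0 \<le> \<bar>y\<bar> * e" using e by simp
    ultimately have "\<bar>y\<bar> * e \<le> y\<^sup>2 + e * e" by linarith
    then show ?thesis using e by (simp add: field_simps)
  qed
  define R where "R = (\<lambda>N P w. e + (m N w - m P w)\<^sup>2 / e
      + (\<Sum>i\<le>N. e * \<Psi> (x i w)) / real (Suc N) + (\<Sum>i\<le>P. e * \<Psi> (x i w)) / real (Suc P))"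
  have mean_int: "integrable M (\<lambda>w. (\<Sum>i\<le>N. e * \<Psi> (x i w)) / real (Suc N))" for N
    by (intro integrable_divide Bochner_Integration.integrable_sum integrable_mult_right integrable_x)
  have R_int: "integrable M (R N P)" for N P
    unfolding R_def
    by (intro Bochner_Integration.integrable_add integrable_divide m_int mean_int) simp
  have mean_le: "(\<integral>w. (\<Sum>i\<le>N. e * \<Psi> (x i w)) / real (Suc N) \<partial>M) \<le> e" for N
  proof -
    have "(\<integral>w. (\<Sum>i\<le>N. e * \<Psi> (x i w)) / real (Suc N) \<partial>M)
        = (\<Sum>i\<le>N. e * (\<integral>w. \<Psi> (x i w) \<partial>M)) / real (Suc N)"
      by (simp add: Bochner_Integration.integral_sum del: of_nat_Suc)
    also have "\<dots> \<le> (\<Sum>i\<le>N. e * 1) / real (Suc N)"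
      using modular_x e by (intro divide_right_mono sum_mono mult_left_mono) auto
    finally show ?thesis by (simp del: of_nat_Suc)
  qed
  have bound: "(\<integral>w. norm (cesaro_means x N w - cesaro_means x P w) \<partial>M) \<le> 3 * e + (\<epsilon> N + \<epsilon> P) / e" for N P
  proof -
    have "(\<integral>w. norm (cesaro_means x N w - cesaro_means x P w) \<partial>M) \<le> (\<integral>w. R N P w \<partial>M)"
    proof (rule integral_mono[OF _ R_int])
      fix w
      show "norm (cesaro_means x N w - cesaro_means x P w) \<le> R N P w"
        using one[of N w] one[of P w] amgm[of "m N w - m P w"] unfolding R_def real_norm_def by linarith
    qed (intro integrable_norm Bochner_Integration.integrable_diff integrable_mean)
    also have "\<dots> = e + (\<integral>w. (m N w - m P w)\<^sup>2 \<partial>M) / e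
      + (\<integral>w. (\<Sum>i\<le>N. e * \<Psi> (x i w)) / real (Suc N) \<partial>M) + (\<integral>w. (\<Sum>i\<le>P. e * \<Psi> (x i w)) / real (Suc P) \<partial>M)"
      unfolding R_def using m_int mean_int by (simp add: prob_space del: of_nat_Suc)
    also have "(\<integral>w. (m N w - m P w)\<^sup>2 \<partial>M) / e \<le> (\<epsilon> N + \<epsilon> P) / e"
      unfolding m_def using \<epsilon>(2)[of N P] e by (intro divide_right_mono) auto
    finally show ?thesis using mean_le[of N] mean_le[of P] by linarith
  qed
  have "eventually (\<lambda>N. \<epsilon> N / e < e) sequentially"
    using tendsto_divide[OF \<epsilon>(1) tendsto_const[of e]] e by (intro order_tendstoD) auto
  then obtain N0 where N0: "\<And>N. N \<ge> N0 \<Longrightarrow> \<epsilon> N / e < e"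
    unfolding eventually_sequentially by blast
  show ?thesis
  proof (intro exI[of _ N0] allI impI)
    fix N P assume "N \<ge> N0" "P \<ge> N0"
    then have "3 * e + (\<epsilon> N + \<epsilon> P) / e < 8 * e"
      using N0[of N] N0[of P] e unfolding add_divide_distrib by linarith
    then show "(\<integral>w. norm (cesaro_means x N w - cesaro_means x P w) \<partial>M) < 8 * e"
      using bound[of N P] by linarith
  qed
qed

text \<open>The Cauchy property in L^1 yields a subsequence converging almost surely, which defines
  f. Fatou's lemma along it carries both Cauchy estimates from pairs of means over to the distance
  between a mean and f.\<close>

lemma cesaro_modular_limit:
  "\<exists>f\<in>borel_measurable M. (\<lambda>N. \<integral>\<^sup>+w. ennreal (\<Psi> ((cesaro_means x N w - f w) / 10)
     + \<bar>cesaro_means x N w - f w\<bar>) \<partial>M) \<longlonglongrightarrow> 0"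
proof -
  have "\<exists>N. \<forall>i\<ge>N. \<forall>j\<ge>N. (\<integral>w. norm (cesaro_means x i w - cesaro_means x j w) \<partial>M) < e" if "e > 0" for e
    using mean_cauchy[of "e / 8"] that by simp
  then obtain \<rho> where \<rho>: "strict_mono (\<rho> :: nat \<Rightarrow> nat)" "AE w in M. Cauchy (\<lambda>i. cesaro_means x (\<rho> i) w)"
    using cauchy_L1_AE_cauchy_subseq[of M "cesaro_means x"] integrable_mean by metis
  define f where "f = (\<lambda>w. lim (\<lambda>i. cesaro_means x (\<rho> i) w))"
  have f_meas [measurable]: "f \<in> borel_measurable M" unfolding f_def by measurable
  have f_lim: "AE w in M. (\<lambda>i. cesaro_means x (\<rho> i) w) \<longlonglongrightarrow> f w"
    using \<rho>(2) by eventually_elim (simp add: f_def Cauchy_convergent convergent_LIMSEQ_iff[symmetric])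
  define H where "H = (\<lambda>y. \<Psi> (y / 10) + \<bar>y\<bar>)"
  have H_meas [measurable]: "H \<in> borel_measurable borel" unfolding H_def by measurable
  have H_nn: "0 \<le> H y" for y by (simp add: H_def)
  have cont: "isCont H y" for y
  proof -
    have "continuous_on UNIV H" unfolding H_def
      by (intro continuous_intros continuous_on_compose2[OF continuous[of UNIV]]) auto
    then show ?thesis by (simp add: continuous_on_eq_continuous_at)
  qed
  define D where "D = (\<lambda>N P. \<integral>\<^sup>+w. ennreal (H (cesaro_means x N w - cesaro_means x P w)) \<partial>M)"
  have young_int: "integrable M (\<lambda>w. \<Psi> ((cesaro_means x N w - cesaro_means x P w) / 10))" for N P
  proof (rule integrable_young_bound)
    show "integrable M (\<lambda>w. (\<Psi> (cesaro_means x N w) + \<Psi> (cesaro_means x P w)) / 2)"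
      using integrable_young_mean by auto
    have "\<Psi> ((u - v) / 10) \<le> (\<Psi> u + \<Psi> v) / 2" for u v
    proof -
      have "\<Psi> ((u - v) / 10) \<le> \<Psi> ((u + - v) / 2)" by (rule mono_abs) simp
      also have "\<dots> \<le> (\<Psi> u + \<Psi> v) / 2" using midpoint[of u "- v"] by simp
      finally show ?thesis .
    qed
    then show "AE w in M. \<Psi> ((cesaro_means x N w - cesaro_means x P w) / 10)
        \<le> (\<Psi> (cesaro_means x N w) + \<Psi> (cesaro_means x P w)) / 2" by simp
  qed measurable
  have D_eq: "D N P = ennreal ((\<integral>w. \<Psi> ((cesaro_means x N w - cesaro_means x P w) / 10) \<partial>M)
      + (\<integral>w. norm (cesaro_means x N w - cesaro_means x P w) \<partial>M))" for N P
  proof -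
    have "D N P = ennreal (\<integral>w. H (cesaro_means x N w - cesaro_means x P w) \<partial>M)"
      unfolding D_def by (rule nn_integral_eq_integral)
        (use young_int integrable_mean H_nn in \<open>auto simp: H_def\<close>)
    also have "(\<integral>w. H (cesaro_means x N w - cesaro_means x P w) \<partial>M)
      = (\<integral>w. \<Psi> ((cesaro_means x N w - cesaro_means x P w) / 10) \<partial>M)
      + (\<integral>w. norm (cesaro_means x N w - cesaro_means x P w) \<partial>M)"
      unfolding H_def real_norm_def
      by (intro Bochner_Integration.integral_add young_int integrable_abs
          Bochner_Integration.integrable_diff integrable_mean)
    finally show ?thesis .
  qed
  have Fatou: "(\<integral>\<^sup>+w. ennreal (H (cesaro_means x N w - f w)) \<partial>M) \<le> liminf (\<lambda>i. D N (\<rho> i))" for N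
  proof -
    have "(\<integral>\<^sup>+w. ennreal (H (cesaro_means x N w - f w)) \<partial>M)
        = (\<integral>\<^sup>+w. liminf (\<lambda>i. ennreal (H (cesaro_means x N w - cesaro_means x (\<rho> i) w))) \<partial>M)"
    proof (rule nn_integral_cong_AE)
      show "AE w in M. ennreal (H (cesaro_means x N w - f w))
          = liminf (\<lambda>i. ennreal (H (cesaro_means x N w - cesaro_means x (\<rho> i) w)))"
        using f_lim
      proof eventually_elim
        case (elim w)
        have "(\<lambda>i. H (cesaro_means x N w - cesaro_means x (\<rho> i) w)) \<longlonglongrightarrow> H (cesaro_means x N w - f w)"
          by (intro isCont_tendsto_compose[OF cont] tendsto_intros elim)
        then have "(\<lambda>i. ennreal (H (cesaro_means x N w - cesaro_means x (\<rho> i) w)))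
            \<longlonglongrightarrow> ennreal (H (cesaro_means x N w - f w))"
          by (rule tendsto_ennrealI)
        then show ?case by (intro lim_imp_Liminf[symmetric]) auto
      qed
    qed
    also have "\<dots> \<le> liminf (\<lambda>i. D N (\<rho> i))"
      unfolding D_def by (rule nn_integral_liminf) measurable
    finally show ?thesis .
  qed
  have "(\<lambda>N. \<integral>\<^sup>+w. ennreal (H (cesaro_means x N w - f w)) \<partial>M) \<longlonglongrightarrow> 0"
  proof (rule order_tendstoI)
    fix c :: ennreal assume "0 < c"
    then obtain d where d: "0 < d" "d < c" using dense by blast
    define e where "e = enn2real d"
    have "d < top" using d(2) by (rule less_le_trans) simp
    then have e: "e > 0" "ennreal e < c"
      using d by (auto simp: e_def enn2real_positive_iff)
    obtain N1 where N1: "\<And>N P. N \<ge> N1 \<Longrightarrow> P \<ge> N1 \<Longrightarrow>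
        (\<integral>w. \<Psi> ((cesaro_means x N w - cesaro_means x P w) / 10) \<partial>M) \<le> 2 * (e / 4)"
      using modular_cauchy[of "e / 4"] e by auto
    obtain N2 where N2: "\<And>N P. N \<ge> N2 \<Longrightarrow> P \<ge> N2 \<Longrightarrow>
        (\<integral>w. norm (cesaro_means x N w - cesaro_means x P w) \<partial>M) < 8 * (e / 16)"
      using mean_cauchy[of "e / 16"] e by auto
    have "(\<integral>\<^sup>+w. ennreal (H (cesaro_means x N w - f w)) \<partial>M) < c" if N: "N \<ge> max N1 N2" for N
    proof -
      have "D N (\<rho> i) \<le> ennreal e" if "i \<ge> max N1 N2" for i
      proof -
        have "\<rho> i \<ge> i" by (rule seq_suble[OF \<rho>(1)])
        then show ?thesis
          unfolding D_eq using N that N1[of N "\<rho> i"] N2[of N "\<rho> i"] by (intro ennreal_leI) auto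
      qed
      then have "liminf (\<lambda>i. D N (\<rho> i)) \<le> ennreal e"
        by (intro Liminf_le) (auto simp: eventually_sequentially intro!: exI[of _ "max N1 N2"])
      then show ?thesis using Fatou[of N] e by (meson le_less_trans)
    qed
    then show "eventually (\<lambda>N. (\<integral>\<^sup>+w. ennreal (H (cesaro_means x N w - f w)) \<partial>M) < c) sequentially"
      unfolding eventually_sequentially by blast
  qed simp
  then show ?thesis using f_meas unfolding H_def by blast
qed

end

section \<open>Modular convergence\<close>

lemma strict_mono_choice:
  assumes "\<And>j n0. \<exists>n>n0. Q j n"
  shows "\<exists>\<rho>. strict_mono (\<rho> :: nat \<Rightarrow> nat) \<and> (\<forall>j. Q j (\<rho> j))"
proof -
  have "\<exists>\<rho>. \<forall>j. Q j (\<rho> j) \<and> \<rho> j < \<rho> (Suc j)"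
  proof (rule dependent_nat_choice)
    show "\<exists>n. Q 0 n" using assms[of 0 0] by blast
    show "\<exists>n'. Q (Suc j) n' \<and> n < n'" if "Q j n" for n j
      using assms[where j = "Suc j" and ?n0.0 = n] by blast
  qed
  then show ?thesis by (auto simp: strict_mono_Suc_iff)
qed

lemma ennreal_tendsto_0_le:
  fixes f :: "nat \<Rightarrow> ennreal"
  assumes "f \<longlonglongrightarrow> 0" "\<epsilon> > 0"
  shows "eventually (\<lambda>n. f n \<le> ennreal \<epsilon>) sequentially"
  using order_tendstoD(2)[OF assms(1), of "ennreal \<epsilon>"] assms(2)
  by (auto elim: eventually_mono)

context young_space
begin

text \<open>The absolute value is added because \<Psi> may vanish on a neighbourhood of 0: with it,
  summable modulars force almost sure convergence to 0.\<close>

definition modular :: "real \<Rightarrow> ('a \<Rightarrow> real) \<Rightarrow> ennreal" where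
  "modular c u = (\<integral>\<^sup>+w. ennreal (\<Psi> (c * u w) + \<bar>u w\<bar>) \<partial>M)"

lemma modular_finite:
  assumes [measurable]: "u \<in> borel_measurable M" and "c > 0" "modular c u < \<infinity>"
  shows "u \<in> L \<Psi>"
proof -
  have "(\<integral>\<^sup>+w. ennreal (\<Psi> (c * u w)) \<partial>M) \<le> modular c u"
    unfolding modular_def by (intro nn_integral_mono ennreal_leI) simp
  then have "integrable M (\<lambda>w. \<Psi> (c * u w))"
    using assms by (intro integrableI_nonneg) (auto intro: le_less_trans)
  then show ?thesis using assms by (auto simp: orlicz_space_iff)
qed

text \<open>The sum S of all terms \<Psi>(c u n) + |u n| is integrable and bounds each of them. With
  Y j the supremum of |u n| over n \<ge> j, \<Psi>(c Y 0) is therefore at most S at the same scale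
  c, and Y j decreases to 0 because the terms of a convergent series do.\<close>

lemma decreasing_order_bound:
  assumes [measurable]: "\<And>n. u n \<in> borel_measurable M" and c: "c > 0"
    and fast: "\<And>n. modular c (u n) \<le> ennreal ((1/2) ^ n)"
  obtains Y where "\<And>j. Y j \<in> borel_measurable M" "Y 0 \<in> L \<Psi>"
    "\<And>j w. 0 \<le> Y j w" "\<And>j w. Y (Suc j) w \<le> Y j w"
    "AE w in M. (\<lambda>j. Y j w) \<longlonglongrightarrow> 0 \<and> (\<forall>n. \<bar>u n w\<bar> \<le> Y n w)"
proof -
  define S where "S = (\<lambda>w. \<Sum>n. ennreal (\<Psi> (c * u n w) + \<bar>u n w\<bar>))"
  have [measurable]: "S \<in> borel_measurable M" unfolding S_def by measurable
  have "(\<integral>\<^sup>+w. S w \<partial>M) = (\<Sum>n. modular c (u n))"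
    unfolding S_def modular_def by (rule nn_integral_suminf) measurable
  also have "\<dots> \<le> (\<Sum>n. ennreal ((1/2) ^ n))"
    by (intro suminf_le fast) auto
  also have "\<dots> = ennreal 2"
  proof -
    have "(\<Sum>n. ennreal ((1/2) ^ n)) = ennreal (\<Sum>n. (1/2) ^ n)"
      by (rule suminf_ennreal2) (simp_all add: summable_geometric)
    also have "(\<Sum>n. (1/2 :: real) ^ n) = 1 / (1 - 1/2)" by (rule suminf_geometric) simp
    finally show ?thesis by simp
  qed
  finally have S_fin: "(\<integral>\<^sup>+w. S w \<partial>M) < \<infinity>"
    by (rule le_less_trans) simp
  then have AE_S: "AE w in M. S w \<noteq> \<infinity>"
    by (intro nn_integral_PInf_AE) auto
  \<comment> \<open>Resetting to 0 on the null set where S is infinite makes the real suprema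
    bounded, so positivity and monotonicity of Y hold everywhere and only the comparison with u is
    almost sure.\<close>
  define v where "v = (\<lambda>n w. if S w \<noteq> \<infinity> then u n w else 0)"
  have [measurable]: "v n \<in> borel_measurable M" for n unfolding v_def by measurable
  have summ: "summable (\<lambda>n. \<Psi> (c * u n w) + \<bar>u n w\<bar>)" if "S w \<noteq> \<infinity>" for w
    using that unfolding S_def by (intro summable_suminf_not_top) auto
  have S_real: "enn2real (S w) = (\<Sum>n. \<Psi> (c * u n w) + \<bar>u n w\<bar>)" if "S w \<noteq> \<infinity>" for w
    unfolding S_def using summ[OF that] by (subst suminf_ennreal2) (simp_all add: suminf_nonneg)
  have term_le: "\<Psi> (c * v n w) + \<bar>v n w\<bar> \<le> enn2real (S w)" for n w
  proof (cases "S w \<noteq> \<infinity>")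
    case True
    show ?thesis
      using sum_le_suminf[OF summ[OF True], of "{n}"] True by (simp add: S_real v_def)
  qed (simp add: v_def)
  have v_lim: "(\<lambda>n. v n w) \<longlonglongrightarrow> 0" for w
  proof (cases "S w \<noteq> \<infinity>")
    case True
    show ?thesis
    proof (rule Lim_null_comparison[OF _ summable_LIMSEQ_zero[OF summ[OF True]]])
      show "eventually (\<lambda>n. norm (v n w) \<le> \<Psi> (c * u n w) + \<bar>u n w\<bar>) sequentially"
        by (auto simp: v_def)
    qed
  qed (simp add: v_def)
  have bdd: "bdd_above (range (\<lambda>n. \<bar>v (n + j) w\<bar>))" for j w
  proof (rule bdd_aboveI2)
    show "\<bar>v (n + j) w\<bar> \<le> enn2real (S w)" for n
      using term_le[of "n + j" w] nonneg[of "c * v (n + j) w"] by linarith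
  qed
  define Y where "Y = (\<lambda>j w. SUP n. \<bar>v (n + j) w\<bar>)"
  have Y_ge: "\<bar>v n w\<bar> \<le> Y j w" if "j \<le> n" for n j w
    unfolding Y_def using cSUP_upper[OF UNIV_I bdd, of "n - j" j w] that by simp
  have Y_le: "Y j w \<le> z" if "\<And>n. n \<ge> j \<Longrightarrow> \<bar>v n w\<bar> \<le> z" for j w z
    unfolding Y_def by (rule cSUP_least) (use that in auto)
  have Y_nn: "0 \<le> Y j w" for j w using Y_ge[of j j w] by simp
  have Y_meas: "Y j \<in> borel_measurable M" for j
    unfolding Y_def by (rule borel_measurable_cSUP) (use bdd in auto)
  show ?thesis
  proof (rule that[of Y])
    show "Y (Suc j) w \<le> Y j w" for j w by (rule Y_le) (auto intro: Y_ge)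
    show "Y 0 \<in> L \<Psi>"
    proof -
      have "integrable M (\<lambda>w. enn2real (S w))"
      proof (rule integrableI_nonneg)
        have "(\<integral>\<^sup>+w. ennreal (enn2real (S w)) \<partial>M) \<le> (\<integral>\<^sup>+w. S w \<partial>M)"
          by (intro nn_integral_mono) (simp add: ennreal_enn2real_if)
        then show "(\<integral>\<^sup>+w. ennreal (enn2real (S w)) \<partial>M) < \<infinity>" using S_fin by (rule le_less_trans)
      qed auto
      moreover have "\<Psi> (c * Y 0 w) \<le> enn2real (S w)" for w
      proof -
        \<comment> \<open>A nonempty closed set that is bounded above contains its supremum when the
          supremum is over a subset; so the bound passes from the |v n| to Y 0.\<close>
        have "closed {z. \<Psi> (c * z) \<le> enn2real (S w)}"
          by (intro closed_Collect_le continuous_on_compose2[OF continuous[of UNIV]] continuous_intros) auto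
        moreover have "range (\<lambda>n. \<bar>v (n + 0) w\<bar>) \<subseteq> {z. \<Psi> (c * z) \<le> enn2real (S w)}"
        proof clarify
          fix n
          have "\<Psi> (c * \<bar>v (n + 0) w\<bar>) = \<Psi> (c * v n w)"
            using c abs_arg[of "c * v n w"] by (simp add: abs_mult)
          then show "\<Psi> (c * \<bar>v (n + 0) w\<bar>) \<le> enn2real (S w)" using term_le[of n w] by linarith
        qed
        ultimately have "Y 0 w \<in> {z. \<Psi> (c * z) \<le> enn2real (S w)}"
          unfolding Y_def by (intro closed_subset_contains_Sup bdd) auto
        then show ?thesis by simp
      qed
      ultimately have "integrable M (\<lambda>w. \<Psi> (c * Y 0 w))"
        using Y_meas[of 0] by (intro integrable_young_bound[where g="\<lambda>w. enn2real (S w)"]) auto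
      then show ?thesis using c Y_meas by (auto simp: orlicz_space_iff)
    qed
    show "AE w in M. (\<lambda>j. Y j w) \<longlonglongrightarrow> 0 \<and> (\<forall>n. \<bar>u n w\<bar> \<le> Y n w)"
      using AE_S
    proof eventually_elim
      case (elim w)
      have "(\<lambda>j. Y j w) \<longlonglongrightarrow> 0"
      proof (rule LIMSEQ_I)
        fix e :: real assume e: "e > 0"
        obtain n0 where n0: "\<And>n. n \<ge> n0 \<Longrightarrow> \<bar>v n w\<bar> < e / 2"
          using LIMSEQ_D[OF v_lim[of w], of "e / 2"] e by auto
        have "Y j w \<le> e / 2" if "j \<ge> n0" for j
          using n0 that by (intro Y_le) (simp add: less_imp_le)
        then have "norm (Y j w - 0) < e" if "j \<ge> n0" for j
          using that e Y_nn[of j w] by (simp add: le_less_trans[of _ "e / 2"])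
        then show "\<exists>no. \<forall>j\<ge>no. norm (Y j w - 0) < e" by blast
      qed
      moreover have "\<bar>u n w\<bar> \<le> Y n w" for n
        using Y_ge[of n n w] elim by (simp add: v_def)
      ultimately show ?case by blast
    qed
  qed (use Y_nn Y_meas in auto)
qed

lemma modular_scale_le:
  assumes "C > 0" and [measurable]: "u \<in> borel_measurable M"
  shows "modular (c / C) (\<lambda>w. C * u w) \<le> ennreal (1 + C) * modular c u"
proof -
  have "modular (c / C) (\<lambda>w. C * u w) \<le> (\<integral>\<^sup>+w. ennreal (1 + C) * ennreal (\<Psi> (c * u w) + \<bar>u w\<bar>) \<partial>M)"
    unfolding modular_def
  proof (intro nn_integral_mono)
    fix w
    have "\<Psi> (c / C * (C * u w)) + \<bar>C * u w\<bar> \<le> (1 + C) * (\<Psi> (c * u w) + \<bar>u w\<bar>)"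
      using assms(1) by (simp add: abs_mult algebra_simps)
    then have "ennreal (\<Psi> (c / C * (C * u w)) + \<bar>C * u w\<bar>)
        \<le> ennreal ((1 + C) * (\<Psi> (c * u w) + \<bar>u w\<bar>))" by (rule ennreal_leI)
    also have "\<dots> = ennreal (1 + C) * ennreal (\<Psi> (c * u w) + \<bar>u w\<bar>)"
      using assms(1) by (intro ennreal_mult) auto
    finally show "ennreal (\<Psi> (c / C * (C * u w)) + \<bar>C * u w\<bar>)
        \<le> ennreal (1 + C) * ennreal (\<Psi> (c * u w) + \<bar>u w\<bar>)" .
  qed
  also have "\<dots> = ennreal (1 + C) * modular c u"
    unfolding modular_def by (rule nn_integral_cmult) measurable
  finally show ?thesis .
qed

text \<open>The combination 2 u - v is the form in which block averages appear below. Writing c / 4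
  times it as the midpoint of c u and -(c / 2) v accounts for the scale.\<close>

lemma modular_combination_le:
  assumes "c > 0" and [measurable]: "u \<in> borel_measurable M" "v \<in> borel_measurable M"
  shows "modular (c / 4) (\<lambda>w. 2 * u w - v w) \<le> 2 * (modular c u + modular c v)"
proof -
  have "modular (c / 4) (\<lambda>w. 2 * u w - v w)
      \<le> (\<integral>\<^sup>+w. 2 * (ennreal (\<Psi> (c * u w) + \<bar>u w\<bar>) + ennreal (\<Psi> (c * v w) + \<bar>v w\<bar>)) \<partial>M)"
    unfolding modular_def
  proof (intro nn_integral_mono)
    fix w
    have "\<Psi> (c / 4 * (2 * u w - v w)) = \<Psi> ((c * u w + - (c / 2 * v w)) / 2)"
      by (rule arg_cong[where f=\<Psi>]) (simp add: field_simps)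
    also have "\<dots> \<le> (\<Psi> (c * u w) + \<Psi> (- (c / 2 * v w))) / 2" by (rule midpoint)
    also have "\<Psi> (- (c / 2 * v w)) \<le> \<Psi> (c * v w)"
      using assms(1) by (intro mono_abs) (simp add: abs_mult)
    also have "(\<Psi> (c * u w) + \<Psi> (c * v w)) / 2 \<le> \<Psi> (c * u w) + \<Psi> (c * v w)" by simp
    finally have "\<Psi> (c / 4 * (2 * u w - v w)) \<le> \<Psi> (c * u w) + \<Psi> (c * v w)" by simp
    moreover have "\<bar>2 * u w - v w\<bar> \<le> 2 * \<bar>u w\<bar> + \<bar>v w\<bar>" by linarith
    ultimately have "\<Psi> (c / 4 * (2 * u w - v w)) + \<bar>2 * u w - v w\<bar>
        \<le> 2 * ((\<Psi> (c * u w) + \<bar>u w\<bar>) + (\<Psi> (c * v w) + \<bar>v w\<bar>))"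
      using nonneg[of "c * u w"] nonneg[of "c * v w"] abs_ge_zero[of "v w"] by argo
    then show "ennreal (\<Psi> (c / 4 * (2 * u w - v w)) + \<bar>2 * u w - v w\<bar>)
        \<le> 2 * (ennreal (\<Psi> (c * u w) + \<bar>u w\<bar>) + ennreal (\<Psi> (c * v w) + \<bar>v w\<bar>))"
      by (simp add: ennreal_leI add_nonneg_nonneg flip: ennreal_plus ennreal_numeral ennreal_mult)
  qed
  also have "\<dots> = 2 * (modular c u + modular c v)"
    unfolding modular_def by (simp add: nn_integral_cmult nn_integral_add)
  finally show ?thesis .
qed

lemma cesaro_means_orlicz:
  assumes "\<And>i. x i \<in> L \<Psi>"
  shows "cesaro_means x N \<in> L \<Psi>"
  using orlicz_space_cmult[OF orlicz_space_sum[of "{..N}" x], of "1 / real (Suc N)"] assms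
  by (simp add: cesaro_means_def)

text \<open>A Komlos type theorem in modular form. The norm bound C is divided out to reach the unit
  ball, where the limit is found at scale 1 / 10, and then restored, which leaves the scale 1 / (10
  C).\<close>

lemma komlos_modular:
  assumes "norm_bounded_seq M \<Psi> \<xi>"
    and "nabla2 \<Psi>"
  shows "\<exists>r f c. strict_mono r \<and> f \<in> L \<Psi> \<and> c > 0 \<and>
    (\<lambda>N. modular c (\<lambda>w. cesaro_means (\<xi> \<circ> r) N w - f w)) \<longlonglongrightarrow> 0"
proof -
  obtain C where C: "C > 0" "\<And>n. (\<lambda>w. \<xi> n w / C) \<in> orlicz_ball M \<Psi>"
    using norm_bounded_seqD[OF assms(1)] by blast
  interpret ms: modular_sequence M \<Psi> "\<lambda>n w. \<xi> n w / C"
    by standard (rule C(2))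
  from ms.splitting_subsequence[OF assms(2)] obtain r b
    where rb: "strict_mono r \<and> split_sequence M \<Psi> (\<lambda>n w. \<xi> (r n) w / C) b" by (elim exE)
  then interpret split_sequence M \<Psi> "\<lambda>n w. \<xi> (r n) w / C" b by simp
  define m where "m = cesaro_means (\<lambda>n w. \<xi> (r n) w / C)"
  obtain f where f [measurable]: "f \<in> borel_measurable M" and lim: "(\<lambda>N. \<integral>\<^sup>+w. ennreal (\<Psi> ((m N w - f w) / 10)
     + \<bar>m N w - f w\<bar>) \<partial>M) \<longlonglongrightarrow> 0"
    using cesaro_modular_limit unfolding m_def by blast
  have m_meas [measurable]: "m N \<in> borel_measurable M" for N unfolding m_def by measurable
  have lim': "(\<lambda>N. modular (1/10) (\<lambda>w. m N w - f w)) \<longlonglongrightarrow> 0"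
    using lim by (simp add: modular_def)
  have mean_eq: "cesaro_means (\<xi> \<circ> r) N w - C * f w = C * (m N w - f w)" for N w
    using C(1) by (simp add: m_def cesaro_means_def right_diff_distrib sum_divide_distrib[symmetric])
  have "(\<lambda>N. ennreal (1 + C) * modular (1/10) (\<lambda>w. m N w - f w)) \<longlonglongrightarrow> ennreal (1 + C) * 0"
    by (intro ennreal_tendsto_cmult lim') simp
  then have conv: "(\<lambda>N. modular (1/10/C) (\<lambda>w. cesaro_means (\<xi> \<circ> r) N w - C * f w)) \<longlonglongrightarrow> 0"
  proof -
    have le: "modular (1/10/C) (\<lambda>w. C * (m N w - f w)) \<le> ennreal (1 + C) * modular (1/10) (\<lambda>w. m N w - f w)" for N
      by (rule modular_scale_le[OF C(1)]) measurable
    assume "(\<lambda>N. ennreal (1 + C) * modular (1/10) (\<lambda>w. m N w - f w)) \<longlonglongrightarrow> ennreal (1 + C) * 0"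
    then have "(\<lambda>N. ennreal (1 + C) * modular (1/10) (\<lambda>w. m N w - f w)) \<longlonglongrightarrow> 0" by simp
    then show ?thesis
      unfolding mean_eq
      by (rule tendsto_sandwich[OF always_eventually always_eventually tendsto_const, rotated 2])
        ((rule allI)?, (rule zero_le | rule le))+
  qed
  have \<xi>_space: "\<xi> n \<in> L \<Psi>" for n
    using assms(1) by (simp add: norm_bounded_seq_def)
  have "(\<lambda>w. C * f w) \<in> L \<Psi>"
  proof -
    have "eventually (\<lambda>N. modular (1/10/C) (\<lambda>w. cesaro_means (\<xi> \<circ> r) N w - C * f w) \<le> ennreal 1) sequentially"
      by (rule ennreal_tendsto_0_le[OF conv]) simp
    then obtain N where N: "modular (1/10/C) (\<lambda>w. cesaro_means (\<xi> \<circ> r) N w - C * f w) \<le> 1"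
      by (auto simp: eventually_sequentially)
    have mean: "cesaro_means (\<xi> \<circ> r) N \<in> L \<Psi>"
      by (rule cesaro_means_orlicz) (simp add: \<xi>_space)
    have "(\<lambda>w. cesaro_means (\<xi> \<circ> r) N w - C * f w) \<in> L \<Psi>"
    proof (rule modular_finite[where c="1/10/C"])
      show "modular (1/10/C) (\<lambda>w. cesaro_means (\<xi> \<circ> r) N w - C * f w) < \<infinity>"
        using N by (rule le_less_trans) simp
    qed (use orlicz_space_measurable[OF mean] C in auto)
    from orlicz_space_diff[OF mean this] show ?thesis by simp
  qed
  then show ?thesis
    using rb conv C(1)
    by (intro exI[of _ r] exI[of _ "\<lambda>w. C * f w"] exI[of _ "1/10/C"]) auto
qed

text \<open>Cesaro means always involve the first term, so they are not forward. Since the n-th mean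
  has n + 1 terms, twice mean 2 n + 1 minus mean n is the average over the indices n + 1 to 2 n + 1.
  It is forward because r i \<ge> i, and it inherits the modular limit.\<close>

lemma forward_modular:
  assumes "norm_bounded_seq M \<Psi> \<xi>" "strict_mono r" "f \<in> L \<Psi>" "c > 0"
    "(\<lambda>N. modular c (\<lambda>w. cesaro_means (\<xi> \<circ> r) N w - f w)) \<longlonglongrightarrow> 0"
  shows "\<exists>\<zeta>. forward_convex_combinations \<xi> \<zeta> \<and> (\<forall>n. \<zeta> n \<in> L \<Psi>) \<and>
    (\<forall>n. modular (c / 4) (\<lambda>w. \<zeta> n w - f w) \<le> ennreal ((1/2) ^ n))"
proof -
  have \<xi>_space: "\<xi> n \<in> L \<Psi>" for n
    using assms(1) by (simp add: norm_bounded_seq_def)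
  define m where "m = cesaro_means (\<xi> \<circ> r)"
  have m_space: "m N \<in> L \<Psi>" for N
    unfolding m_def by (rule cesaro_means_orlicz) (simp add: \<xi>_space)
  note [measurable] = orlicz_space_measurable[OF m_space] orlicz_space_measurable[OF assms(3)]
  define \<zeta> where "\<zeta> = (\<lambda>n w. 2 * m (2 * n + 1) w - m n w)"
  have \<zeta>_space: "\<zeta> n \<in> L \<Psi>" for n
    unfolding \<zeta>_def by (intro orlicz_space_diff orlicz_space_cmult m_space)
  have conv_tail: "\<zeta> n \<in> conv_tail \<xi> n" for n
  proof -
    have inj: "inj_on r {n+1..2*n+1}"
      using strict_mono_imp_inj_on[OF assms(2)] inj_on_subset by blast
    have "\<zeta> n w = (\<Sum>k\<in>r ` {n+1..2*n+1}. (1 / real (n + 1)) * \<xi> k w)" for w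
    proof -
      have split: "{..2 * n + 1} = {..n} \<union> {n+1..2*n+1}" by auto
      have sum_split: "(\<Sum>i\<le>2*n+1. \<xi> (r i) w) = (\<Sum>i\<le>n. \<xi> (r i) w) + (\<Sum>i\<in>{n+1..2*n+1}. \<xi> (r i) w)"
        unfolding split by (rule sum.union_disjoint) auto
      have twice: "real (Suc (2 * n + 1)) = 2 * real (Suc n)" by simp
      have cancel: "2 * ((s + t) / (2 * d)) - s / d = t / d" if "d \<noteq> 0" for s t d :: real
        using that by (simp add: field_simps)
      have "\<zeta> n w = (\<Sum>i\<in>{n+1..2*n+1}. \<xi> (r i) w) / real (Suc n)"
        unfolding \<zeta>_def m_def cesaro_means_def o_def sum_split twice by (rule cancel) simp
      then show ?thesis
        by (simp only: sum.reindex[OF inj] o_def sum_divide_distrib) simp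
    qed
    then have eq: "\<zeta> n = (\<lambda>w. \<Sum>k\<in>r ` {n+1..2*n+1}. (1 / real (n + 1)) * \<xi> k w)" by (rule ext)
    have "r ` {n+1..2*n+1} \<subseteq> {n..}"
    proof clarify
      fix i assume "i \<in> {n+1..2*n+1}"
      then show "r i \<ge> n" using seq_suble[OF assms(2), of i] by simp
    qed
    moreover have "(\<Sum>k\<in>r ` {n+1..2*n+1}. 1 / real (n + 1)) = 1"
      by (simp only: sum_constant card_image[OF inj]) simp
    ultimately show ?thesis
      unfolding conv_tail_def eq
      by (intro CollectI exI[of _ "r ` {n+1..2*n+1}"] exI[of _ "\<lambda>_. 1 / real (n + 1)"]) simp
  qed
  define a where "a = (\<lambda>N. modular c (\<lambda>w. m N w - f w))"
  have a: "a \<longlonglongrightarrow> 0" using assms(5) by (simp add: a_def m_def)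
  have le: "modular (c / 4) (\<lambda>w. \<zeta> n w - f w) \<le> 2 * (a (2 * n + 1) + a n)" for n
  proof -
    have "modular (c / 4) (\<lambda>w. \<zeta> n w - f w)
        = modular (c / 4) (\<lambda>w. 2 * (m (2 * n + 1) w - f w) - (m n w - f w))"
      by (simp add: \<zeta>_def algebra_simps)
    also have "\<dots> \<le> 2 * (a (2 * n + 1) + a n)"
      unfolding a_def by (rule modular_combination_le[OF assms(4)]) measurable
    finally show ?thesis .
  qed
  have "(\<lambda>n. 2 * (a (2 * n + 1) + a n)) \<longlonglongrightarrow> 2 * (0 + 0)"
  proof (intro ennreal_tendsto_cmult tendsto_add a)
    have "strict_mono (\<lambda>n::nat. 2 * n + 1)" by (auto simp: strict_mono_def)
    from LIMSEQ_subseq_LIMSEQ[OF a this] show "(\<lambda>n. a (2 * n + 1)) \<longlonglongrightarrow> 0" by (simp add: o_def)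
  qed simp
  then have lim: "(\<lambda>n. 2 * (a (2 * n + 1) + a n)) \<longlonglongrightarrow> 0" by simp
  \<comment> \<open>Thinning the block averages produces the geometric rate required for an order
    bound; \<rho> j \<ge> j keeps the combinations forward.\<close>
  have "\<exists>n>n0. 2 * (a (2 * n + 1) + a n) \<le> ennreal ((1/2) ^ j)" for j n0
  proof -
    have "eventually (\<lambda>n. 2 * (a (2 * n + 1) + a n) \<le> ennreal ((1/2) ^ j) \<and> n > n0) sequentially"
      by (intro eventually_conj ennreal_tendsto_0_le[OF lim] eventually_gt_at_top) simp
    then show ?thesis by (auto simp: eventually_sequentially)
  qed
  then obtain \<rho> where \<rho>: "strict_mono (\<rho> :: nat \<Rightarrow> nat)"
      "\<And>j. 2 * (a (2 * \<rho> j + 1) + a (\<rho> j)) \<le> ennreal ((1/2) ^ j)"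
    using strict_mono_choice[of "\<lambda>j n. 2 * (a (2 * n + 1) + a n) \<le> ennreal ((1/2) ^ j)"] by blast
  have tail_mono: "conv_tail \<xi> n' \<subseteq> conv_tail \<xi> n" if "n \<le> n'" for n n'
  proof -
    have "{n'..} \<subseteq> {n..}" using that by auto
    then show ?thesis
      unfolding conv_tail_def by (intro Collect_mono ex_mono impI) (elim conjE exE, intro exI conjI, auto)
  qed
  show ?thesis
  proof (intro exI[of _ "\<lambda>n. \<zeta> (\<rho> n)"] conjI allI)
    show "forward_convex_combinations \<xi> (\<lambda>n. \<zeta> (\<rho> n))"
      unfolding forward_convex_combinations_def
      using conv_tail tail_mono[OF seq_suble[OF \<rho>(1)]] by blast
    show "modular (c / 4) (\<lambda>w. \<zeta> (\<rho> n) w - f w) \<le> ennreal ((1/2) ^ n)" for n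
      using le \<rho>(2) by (rule order_trans)
  qed (rule \<zeta>_space)
qed

end

section \<open>Weakly compact sets\<close>

lemma summable_small_finite_sums:
  fixes f :: "nat \<Rightarrow> real"
  assumes "summable f" "\<And>n. 0 \<le> f n" "\<epsilon> > 0"
  shows "\<exists>N. \<forall>F. finite F \<longrightarrow> F \<subseteq> {N..} \<longrightarrow> sum f F \<le> \<epsilon>"
proof -
  have "(\<lambda>n. sum f {..<n}) \<longlonglongrightarrow> suminf f" using assms(1) by (rule summable_LIMSEQ)
  then have "eventually (\<lambda>n. suminf f - \<epsilon> < sum f {..<n}) sequentially"
    by (rule order_tendstoD) (use assms in auto)
  then obtain N where N: "suminf f - \<epsilon> < sum f {..<N}" by (auto simp: eventually_sequentially)
  have "sum f F \<le> \<epsilon>" if "finite F" "F \<subseteq> {N..}" for F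
  proof -
    have "sum f (F \<union> {..<N}) \<le> suminf f"
      using assms that by (intro sum_le_suminf) auto
    moreover have "sum f (F \<union> {..<N}) = sum f F + sum f {..<N}"
      using that by (intro sum.union_disjoint) auto
    ultimately show ?thesis using N by linarith
  qed
  then show ?thesis by blast
qed

text \<open>If every point of K had a neighbourhood that the sequence eventually avoids, it would
  eventually avoid a finite subcover of K. Compactness of a general topology gives such cluster
  points, and the arguments below are built on them instead of on convergent subsequences.\<close>

lemma compactin_sequence_cluster:
  assumes "compactin T K" "\<And>n. \<kappa> n \<in> K"
  shows "\<exists>k\<in>K. \<forall>U. openin T U \<longrightarrow> k \<in> U \<longrightarrow> (\<forall>n0. \<exists>n\<ge>n0. \<kappa> (n :: nat) \<in> U)"
proof (rule ccontr)
  assume neg: "\<not> ?thesis"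
  define \<U> where "\<U> = {U. openin T U \<and> (\<exists>n0. \<forall>n\<ge>n0. \<kappa> n \<notin> U)}"
  have cover: "K \<subseteq> \<Union>\<U>"
  proof
    fix k assume "k \<in> K"
    then obtain U n0 where "openin T U" "k \<in> U" "\<forall>n\<ge>n0. \<kappa> n \<notin> U" using neg by auto
    then show "k \<in> \<Union>\<U>" unfolding \<U>_def by auto
  qed
  have opn: "\<forall>U\<in>\<U>. openin T U" by (simp add: \<U>_def)
  obtain \<F> where \<F>: "finite \<F>" "\<F> \<subseteq> \<U>" "K \<subseteq> \<Union>\<F>"
    using assms(1)[unfolded compactin_def, THEN conjunct2, rule_format, OF conjI, OF opn cover] by (elim exE conjE)
  then have "\<forall>U\<in>\<F>. eventually (\<lambda>n. \<kappa> n \<notin> U) sequentially"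
    unfolding \<U>_def eventually_sequentially by auto
  then have "eventually (\<lambda>n. \<forall>U\<in>\<F>. \<kappa> n \<notin> U) sequentially"
    using \<F>(1) by (simp add: eventually_ball_finite)
  then obtain n where "\<forall>U\<in>\<F>. \<kappa> n \<notin> U" by (auto simp: eventually_sequentially)
  then show False using assms(2)[of n] \<F>(3) by blast
qed

section \<open>Uniform smallness on weakly compact sets\<close>

context young_duality
begin

text \<open>The index may depend on the test function x, so the cluster point need not be the limit
  of one subsequence for all x together.\<close>

lemma weak_cluster:
  fixes \<kappa> :: "nat \<Rightarrow> 'a \<Rightarrow> real"
  assumes "weakly_compact K" "\<And>n. \<kappa> n \<in> K"
  shows "\<exists>k\<in>K. \<forall>x\<in>L \<Psi>. \<forall>\<epsilon>>0. \<forall>n0. \<exists>n\<ge>n0. \<bar>pairing M x (\<kappa> n) - pairing M x k\<bar> < \<epsilon>"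
proof -
  from compactin_sequence_cluster[OF assms]
  obtain k where k: "k \<in> K" and cl: "\<forall>U. openin (weak_topology M (L \<Phi>) (L \<Psi>)) U \<longrightarrow>
      k \<in> U \<longrightarrow> (\<forall>n0. \<exists>n\<ge>n0. \<kappa> n \<in> U)" ..
  have "k \<in> L \<Phi>"
    using compactin_subset_topspace[OF assms(1)] k dual.orlicz_space_zero
      topspace_weak_topology[of "L \<Psi>" M "L \<Phi>"] by blast
  then have "\<exists>n\<ge>n0. \<bar>pairing M x (\<kappa> n) - pairing M x k\<bar> < \<epsilon>"
    if "x \<in> L \<Psi>" "\<epsilon> > 0" for x \<epsilon> n0
    using cl[rule_format, OF openin_weak_topology[OF that(1) open_ball], of "pairing M x k" \<epsilon> n0] that
    by (auto simp: dist_real_def abs_minus_commute)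
  then show ?thesis using k by (intro bexI[of _ k] ballI allI impI)
qed

lemma weakly_compact_subset:
  assumes "weakly_compact K"
  shows "K \<subseteq> L \<Phi>"
  using compactin_subset_topspace[OF assms] dual.orlicz_space_zero
    topspace_weak_topology[of "L \<Psi>" M "L \<Phi>"] by blast

text \<open>An unbounded sequence of pairings could not return near its value at a cluster point.
  The bound makes the real suprema in the Mackey seminorms meaningful.\<close>

lemma pairing_bounded:
  assumes K: "weakly_compact K"
    and x: "x \<in> L \<Psi>"
  shows "\<exists>C. \<forall>k\<in>K. \<bar>pairing M x k\<bar> \<le> C"
proof (rule ccontr)
  assume "\<not> ?thesis"
  then have "\<forall>n::nat. \<exists>k\<in>K. \<bar>pairing M x k\<bar> > real n" by (meson not_le)
  then obtain \<kappa> where \<kappa>: "\<And>n. \<kappa> n \<in> K" "\<And>n. \<bar>pairing M x (\<kappa> n)\<bar> > real n" by metis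
  from weak_cluster[OF K \<kappa>(1)] obtain k where "k \<in> K" and "\<forall>x\<in>L \<Psi>. \<forall>\<epsilon>>0. \<forall>n0.
    \<exists>n\<ge>n0. \<bar>pairing M x (\<kappa> n) - pairing M x k\<bar> < \<epsilon>" ..
  then have k: "\<exists>n\<ge>n0. \<bar>pairing M x (\<kappa> n) - pairing M x k\<bar> < 1" for n0
    using x zero_less_one by blast
  obtain n0 :: nat where n0: "\<bar>pairing M x k\<bar> + 1 \<le> real n0" using real_arch_simple by blast
  obtain n where "n \<ge> n0" "\<bar>pairing M x (\<kappa> n) - pairing M x k\<bar> < 1" using k[of n0] by blast
  then show False using n0 \<kappa>(2)[of n] by linarith
qed

lemma orlicz_space_summand:
  fixes x :: "nat \<Rightarrow> 'a \<Rightarrow> real"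
  assumes g: "g \<in> L \<Psi>" and "\<And>i. x i \<in> borel_measurable M"
    and bound: "\<And>m w. (\<Sum>i<m. \<bar>x i w\<bar>) \<le> g w"
  shows "x i \<in> L \<Psi>"
proof (rule dual.orlicz_space_solid[OF g])
  have "\<bar>x i w\<bar> \<le> \<bar>g w\<bar>" for w
  proof -
    have "\<bar>x i w\<bar> \<le> (\<Sum>i<Suc i. \<bar>x i w\<bar>)" by (intro member_le_sum) auto
    then show ?thesis using bound[of w "Suc i"] by linarith
  qed
  then show "AE w in M. \<bar>x i w\<bar> \<le> \<bar>g w\<bar>" by simp
qed (rule assms)

text \<open>Domination of all partial sums of |x i| by one g in the space makes the series of
  pairings absolutely convergent. Each h thus becomes an element of l^1, and the sum of the series,
  as well as that of any subseries, is again a test function.\<close>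

lemma pairing_sums:
  fixes x :: "nat \<Rightarrow> 'a \<Rightarrow> real"
  assumes x [measurable]: "\<And>i. x i \<in> borel_measurable M" and g: "g \<in> L \<Psi>"
    and bound: "\<And>m w. (\<Sum>i<m. \<bar>x i w\<bar>) \<le> g w" and h: "h \<in> L \<Phi>"
  shows "(\<lambda>i. pairing M (x i) h) sums pairing M (\<lambda>w. \<Sum>i. x i w) h"
    and "summable (\<lambda>i. \<bar>pairing M (x i) h\<bar>)"
    and "(\<lambda>w. \<Sum>i. x i w) \<in> L \<Psi>"
proof -
  note [measurable] = orlicz_space_measurable[OF h] dual.orlicz_space_measurable[OF g]
  have summ: "summable (\<lambda>i. \<bar>x i w\<bar>)" for w
  proof (rule bounded_imp_summable)
    show "(\<Sum>i\<le>n. \<bar>x i w\<bar>) \<le> g w" for n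
      using bound[of w "Suc n"] by (simp only: lessThan_Suc_atMost)
  qed simp
  have g_nn: "0 \<le> g w" for w using bound[of w 0] by simp
  have x_space: "x i \<in> L \<Psi>" for i
    by (rule orlicz_space_summand[of g x i]) (rule g x bound)+
  have int: "integrable M (\<lambda>w. x i w * h w)" for i
    using integrable_pairing[OF h x_space[of i]] by (simp add: mult.commute)
  have int_g: "integrable M (\<lambda>w. \<bar>h w * g w\<bar>)"
    by (intro integrable_abs integrable_pairing h g)
  have summ_int: "summable (\<lambda>i. \<integral>w. norm (x i w * h w) \<partial>M)"
  proof (rule bounded_imp_summable)
    fix n
    have "(\<Sum>i\<le>n. \<integral>w. norm (x i w * h w) \<partial>M) = (\<integral>w. (\<Sum>i\<le>n. norm (x i w * h w)) \<partial>M)"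
      by (rule Bochner_Integration.integral_sum[symmetric]) (use int in auto)
    also have "\<dots> \<le> (\<integral>w. \<bar>h w * g w\<bar> \<partial>M)"
    proof (rule integral_mono[OF _ int_g])
      fix w
      have "(\<Sum>i\<le>n. norm (x i w * h w)) = (\<Sum>i<Suc n. \<bar>x i w\<bar>) * \<bar>h w\<bar>"
        by (simp only: lessThan_Suc_atMost sum_distrib_right real_norm_def abs_mult)
      also have "\<dots> \<le> g w * \<bar>h w\<bar>" by (intro mult_right_mono bound) simp
      also have "\<dots> = \<bar>h w * g w\<bar>" using g_nn[of w] by (simp add: abs_mult)
      finally show "(\<Sum>i\<le>n. norm (x i w * h w)) \<le> \<bar>h w * g w\<bar>" .
    qed (intro Bochner_Integration.integrable_sum integrable_norm int)
    finally show "(\<Sum>i\<le>n. \<integral>w. norm (x i w * h w) \<partial>M) \<le> (\<integral>w. \<bar>h w * g w\<bar> \<partial>M)" .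
  qed simp
  have "summable (\<lambda>i. norm (x i w * h w))" for w
    using summable_mult2[OF summ[of w], of "\<bar>h w\<bar>"] by (simp add: abs_mult)
  then have "(\<lambda>i. \<integral>w. x i w * h w \<partial>M) sums (\<integral>w. (\<Sum>i. x i w * h w) \<partial>M)"
    by (intro sums_integral int summ_int) auto
  moreover have "(\<Sum>i. x i w * h w) = (\<Sum>i. x i w) * h w" for w
    using summable_rabs_cancel[OF summ[of w]] by (simp add: suminf_mult2)
  ultimately show "(\<lambda>i. pairing M (x i) h) sums pairing M (\<lambda>w. \<Sum>i. x i w) h"
    by (simp add: pairing_def)
  show "summable (\<lambda>i. \<bar>pairing M (x i) h\<bar>)"
    unfolding pairing_def
    by (rule summable_comparison_test'[OF summ_int, of 0]) (simp add: integral_abs_bound[of M "\<lambda>w. x _ w * h w"])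
  show "(\<lambda>w. \<Sum>i. x i w) \<in> L \<Psi>"
  proof (rule dual.orlicz_space_solid[OF g])
    show "(\<lambda>w. \<Sum>i. x i w) \<in> borel_measurable M"
      by (rule borel_measurable_LIMSEQ_real[where u="\<lambda>n w. \<Sum>i<n. x i w"])
         (use summable_LIMSEQ[OF summable_rabs_cancel[OF summ]] in auto)
    have "\<bar>\<Sum>i. x i w\<bar> \<le> \<bar>g w\<bar>" for w
    proof -
      have "\<bar>\<Sum>i. x i w\<bar> \<le> (\<Sum>i. \<bar>x i w\<bar>)" by (rule summable_rabs[OF summ])
      also have "\<dots> \<le> g w" by (rule suminf_le_const[OF summ bound])
      finally show ?thesis by simp
    qed
    then show "AE w in M. \<bar>\<Sum>i. x i w\<bar> \<le> \<bar>g w\<bar>" by simp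
  qed
qed

lemma sum_subsequence_le:
  assumes "\<And>m w. (\<Sum>i<m. \<bar>x i w\<bar>) \<le> (g w :: real)" "strict_mono (s :: nat \<Rightarrow> nat)"
  shows "(\<Sum>i<m. \<bar>x (s i) w\<bar>) \<le> g w"
proof -
  have "(\<Sum>i<m. \<bar>x (s i) w\<bar>) = (\<Sum>i\<in>s ` {..<m}. \<bar>x i w\<bar>)"
    using strict_mono_imp_inj_on[OF assms(2)]
    by (subst sum.reindex) (auto intro: inj_on_subset)
  also have "\<dots> \<le> (\<Sum>i<s m. \<bar>x i w\<bar>)"
    by (rule sum_mono2) (use assms(2) in \<open>auto simp: strict_mono_less\<close>)
  also have "\<dots> \<le> g w" by (rule assms(1))
  finally show ?thesis .
qed

text \<open>The gliding hump argument that proves the Schur property of \<open>\<ell>\<^sup>1\<close>: every element \<open>k\<close> of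
  \<open>K\<close> yields the summable sequence of its pairings with the \<open>x\<^sub>i\<close>.\<close>

lemma no_gliding_hump:
  assumes K: "weakly_compact K"
    and \<kappa>: "\<And>n. \<kappa> n \<in> K"
    and x [measurable]: "\<And>i. x i \<in> borel_measurable M" and g: "g \<in> L \<Psi>"
    and bound: "\<And>m w. (\<Sum>i<m. \<bar>x i w\<bar>) \<le> g w"
    and \<delta>: "\<delta> > 0" and hump: "\<And>i. pairing M (x i) (\<kappa> i) \<ge> \<delta>"
    and conv: "\<And>i. convergent (\<lambda>n. pairing M (x i) (\<kappa> n))"
  shows False
proof -
  note sub = weakly_compact_subset[OF K]
  have x_space: "x i \<in> L \<Psi>" for i
    by (rule orlicz_space_summand[of g x i]) (rule g x bound)+
  obtain \<alpha> where \<alpha>: "\<And>i. (\<lambda>n. pairing M (x i) (\<kappa> n)) \<longlonglongrightarrow> \<alpha> i"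
    using conv unfolding convergent_def by metis
  \<comment> \<open>The pairings with each x i converge along the whole sequence, so every cluster
    point of every subsequence has the same coordinates \<alpha> i.\<close>
  have cluster_limit: "pairing M (x i) k' = \<alpha> i"
    if s: "strict_mono (s :: nat \<Rightarrow> nat)" and k': "\<And>x \<epsilon> n0. x \<in> L \<Psi> \<Longrightarrow> \<epsilon> > 0 \<Longrightarrow>
       \<exists>n\<ge>n0. \<bar>pairing M x (\<kappa> (s n)) - pairing M x k'\<bar> < \<epsilon>" for s k' i
  proof (rule ccontr)
    assume "pairing M (x i) k' \<noteq> \<alpha> i"
    then have e: "\<bar>pairing M (x i) k' - \<alpha> i\<bar> / 2 > 0" (is "?e > 0") by simp
    obtain n0 where n0: "\<And>n. n \<ge> n0 \<Longrightarrow> \<bar>pairing M (x i) (\<kappa> n) - \<alpha> i\<bar> < ?e"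
      using LIMSEQ_D[OF \<alpha>[of i] e] by auto
    obtain n where n: "n \<ge> n0" "\<bar>pairing M (x i) (\<kappa> (s n)) - pairing M (x i) k'\<bar> < ?e"
      using k'[OF x_space e] by blast
    have "s n \<ge> n0" using seq_suble[OF s, of n] n(1) by linarith
    have "\<bar>pairing M (x i) k' - \<alpha> i\<bar> \<le>
        \<bar>pairing M (x i) (\<kappa> (s n)) - \<alpha> i\<bar> + \<bar>pairing M (x i) (\<kappa> (s n)) - pairing M (x i) k'\<bar>"
      by linarith
    also have "\<dots> < ?e + ?e" by (rule add_strict_mono[OF n0[OF \<open>s n \<ge> n0\<close>] n(2)])
    finally show False by simp
  qed
  from weak_cluster[OF K, of "\<lambda>n. \<kappa> n", OF \<kappa>] obtain k where k1: "k \<in> K" and k_cl: "\<forall>x\<in>L \<Psi>.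
      \<forall>\<epsilon>>0. \<forall>n0. \<exists>n\<ge>n0. \<bar>pairing M x (\<kappa> n) - pairing M x k\<bar> < \<epsilon>" ..
  then have k: "k \<in> K" "\<And>x \<epsilon> n0. x \<in> L \<Psi> \<Longrightarrow> \<epsilon> > 0 \<Longrightarrow>
       \<exists>n\<ge>n0. \<bar>pairing M x (\<kappa> n) - pairing M x k\<bar> < \<epsilon>"
    by simp_all
  have k_lim: "pairing M (x i) k = \<alpha> i" for i
    using cluster_limit[of id k i] k(2) by (simp add: strict_mono_def)
  \<comment> \<open>Row n holds the coordinates of \<kappa> n relative to the cluster point k.
    Columns tend to 0 and rows are summable. As the coordinates of k itself tend to 0, the diagonal
    eventually stays above \<delta> / 2.\<close>
  define A where "A = (\<lambda>n i. pairing M (x i) (\<kappa> n) - pairing M (x i) k)"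
  have A_lim: "(\<lambda>n. A n i) \<longlonglongrightarrow> 0" for i
    unfolding A_def using tendsto_diff[OF \<alpha>[of i] tendsto_const[of "pairing M (x i) k"]] by (simp add: k_lim)
  have A_summ: "summable (\<lambda>i. \<bar>A n i\<bar>)" for n
  proof (rule summable_comparison_test'[of _ 0])
    show "summable (\<lambda>i. \<bar>pairing M (x i) (\<kappa> n)\<bar> + \<bar>pairing M (x i) k\<bar>)"
      by (intro summable_add pairing_sums(2)[OF x g bound]) (use \<kappa> k sub in auto)
  qed (simp add: A_def)
  have "(\<lambda>i. \<bar>pairing M (x i) k\<bar>) \<longlonglongrightarrow> 0"
    by (intro summable_LIMSEQ_zero pairing_sums(2)[OF x g bound]) (use k sub in auto)
  from order_tendstoD(2)[OF this, of "\<delta> / 2"] obtain n1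
    where n1: "\<And>i. i \<ge> n1 \<Longrightarrow> \<bar>pairing M (x i) k\<bar> < \<delta> / 2"
    using \<delta> by (auto simp: eventually_sequentially)
  have diag: "A n n \<ge> \<delta> / 2" if "n \<ge> n1" for n
    using n1[OF that] hump[of n] by (simp add: A_def)
  \<comment> \<open>From R on, the columns up to n are negligible in all later rows, and row n is
    negligible in all later columns. Iterating such skips leaves one hump per row.\<close>
  define skip where "skip = (\<lambda>n R. n < R \<and> (\<forall>n'\<ge>R. (\<Sum>i\<le>n. \<bar>A n' i\<bar>) \<le> \<delta> / 8) \<and>
      (\<forall>F. finite F \<longrightarrow> F \<subseteq> {R..} \<longrightarrow> (\<Sum>i\<in>F. \<bar>A n i\<bar>) \<le> \<delta> / 8))"
  have "\<exists>R. skip n R" for n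
  proof -
    have "(\<lambda>n'. \<Sum>i\<le>n. \<bar>A n' i\<bar>) \<longlonglongrightarrow> (\<Sum>i\<le>n. \<bar>0\<bar>)"
      by (intro tendsto_sum tendsto_rabs A_lim)
    from order_tendstoD(2)[OF this, of "\<delta> / 8"] obtain R1
      where R1: "\<And>n'. n' \<ge> R1 \<Longrightarrow> (\<Sum>i\<le>n. \<bar>A n' i\<bar>) < \<delta> / 8"
      using \<delta> by (auto simp: eventually_sequentially)
    obtain R2 where R2: "\<And>F. finite F \<Longrightarrow> F \<subseteq> {R2..} \<Longrightarrow> (\<Sum>i\<in>F. \<bar>A n i\<bar>) \<le> \<delta> / 8"
      using summable_small_finite_sums[OF A_summ[of n], of "\<delta> / 8"] \<delta> by auto
    show ?thesis
      unfolding skip_def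
    proof (intro exI[of _ "max (max R1 R2) (Suc n)"] conjI allI impI)
      fix F :: "nat set" assume F: "finite F" "F \<subseteq> {max (max R1 R2) (Suc n)..}"
      then have "F \<subseteq> {R2..}" by auto
      then show "(\<Sum>i\<in>F. \<bar>A n i\<bar>) \<le> \<delta> / 8" by (rule R2[OF F(1)])
    next
      fix n' assume "max (max R1 R2) (Suc n) \<le> n'"
      then show "(\<Sum>i\<le>n. \<bar>A n' i\<bar>) \<le> \<delta> / 8" using R1[of n'] by simp
    qed simp
  qed
  then obtain R where "\<And>n. skip n (R n)" by metis
  note R = this[unfolded skip_def]
  have R_tail: "(\<Sum>i\<in>F. \<bar>A n i\<bar>) \<le> \<delta> / 8" if "finite F" "F \<subseteq> {R n..}" for F n
    using R[THEN conjunct2, THEN conjunct2, rule_format, OF that] .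
  define p where "p = (\<lambda>l. (R ^^ l) n1)"
  have p_Suc: "p (Suc l) = R (p l)" for l by (simp add: p_def)
  have p: "strict_mono p" unfolding strict_mono_Suc_iff by (simp add: p_Suc R)
  have p_mono: "i \<le> j \<Longrightarrow> p i \<le> p j" for i j using p by (simp add: strict_mono_less_eq)
  have p_ge: "n1 \<le> p l" for l using p_mono[of 0 l] by (simp add: p_def)
  have inj: "inj_on p S" for S using strict_mono_imp_inj_on[OF p] inj_on_subset by blast
  define z where "z = (\<lambda>w. \<Sum>i. x (p i) w)"
  have x': "x (p i) \<in> borel_measurable M" for i by measurable
  have bound': "(\<Sum>i<m. \<bar>x (p i) w\<bar>) \<le> g w" for m w
    by (rule sum_subsequence_le[OF _ p]) (rule bound)
  note sums_z = pairing_sums[of "\<lambda>i. x (p i)" g, OF x' g bound', folded z_def]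
  \<comment> \<open>The test function \<open>z\<close> adds up only the selected x (p i). In row p l
    the hump gives \<delta> / 2, and the columns before and after it cost at most \<delta> / 8
    each.\<close>
  have partial: "(\<Sum>j<m. A (p l) (p j)) \<ge> \<delta> / 4" if "m > l" for m l
  proof -
    have split: "{..<m} = {..<l} \<union> {l} \<union> {l<..<m}" using that by auto
    have eq: "(\<Sum>j<m. A (p l) (p j)) = (\<Sum>j<l. A (p l) (p j)) + A (p l) (p l) + (\<Sum>j\<in>{l<..<m}. A (p l) (p j))"
      unfolding split by (subst sum.union_disjoint, simp, simp, force)+ simp
    have "(\<Sum>j<l. \<bar>A (p l) (p j)\<bar>) \<le> \<delta> / 8"
    proof (cases l)
      case (Suc l')
      have "(\<Sum>j<l. \<bar>A (p l) (p j)\<bar>) = (\<Sum>i\<in>p ` {..<l}. \<bar>A (p l) i\<bar>)"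
        by (subst sum.reindex[OF inj]) simp
      also have "\<dots> \<le> (\<Sum>i\<le>p l'. \<bar>A (p l) i\<bar>)"
        by (rule sum_mono2) (auto simp: Suc intro: p_mono)
      also have "\<dots> \<le> \<delta> / 8" using R by (simp add: Suc p_Suc)
      finally show ?thesis .
    qed (use \<delta> in simp)
    then have 1: "(\<Sum>j<l. A (p l) (p j)) \<ge> - (\<delta> / 8)"
      using sum_abs[of "\<lambda>j. A (p l) (p j)" "{..<l}"] by linarith
    have "(\<Sum>j\<in>{l<..<m}. \<bar>A (p l) (p j)\<bar>) = (\<Sum>i\<in>p ` {l<..<m}. \<bar>A (p l) i\<bar>)"
      by (subst sum.reindex[OF inj]) simp
    also have "\<dots> \<le> \<delta> / 8"
    proof -
      have "p ` {l<..<m} \<subseteq> {R (p l)..}" by (auto simp flip: p_Suc intro!: p_mono)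
      then show ?thesis by (intro R_tail) simp_all
    qed
    finally have 2: "(\<Sum>j\<in>{l<..<m}. A (p l) (p j)) \<ge> - (\<delta> / 8)"
      using sum_abs[of "\<lambda>j. A (p l) (p j)" "{l<..<m}"] by linarith
    show ?thesis using 1 2 diag[OF p_ge[of l]] unfolding eq by linarith
  qed
  have gap: "pairing M z (\<kappa> (p l)) - pairing M z k \<ge> \<delta> / 4" for l
  proof -
    have "(\<lambda>j. pairing M (x (p j)) (\<kappa> (p l)) - pairing M (x (p j)) k) sums (pairing M z (\<kappa> (p l)) - pairing M z k)"
      by (intro sums_diff sums_z) (use \<kappa> k sub in auto)
    then have "(\<lambda>m. \<Sum>j<m. A (p l) (p j)) \<longlonglongrightarrow> pairing M z (\<kappa> (p l)) - pairing M z k"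
      by (simp add: sums_def A_def)
    then show ?thesis
      by (rule LIMSEQ_le_const) (use partial in \<open>auto intro!: exI[of _ "Suc l"]\<close>)
  qed
  from weak_cluster[OF K, of "\<lambda>n. \<kappa> (p n)", OF \<kappa>] obtain k' where k'1: "k' \<in> K" and k'_cl: "\<forall>x\<in>L \<Psi>.
      \<forall>\<epsilon>>0. \<forall>n0. \<exists>n\<ge>n0. \<bar>pairing M x (\<kappa> (p n)) - pairing M x k'\<bar> < \<epsilon>" ..
  then have k': "k' \<in> K" "\<And>x \<epsilon> n0. x \<in> L \<Psi> \<Longrightarrow> \<epsilon> > 0 \<Longrightarrow>
       \<exists>n\<ge>n0. \<bar>pairing M x (\<kappa> (p n)) - pairing M x k'\<bar> < \<epsilon>"
    by simp_all
  \<comment> \<open>A cluster point of the selected rows has the coordinates of k, hence also the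
    same pairing with z. This contradicts the gap \<delta> / 4 in every selected row.\<close>
  have same: "pairing M (x i) k' = pairing M (x i) k" for i
    using cluster_limit[OF p k'(2)] by (simp add: k_lim)
  have "(\<lambda>j. pairing M (x (p j)) k') sums pairing M z k'" "(\<lambda>j. pairing M (x (p j)) k) sums pairing M z k"
    by (rule sums_z, use k' k sub in auto)+
  then have "pairing M z k' = pairing M z k"
    unfolding same by (rule sums_unique2)
  moreover have "z \<in> L \<Psi>" by (rule sums_z(3)) (use k sub in auto)
  then obtain l where "\<bar>pairing M z (\<kappa> (p l)) - pairing M z k'\<bar> < \<delta> / 4"
    using k'(2)[of z "\<delta> / 4" 0] \<delta> by auto
  ultimately show False using gap[of l] by linarith
qed

text \<open>Weak compactness bounds the pairings, so a diagonal subsequence makes them converge.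
  Thinning x and \<kappa> by the same subsequence preserves both the humps and the domination by
  g.\<close>

lemma weakly_compact_no_hump:
  fixes x :: "nat \<Rightarrow> 'a \<Rightarrow> real"
  assumes K: "weakly_compact K"
    and \<kappa>: "\<And>n. \<kappa> n \<in> K"
    and x [measurable]: "\<And>i. x i \<in> borel_measurable M" and g: "g \<in> L \<Psi>"
    and bound: "\<And>m w. (\<Sum>i<m. \<bar>x i w\<bar>) \<le> g w"
    and \<delta>: "\<delta> > 0" and hump: "\<And>i. pairing M (x i) (\<kappa> i) \<ge> \<delta>"
  shows False
proof -
  have x_space: "x i \<in> L \<Psi>" for i
    by (rule orlicz_space_summand[of g x i]) (rule g x bound)+
  have "bounded (range (\<lambda>n. pairing M (x i) (\<kappa> n)))" for i
  proof -
    obtain C where "\<forall>k\<in>K. \<bar>pairing M (x i) k\<bar> \<le> C" using pairing_bounded[OF K x_space[of i]] ..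
    then show ?thesis using \<kappa> by (intro boundedI[of _ C]) auto
  qed
  then obtain s where s: "strict_mono (s :: nat \<Rightarrow> nat)" "\<And>i. convergent (\<lambda>n. pairing M (x i) (\<kappa> (s n)))"
    using diagonal_convergent[of "\<lambda>i n. pairing M (x i) (\<kappa> n)"] by metis
  have bound': "(\<Sum>i<m. \<bar>x (s i) w\<bar>) \<le> g w" for m w
    by (rule sum_subsequence_le[OF _ s(1)]) (rule bound)
  show False
    by (rule no_gliding_hump[of K "\<lambda>n. \<kappa> (s n)" "\<lambda>n. x (s n)" g \<delta>])
       (rule K \<kappa> x g bound' \<delta> hump s(2))+
qed

text \<open>Otherwise some \<kappa> n in K have E[|\<kappa> n| Y n] > \<epsilon>. For each of them
  dominated convergence finds a later Y j with less than \<epsilon> / 2, so the difference of the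
  two carries more than \<epsilon> / 2. Consecutive differences telescope below Y 0 and thus form a
  forbidden sequence of humps.\<close>

lemma weakly_compact_equi_order_continuous:
  assumes K: "weakly_compact K"
    and Y [measurable]: "\<And>j. Y j \<in> borel_measurable M" and Y0: "Y 0 \<in> L \<Psi>"
    and nn: "\<And>j w. 0 \<le> Y j w" and decr: "\<And>j w. Y (Suc j) w \<le> Y j w"
    and lim: "AE w in M. (\<lambda>j. Y j w) \<longlonglongrightarrow> 0" and \<epsilon>: "\<epsilon> > 0"
  shows "\<exists>n. \<forall>k\<in>K. (\<integral>w. \<bar>k w\<bar> * Y n w \<partial>M) \<le> \<epsilon>"
proof (rule ccontr)
  assume "\<not> ?thesis"
  then have all: "\<forall>n. \<exists>k. k \<in> K \<and> (\<integral>w. \<bar>k w\<bar> * Y n w \<partial>M) > \<epsilon>" by (meson not_le)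
  obtain \<kappa> where \<kappa>: "\<forall>n. \<kappa> n \<in> K \<and> (\<integral>w. \<bar>\<kappa> n w\<bar> * Y n w \<partial>M) > \<epsilon>"
    using choice[OF all] by (elim exE)
  have \<kappa>_space: "\<kappa> n \<in> L \<Phi>" for n using \<kappa> weakly_compact_subset[OF K] by blast
  note [measurable] = orlicz_space_measurable[OF \<kappa>_space]
  have mono: "Y j' w \<le> Y j w" if "j \<le> j'" for j j' w
    using lift_Suc_antimono_le[of "\<lambda>j. Y j w"] decr that by blast
  have int: "integrable M (\<lambda>w. \<bar>\<kappa> n w\<bar> * Y j w)" for n j
  proof (rule Bochner_Integration.integrable_bound[OF integrable_pairing[OF \<kappa>_space[of n] Y0]])
    have "\<bar>\<kappa> n w\<bar> * Y j w \<le> \<bar>\<kappa> n w\<bar> * Y 0 w" for w by (intro mult_left_mono mono) auto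
    then show "AE w in M. norm (\<bar>\<kappa> n w\<bar> * Y j w) \<le> norm (\<kappa> n w * Y 0 w)"
      using nn by (simp add: abs_mult)
  qed measurable
  have "\<exists>j>n. (\<integral>w. \<bar>\<kappa> n w\<bar> * Y j w \<partial>M) < \<epsilon> / 2" for n
  proof -
    have "(\<lambda>j. \<integral>w. \<bar>\<kappa> n w\<bar> * Y j w \<partial>M) \<longlonglongrightarrow> (\<integral>w. 0 \<partial>M)"
    proof (rule integral_dominated_convergence[OF _ _ int[of n 0]])
      show "AE w in M. (\<lambda>j. \<bar>\<kappa> n w\<bar> * Y j w) \<longlonglongrightarrow> 0"
        using lim by eventually_elim (rule tendsto_mult_right_zero)
      show "AE w in M. norm (\<bar>\<kappa> n w\<bar> * Y j w) \<le> \<bar>\<kappa> n w\<bar> * Y 0 w" for j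
        using nn mono[of 0 j] by (auto simp: abs_mult intro!: mult_left_mono)
    qed measurable
    then have "eventually (\<lambda>j. (\<integral>w. \<bar>\<kappa> n w\<bar> * Y j w \<partial>M) < \<epsilon> / 2 \<and> j > n) sequentially"
      using \<epsilon> by (intro eventually_conj order_tendstoD(2) eventually_gt_at_top) auto
    then show ?thesis by (auto simp: eventually_sequentially)
  qed
  then have all': "\<forall>n. \<exists>j>n. (\<integral>w. \<bar>\<kappa> n w\<bar> * Y j w \<partial>M) < \<epsilon> / 2" by (rule allI)
  obtain R where R: "\<forall>n. R n > n \<and> (\<integral>w. \<bar>\<kappa> n w\<bar> * Y (R n) w \<partial>M) < \<epsilon> / 2"
    using choice[OF all'] by (elim exE)
  define p where "p = (\<lambda>l. (R ^^ l) 0)"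
  have p_Suc: "p (Suc l) = R (p l)" for l by (simp add: p_def)
  have p: "strict_mono p" unfolding strict_mono_Suc_iff by (simp add: p_Suc R)
  \<comment> \<open>The sign moves the absolute value of \<kappa> into the test function without
    changing its size.\<close>
  define x where "x = (\<lambda>i w. sgn (\<kappa> (p i) w) * (Y (p i) w - Y (p (Suc i)) w))"
  have d_nn: "0 \<le> Y (p i) w - Y (p (Suc i)) w" for i w
    using mono[of "p i" "p (Suc i)" w] p by (simp add: strict_mono_less_eq)
  show False
  proof (rule weakly_compact_no_hump[OF K, of "\<lambda>i. \<kappa> (p i)" x "Y 0" "\<epsilon> / 2"])
    show "(\<Sum>i<m. \<bar>x i w\<bar>) \<le> Y 0 w" for m w
    proof -
      have "(\<Sum>i<m. \<bar>x i w\<bar>) \<le> (\<Sum>i<m. Y (p i) w - Y (p (Suc i)) w)"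
        using d_nn by (intro sum_mono) (auto simp: x_def abs_mult abs_sgn_eq)
      also have "\<dots> = Y (p 0) w - Y (p m) w" by (rule sum_lessThan_telescope')
      also have "\<dots> \<le> Y 0 w" using nn[of "p m" w] by (simp add: p_def)
      finally show ?thesis .
    qed
    show "\<epsilon> / 2 \<le> pairing M (x i) (\<kappa> (p i))" for i
    proof -
      have "pairing M (x i) (\<kappa> (p i)) = (\<integral>w. \<bar>\<kappa> (p i) w\<bar> * Y (p i) w - \<bar>\<kappa> (p i) w\<bar> * Y (p (Suc i)) w \<partial>M)"
        unfolding pairing_def x_def
        by (intro Bochner_Integration.integral_cong) (auto simp: sgn_if algebra_simps)
      also have "\<dots> = (\<integral>w. \<bar>\<kappa> (p i) w\<bar> * Y (p i) w \<partial>M) - (\<integral>w. \<bar>\<kappa> (p i) w\<bar> * Y (p (Suc i)) w \<partial>M)"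
        by (intro Bochner_Integration.integral_diff int)
      also have "\<dots> \<ge> \<epsilon> / 2"
        using \<kappa>[rule_format, of "p i"] R[rule_format, of "p i"] unfolding p_Suc by linarith
      finally show ?thesis .
    qed
    show "x i \<in> borel_measurable M" for i unfolding x_def by measurable
  qed (use \<kappa> \<epsilon> Y0 in auto)
qed

text \<open>Only fast modular convergence provides a dominating sequence. So a failure for
  infinitely many indices is thinned to a fast subsequence of failures, whose decreasing majorants Y
  are uniformly small on K.\<close>

lemma modular_null_uniform:
  assumes K: "weakly_compact K"
    and [measurable]: "\<And>n. u n \<in> borel_measurable M" and c: "c > 0"
    and lim: "(\<lambda>n. dual.modular c (u n)) \<longlonglongrightarrow> 0" and \<epsilon>: "\<epsilon> > 0"
  shows "eventually (\<lambda>n. \<forall>k\<in>K. \<bar>pairing M k (u n)\<bar> \<le> \<epsilon>) sequentially"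
proof (rule ccontr)
  assume neg: "\<not> ?thesis"
  define Q where "Q = (\<lambda>j n. dual.modular c (u n) \<le> ennreal ((1/2) ^ j) \<and> \<not> (\<forall>k\<in>K. \<bar>pairing M k (u n)\<bar> \<le> \<epsilon>))"
  have "\<exists>n>n0. Q j n" for j n0
  proof -
    have "eventually (\<lambda>n. dual.modular c (u n) \<le> ennreal ((1/2) ^ j) \<and> n > n0) sequentially"
      by (intro eventually_conj ennreal_tendsto_0_le[OF lim] eventually_gt_at_top) simp
    note ev = this
    show ?thesis
    proof (rule ccontr)
      assume no: "\<not> ?thesis"
      have "eventually (\<lambda>n. \<forall>k\<in>K. \<bar>pairing M k (u n)\<bar> \<le> \<epsilon>) sequentially"
        using ev by eventually_elim (use no in \<open>auto simp: Q_def\<close>)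
      with neg show False by contradiction
    qed
  qed
  then obtain \<rho> where \<rho>: "strict_mono (\<rho> :: nat \<Rightarrow> nat)" "\<And>j. Q j (\<rho> j)"
    using strict_mono_choice[of Q] by blast
  have meas: "u (\<rho> n) \<in> borel_measurable M" for n by measurable
  have fast: "dual.modular c (u (\<rho> n)) \<le> ennreal ((1/2) ^ n)" for n
    using \<rho>(2)[of n] by (simp add: Q_def)
  show False
  proof (rule dual.decreasing_order_bound[of "\<lambda>n. u (\<rho> n)" c, OF meas c fast])
    fix Y assume Y: "\<And>j. Y j \<in> borel_measurable M" "Y 0 \<in> L \<Psi>"
      "\<And>j w. 0 \<le> Y j w" "\<And>j w. Y (Suc j) w \<le> Y j w"
      "AE w in M. (\<lambda>j. Y j w) \<longlonglongrightarrow> 0 \<and> (\<forall>n. \<bar>u (\<rho> n) w\<bar> \<le> Y n w)"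
    have Y_lim: "AE w in M. (\<lambda>j. Y j w) \<longlonglongrightarrow> 0" and u_le: "AE w in M. \<forall>n. \<bar>u (\<rho> n) w\<bar> \<le> Y n w"
      using Y(5) by auto
    obtain n where n: "\<And>k. k \<in> K \<Longrightarrow> (\<integral>w. \<bar>k w\<bar> * Y n w \<partial>M) \<le> \<epsilon>"
      using weakly_compact_equi_order_continuous[OF K Y(1-4) Y_lim \<epsilon>] by blast
    obtain k where k: "k \<in> K" "\<bar>pairing M k (u (\<rho> n))\<bar> > \<epsilon>"
      using \<rho>(2)[of n] unfolding Q_def by (auto simp: not_le)
    have k_space: "k \<in> L \<Phi>" using k weakly_compact_subset[OF K] by blast
    note [measurable] = orlicz_space_measurable[OF k_space] Y(1)
    have Yn: "Y n \<in> L \<Psi>"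
    proof (rule dual.orlicz_space_solid[OF Y(2)])
      have "Y n w \<le> Y 0 w" for w using lift_Suc_antimono_le[of "\<lambda>j. Y j w" 0 n] Y(4) by blast
      then show "AE w in M. \<bar>Y n w\<bar> \<le> \<bar>Y 0 w\<bar>" using Y(3) by simp
    qed (rule Y)
    have int: "integrable M (\<lambda>w. \<bar>k w\<bar> * Y n w)"
      using integrable_abs[OF integrable_pairing[OF k_space Yn]] Y(3) by (simp add: abs_mult)
    have u_bound: "AE w in M. norm (k w * u (\<rho> n) w) \<le> \<bar>k w\<bar> * Y n w"
      using u_le by eventually_elim (auto simp: abs_mult intro: mult_left_mono)
    have "\<bar>pairing M k (u (\<rho> n))\<bar> \<le> (\<integral>w. norm (k w * u (\<rho> n) w) \<partial>M)"
      unfolding pairing_def using integral_norm_bound[of M "\<lambda>w. k w * u (\<rho> n) w"] by simp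
    also have "\<dots> \<le> (\<integral>w. \<bar>k w\<bar> * Y n w \<partial>M)"
    proof (rule integral_mono_AE[OF _ int u_bound])
      show "integrable M (\<lambda>w. norm (k w * u (\<rho> n) w))"
        by (rule Bochner_Integration.integrable_bound[OF int]) (use u_bound Y(3) in \<open>auto simp: abs_mult\<close>)
    qed
    also have "\<dots> \<le> \<epsilon>" by (rule n[OF k(1)])
    finally show False using k(2) by simp
  qed
qed

section \<open>Mackey and weak limits\<close>

lemma pairing_lincomb:
  assumes "\<eta> \<in> L \<Phi>" "finite F" "\<And>k. k \<in> F \<Longrightarrow> \<xi> k \<in> L \<Psi>"
  shows "pairing M \<eta> (\<lambda>w. \<Sum>k\<in>F. c k * \<xi> k w) = (\<Sum>k\<in>F. c k * pairing M \<eta> (\<xi> k))"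
proof -
  have "pairing M \<eta> (\<lambda>w. \<Sum>k\<in>F. c k * \<xi> k w) = (\<integral>w. (\<Sum>k\<in>F. c k * (\<eta> w * \<xi> k w)) \<partial>M)"
    unfolding pairing_def
    by (intro Bochner_Integration.integral_cong) (auto simp: sum_distrib_left ac_simps)
  also have "\<dots> = (\<Sum>k\<in>F. \<integral>w. c k * (\<eta> w * \<xi> k w) \<partial>M)"
    by (intro Bochner_Integration.integral_sum integrable_mult_right integrable_pairing assms)
  finally show ?thesis by (simp add: pairing_def)
qed

text \<open>A subbasic ball need not be centred at f. Its radius exceeds the seminorm s of f - \<xi>
  by \<epsilon> - s, and half of this slack absorbs u n - f uniformly on K.\<close>

lemma limitin_mackey_topologyI:
  assumes u: "\<And>n. u n \<in> L \<Psi>" and f: "f \<in> L \<Psi>" and c: "c > 0"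
    and lim: "(\<lambda>n. dual.modular c (\<lambda>w. u n w - f w)) \<longlonglongrightarrow> 0"
  shows "limitin mackey_topo u f sequentially"
  unfolding mackey_topology_def
proof (rule limitin_topology_generated_byI)
  let ?S = "{{\<zeta> \<in> L \<Psi>. (SUP \<eta>\<in>K. \<bar>pairing M \<eta> (\<lambda>w. \<zeta> w - \<xi> w)\<bar>) < \<epsilon>} |K \<xi> \<epsilon>.
          K \<noteq> {} \<and> absolutely_convex K \<and>
          weakly_compact K \<and>
          \<xi> \<in> L \<Psi> \<and> \<epsilon> > 0}"
  \<comment> \<open>The underlying set is the union of the subbase, so one ball containing f has to
    be exhibited; the trivial compact set K = {0} provides it.\<close>
  have "weakly_compact {\<lambda>_. 0}"
    using topspace_weak_topology[of "L \<Psi>" M "L \<Phi>"] f orlicz_space_zero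
    by (intro finite_imp_compactin) auto
  moreover have "absolutely_convex {\<lambda>_::'a. 0 :: real}" by (simp add: absolutely_convex_def)
  ultimately have "{\<zeta> \<in> L \<Psi>. (SUP \<eta>\<in>{\<lambda>_. 0}. \<bar>pairing M \<eta> (\<lambda>w. \<zeta> w - f w)\<bar>) < 1} \<in> ?S"
    using f by (intro CollectI exI[of _ "{\<lambda>_. 0}"] exI[of _ f] exI[of _ "1::real"]) auto
  moreover have "f \<in> {\<zeta> \<in> L \<Psi>. (SUP \<eta>\<in>{\<lambda>_. 0}. \<bar>pairing M \<eta> (\<lambda>w. \<zeta> w - f w)\<bar>) < 1}"
    using f by (simp add: pairing_def)
  ultimately show "f \<in> \<Union>?S" by (rule UnionI)
  fix U assume "U \<in> ?S" "f \<in> U"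
  then obtain K \<xi> \<epsilon> where U: "U = {\<zeta> \<in> L \<Psi>. (SUP \<eta>\<in>K. \<bar>pairing M \<eta> (\<lambda>w. \<zeta> w - \<xi> w)\<bar>) < \<epsilon>}"
    and K: "K \<noteq> {}" "weakly_compact K"
    and \<xi>: "\<xi> \<in> L \<Psi>" by auto
  define s where "s = (SUP \<eta>\<in>K. \<bar>pairing M \<eta> (\<lambda>w. f w - \<xi> w)\<bar>)"
  have s: "s < \<epsilon>" using \<open>f \<in> U\<close> by (simp add: U s_def)
  have f\<xi>: "(\<lambda>w. f w - \<xi> w) \<in> L \<Psi>" by (rule dual.orlicz_space_diff[OF f \<xi>])
  obtain C where C: "\<forall>k\<in>K. \<bar>pairing M (\<lambda>w. f w - \<xi> w) k\<bar> \<le> C"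
    using pairing_bounded[OF K(2) f\<xi>] ..
  have s_ge: "\<bar>pairing M k (\<lambda>w. f w - \<xi> w)\<bar> \<le> s" if "k \<in> K" for k
    unfolding s_def
  proof (rule cSUP_upper[OF that])
    show "bdd_above ((\<lambda>\<eta>. \<bar>pairing M \<eta> (\<lambda>w. f w - \<xi> w)\<bar>) ` K)"
      using C by (intro bdd_aboveI[of _ C]) (auto simp: pairing_commute[of M "\<lambda>w. f w - \<xi> w"])
  qed
  have "eventually (\<lambda>n. \<forall>k\<in>K. \<bar>pairing M k (\<lambda>w. u n w - f w)\<bar> \<le> (\<epsilon> - s) / 2) sequentially"
    using modular_null_uniform[OF K(2) _ c lim, of "(\<epsilon> - s) / 2"] s
      dual.orlicz_space_measurable[OF u] dual.orlicz_space_measurable[OF f] by auto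
  then show "eventually (\<lambda>n. u n \<in> U) sequentially"
  proof eventually_elim
    case (elim n)
    have "(SUP \<eta>\<in>K. \<bar>pairing M \<eta> (\<lambda>w. u n w - \<xi> w)\<bar>) \<le> (\<epsilon> + s) / 2"
    proof (rule cSUP_least[OF K(1)])
      fix k assume k: "k \<in> K"
      then have k_space: "k \<in> L \<Phi>" using weakly_compact_subset[OF K(2)] by auto
      have "pairing M k (\<lambda>w. u n w - \<xi> w) = pairing M k (\<lambda>w. u n w - f w) + pairing M k (\<lambda>w. f w - \<xi> w)"
        using pairing_diff[OF k_space] u f \<xi> by simp
      moreover have "\<bar>pairing M k (\<lambda>w. u n w - f w)\<bar> \<le> (\<epsilon> - s) / 2" using elim k by blast
      moreover have "(\<epsilon> - s) / 2 + s = (\<epsilon> + s) / 2" by (simp add: field_simps)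
      ultimately show "\<bar>pairing M k (\<lambda>w. u n w - \<xi> w)\<bar> \<le> (\<epsilon> + s) / 2"
        using s_ge[OF k] by linarith
    qed
    also have "\<dots> < \<epsilon>" using s by simp
    finally show "u n \<in> U" using u by (simp add: U)
  qed
qed

text \<open>Singletons are weakly compact, so the uniform estimate applied to {\<eta>} gives
  convergence of each pairing.\<close>

lemma limitin_weak_of_modular:
  assumes u: "\<And>n. u n \<in> L \<Psi>" and f: "f \<in> L \<Psi>" and c: "c > 0"
    and lim: "(\<lambda>n. dual.modular c (\<lambda>w. u n w - f w)) \<longlonglongrightarrow> 0"
  shows "limitin weak_topo u f sequentially"
proof (rule limitin_weak_topologyI[OF f _ u])
  show "L \<Phi> \<noteq> {}" using orlicz_space_zero by blast
  fix \<eta> assume \<eta>: "\<eta> \<in> L \<Phi>"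
  have K: "weakly_compact {\<eta>}"
    using topspace_weak_topology[of "L \<Psi>" M "L \<Phi>"] f \<eta>
    by (intro finite_imp_compactin) auto
  show "(\<lambda>n. pairing M \<eta> (u n)) \<longlonglongrightarrow> pairing M \<eta> f"
  proof (rule LIMSEQ_I)
    fix e :: real assume "e > 0"
    then have "eventually (\<lambda>n. \<forall>k\<in>{\<eta>}. \<bar>pairing M k (\<lambda>w. u n w - f w)\<bar> \<le> e / 2) sequentially"
      using modular_null_uniform[OF K _ c lim, of "e / 2"]
        dual.orlicz_space_measurable[OF u] dual.orlicz_space_measurable[OF f] by auto
    then have "eventually (\<lambda>n. norm (pairing M \<eta> (u n) - pairing M \<eta> f) < e) sequentially"
      by eventually_elim (use \<open>e > 0\<close> in \<open>simp add: pairing_diff[OF \<eta> u f]\<close>)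
    then show "\<exists>no. \<forall>n\<ge>no. norm (pairing M \<eta> (u n) - pairing M \<eta> f) < e"
      by (simp add: eventually_sequentially)
  qed
qed

text \<open>The segment of all t \<eta> with |t| \<le> 1 is absolutely convex and, as a continuous
  image of an interval, weakly compact. Its Mackey seminorm dominates the pairing with
  \<eta>.\<close>

lemma limitin_mackey_topologyD:
  assumes u: "\<And>n. u n \<in> L \<Psi>"
    and lim: "limitin mackey_topo u l sequentially"
  shows "limitin weak_topo u l sequentially"
proof -
  have l: "l \<in> L \<Psi>"
    using limitin_topspace[OF lim] unfolding mackey_topology_def by auto
  show ?thesis
  proof (rule limitin_weak_topologyI[OF l _ u])
    show "L \<Phi> \<noteq> {}" using orlicz_space_zero by blast
    fix \<eta> assume \<eta>: "\<eta> \<in> L \<Phi>"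
    define K where "K = (\<lambda>t w. t * \<eta> w) ` {-1..1::real}"
    have pairing_scale: "pairing M g (\<lambda>w. t * \<eta> w) = t * pairing M g \<eta>" for g t
      by (simp add: pairing_def mult.left_commute)
    have "continuous_map euclidean (weak_topology M (L \<Phi>) (L \<Psi>)) (\<lambda>t w. t * \<eta> w)"
      unfolding weak_topology_def
    proof (rule continuous_on_generated_topo)
      fix V assume "V \<in> {{\<xi> \<in> L \<Phi>. pairing M g \<xi> \<in> U} |g U. g \<in> L \<Psi> \<and> open U}"
      then obtain g U where V: "V = {\<xi> \<in> L \<Phi>. pairing M g \<xi> \<in> U}" "open U" by auto
      have "(\<lambda>t w. t * \<eta> w) -` V \<inter> topspace euclidean = (\<lambda>t. t * pairing M g \<eta>) -` U"
        using orlicz_space_cmult[OF \<eta>] by (auto simp: V pairing_scale)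
      also have "open \<dots>" by (intro open_vimage V continuous_intros)
      finally show "openin euclidean ((\<lambda>t w. t * \<eta> w) -` V \<inter> topspace euclidean)" by simp
    next
      have "UNIV \<in> {U :: real set. open U}" by simp
      then show "(\<lambda>t w. t * \<eta> w) ` topspace euclidean
          \<subseteq> \<Union>{{\<xi> \<in> L \<Phi>. pairing M g \<xi> \<in> U} |g U. g \<in> L \<Psi> \<and> open U}"
        using orlicz_space_cmult[OF \<eta>] l by (fastforce intro: exI[of _ l] exI[of _ "UNIV :: real set"])
    qed
    then have K: "weakly_compact K"
      unfolding K_def by (intro image_compactin[of euclidean]) auto
    have ac: "absolutely_convex K"
      unfolding absolutely_convex_def
    proof (intro ballI allI impI)
      fix f g :: "'a \<Rightarrow> real" and a b :: real
      assume "f \<in> K" "g \<in> K" and ab: "\<bar>a\<bar> + \<bar>b\<bar> \<le> 1"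
      then obtain s t where st: "\<bar>s\<bar> \<le> 1" "\<bar>t\<bar> \<le> 1" "f = (\<lambda>w. s * \<eta> w)" "g = (\<lambda>w. t * \<eta> w)"
        by (auto simp: K_def abs_le_iff)
      have "\<bar>a * s + b * t\<bar> \<le> \<bar>a\<bar> * \<bar>s\<bar> + \<bar>b\<bar> * \<bar>t\<bar>"
        using abs_triangle_ineq[of "a * s" "b * t"] by (simp add: abs_mult)
      also have "\<dots> \<le> \<bar>a\<bar> * 1 + \<bar>b\<bar> * 1" using st by (intro add_mono mult_left_mono) auto
      finally have "a * s + b * t \<in> {-1..1}" using ab by (auto simp: abs_le_iff)
      moreover have "(\<lambda>w. a * f w + b * g w) = (\<lambda>w. (a * s + b * t) * \<eta> w)"
        by (simp add: st algebra_simps)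
      ultimately show "(\<lambda>w. a * f w + b * g w) \<in> K" unfolding K_def by blast
    qed
    show "(\<lambda>n. pairing M \<eta> (u n)) \<longlonglongrightarrow> pairing M \<eta> l"
    proof (rule LIMSEQ_I)
      fix e :: real assume e: "e > 0"
      define V where "V = {\<zeta> \<in> L \<Psi>. (SUP k\<in>K. \<bar>pairing M k (\<lambda>w. \<zeta> w - l w)\<bar>) < e}"
      have K_ne: "K \<noteq> {}" by (simp add: K_def)
      have "openin mackey_topo V"
        unfolding mackey_topology_def V_def
        by (rule topology_generated_by_Basis) (use K_ne ac K l e in blast)
      moreover have "l \<in> V" using l e K_ne by (simp add: V_def pairing_def)
      ultimately have "eventually (\<lambda>n. u n \<in> V) sequentially"
        using lim unfolding limitin_def by blast
      then have "eventually (\<lambda>n. norm (pairing M \<eta> (u n) - pairing M \<eta> l) < e) sequentially"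
      proof eventually_elim
        case (elim n)
        define d where "d = (\<lambda>w. u n w - l w)"
        have "\<eta> = (\<lambda>w. 1 * \<eta> w)" by simp
        then have \<eta>K: "\<eta> \<in> K" unfolding K_def by (rule image_eqI) simp
        have "bdd_above ((\<lambda>k. \<bar>pairing M k d\<bar>) ` K)"
        proof (rule bdd_aboveI2)
          fix k assume "k \<in> K"
          then obtain t where t: "\<bar>t\<bar> \<le> 1" "k = (\<lambda>w. t * \<eta> w)" by (auto simp: K_def abs_le_iff)
          have "\<bar>pairing M k d\<bar> = \<bar>t\<bar> * \<bar>pairing M \<eta> d\<bar>"
            using pairing_scale[of d t] by (simp add: t(2) pairing_commute[of M _ d] abs_mult)
          also have "\<dots> \<le> 1 * \<bar>pairing M \<eta> d\<bar>" using t by (intro mult_right_mono) auto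
          finally show "\<bar>pairing M k d\<bar> \<le> \<bar>pairing M \<eta> d\<bar>" by simp
        qed
        then have "\<bar>pairing M \<eta> d\<bar> \<le> (SUP k\<in>K. \<bar>pairing M k d\<bar>)" by (rule cSUP_upper[OF \<eta>K])
        also have "\<dots> < e" using elim by (simp add: V_def d_def)
        finally show ?case by (simp add: d_def pairing_diff[OF \<eta> u l])
      qed
      then show "\<exists>no. \<forall>n\<ge>no. norm (pairing M \<eta> (u n) - pairing M \<eta> l) < e"
        by (simp add: eventually_sequentially)
    qed
  qed
qed

end

section \<open>Order bounds from fast modular convergence\<close>

context young_space
begin

lemma order_bounded_of_modular:
  assumes \<zeta>: "\<And>n. \<zeta> n \<in> L \<Psi>" and f: "f \<in> L \<Psi>" and c: "c > 0"
    and fast: "\<And>n. modular c (\<lambda>w. \<zeta> n w - f w) \<le> ennreal ((1/2) ^ n)"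
  shows "order_bounded_seq M \<Psi> \<zeta>"
proof -
  note [measurable] = orlicz_space_measurable[OF \<zeta>] orlicz_space_measurable[OF f]
  have meas: "(\<lambda>w. \<zeta> n w - f w) \<in> borel_measurable M" for n by measurable
  show ?thesis
  proof (rule decreasing_order_bound[of "\<lambda>n w. \<zeta> n w - f w" c, OF meas c fast])
    fix Y assume Y: "Y 0 \<in> L \<Psi>" "\<And>j w. 0 \<le> Y j w" "\<And>j w. Y (Suc j) w \<le> Y j w"
      "AE w in M. (\<lambda>j. Y j w) \<longlonglongrightarrow> 0 \<and> (\<forall>n. \<bar>\<zeta> n w - f w\<bar> \<le> Y n w)"
    \<comment> \<open>The supremum is finite almost surely, being at most |f| + Y 0. Where it is
      infinite \<open>real_of_ereal\<close> returns 0, which only concerns a null set.\<close>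
    define \<eta> where "\<eta> = (\<lambda>w. real_of_ereal (SUP n. ereal \<bar>\<zeta> n w\<bar>))"
    have \<eta>_meas: "\<eta> \<in> borel_measurable M" unfolding \<eta>_def by measurable
    have bound: "AE w in M. (SUP n. ereal \<bar>\<zeta> n w\<bar>) = ereal (\<eta> w) \<and> \<bar>\<eta> w\<bar> \<le> \<bar>f w\<bar> + Y 0 w"
      using Y(4)
    proof eventually_elim
      case (elim w)
      have "\<bar>\<zeta> n w\<bar> \<le> \<bar>f w\<bar> + Y 0 w" for n
      proof -
        have "Y n w \<le> Y 0 w" using lift_Suc_antimono_le[of "\<lambda>j. Y j w" 0 n] Y(3) by blast
        moreover have "\<bar>\<zeta> n w - f w\<bar> \<le> Y n w" using elim by blast
        ultimately show ?thesis by linarith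
      qed
      then have le: "(SUP n. ereal \<bar>\<zeta> n w\<bar>) \<le> ereal (\<bar>f w\<bar> + Y 0 w)"
        by (intro SUP_least) simp
      moreover have ge: "0 \<le> (SUP n. ereal \<bar>\<zeta> n w\<bar>)"
        by (rule SUP_upper2[of 0]) auto
      ultimately have eq: "(SUP n. ereal \<bar>\<zeta> n w\<bar>) = ereal (\<eta> w)"
        unfolding \<eta>_def by (intro ereal_real'[symmetric]) auto
      with le ge show ?case by simp
    qed
    have "(\<lambda>w. \<bar>f w\<bar> + Y 0 w) \<in> L \<Psi>"
      by (intro orlicz_space_add Y orlicz_space_solid[OF f]) auto
    then have "\<eta> \<in> L \<Psi>"
    proof (rule orlicz_space_solid[OF _ \<eta>_meas])
      show "AE w in M. \<bar>\<eta> w\<bar> \<le> \<bar>\<bar>f w\<bar> + Y 0 w\<bar>"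
        using bound by eventually_elim (use Y(2) in auto)
    qed
    then show ?thesis
      unfolding order_bounded_seq_def using bound \<zeta> by (intro conjI allI bexI[of _ \<eta>]) auto
  qed
qed

end

section \<open>Atomless probability spaces\<close>

context prob_space
begin

text \<open>A set without atoms splits into two parts of positive probability, and the smaller one
  has at most half of the probability. Repetition gives the power of 2.\<close>

lemma atomless_small_subset:
  assumes "atomless M" "B \<in> sets M" "prob B > 0"
  shows "\<exists>A\<in>sets M. A \<subseteq> B \<and> 0 < prob A \<and> prob A \<le> prob B / 2 ^ n"
proof (induction n)
  case 0
  then show ?case using assms by auto
next
  case (Suc n)
  then obtain A where A: "A \<in> sets M" "A \<subseteq> B" "0 < prob A" "prob A \<le> prob B / 2 ^ n" by auto
  then obtain C where C: "C \<in> sets M" "C \<subseteq> A" "prob C \<noteq> 0" "prob C \<noteq> prob A"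
    using assms(1) unfolding atomless_def by blast
  have diff: "prob (A - C) = prob A - prob C" using A C by (intro finite_measure_Diff)
  have le: "prob C \<le> prob A" using A C by (intro finite_measure_mono)
  have half: "prob A / 2 \<le> prob B / 2 ^ Suc n" using A by simp
  show ?case
  proof (cases "prob C \<le> prob A / 2")
    case True
    then show ?thesis using A C half by (intro bexI[of _ C]) (auto simp: zero_less_measure_iff)
  next
    case False
    then show ?thesis using A C half diff le by (intro bexI[of _ "A - C"]) auto
  qed
qed

text \<open>Sierpinski's theorem: exhaust \<open>B\<close> greedily by sets that are at least half as large as
  possible.\<close>

lemma atomless_intermediate:
  assumes atomless: "atomless M" and B: "B \<in> sets M" and t: "0 \<le> t" "t \<le> prob B"
  shows "\<exists>A\<in>sets M. A \<subseteq> B \<and> prob A = t"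
proof -
  define P where "P = (\<lambda>S. S \<in> sets M \<and> S \<subseteq> B \<and> prob S \<le> t)"
  define Q where "Q = (\<lambda>S S'. S \<subseteq> S' \<and> (\<forall>C\<in>sets M. C \<subseteq> B - S \<longrightarrow> prob S + prob C \<le> t \<longrightarrow>
      prob C \<le> 2 * (prob S' - prob S)))"
  have "\<exists>S. \<forall>n. P (S n) \<and> Q (S n) (S (Suc n))"
  proof (rule dependent_nat_choice)
    show "\<exists>S. P S" using t by (intro exI[of _ "{}"]) (simp add: P_def)
    fix S :: "'a set" and n :: nat assume S: "P S"
    define \<C> where "\<C> = {C \<in> sets M. C \<subseteq> B - S \<and> prob S + prob C \<le> t}"
    define s where "s = (SUP C\<in>\<C>. prob C)"
    have empty: "{} \<in> \<C>" using S by (simp add: \<C>_def P_def)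
    have bdd: "bdd_above (prob ` \<C>)" by (rule bdd_aboveI2[of _ _ 1]) simp
    have le_s: "prob C \<le> s" if "C \<in> \<C>" for C unfolding s_def by (rule cSUP_upper[OF that bdd])
    have "\<exists>C\<in>\<C>. s \<le> 2 * prob C"
    proof (cases "s \<le> 0")
      case True
      then show ?thesis using empty by (intro bexI[of _ "{}"]) auto
    next
      case False
      then have "s / 2 < (SUP C\<in>\<C>. prob C)" by (simp add: s_def[symmetric])
      then obtain C where "C \<in> \<C>" "s / 2 < prob C"
        using less_cSUP_iff[OF _ bdd] empty by blast
      then show ?thesis by (intro bexI[of _ C]) auto
    qed
    then obtain C where C: "C \<in> \<C>" "s \<le> 2 * prob C" ..
    have union: "prob (S \<union> C) = prob S + prob C"
      using C S by (intro finite_measure_Union) (auto simp: \<C>_def P_def)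
    show "\<exists>S'. P S' \<and> Q S S'"
    proof (intro exI[of _ "S \<union> C"] conjI)
      show "P (S \<union> C)" using C S by (auto simp: P_def \<C>_def union)
      have "prob D \<le> 2 * prob C" if "D \<in> sets M" "D \<subseteq> B - S" "prob S + prob D \<le> t" for D
        using le_s[of D] that C by (simp add: \<C>_def)
      then show "Q S (S \<union> C)" by (auto simp: Q_def union)
    qed
  qed
  then obtain S where "\<forall>n. P (S n) \<and> Q (S n) (S (Suc n))" ..
  then have P: "\<And>n. P (S n)" and Q: "\<And>n. Q (S n) (S (Suc n))" by simp_all
  have sets: "S n \<in> sets M" and sub: "S n \<subseteq> B" and le_t: "prob (S n) \<le> t" for n
    using P[of n] by (auto simp: P_def)
  define A where "A = (\<Union>n. S n)"
  have A: "A \<in> sets M" "A \<subseteq> B" using sets sub by (auto simp: A_def)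
  have "incseq S" by (rule incseq_SucI) (use Q in \<open>auto simp: Q_def\<close>)
  then have lim: "(\<lambda>n. prob (S n)) \<longlonglongrightarrow> prob A"
    unfolding A_def using sets by (intro finite_Lim_measure_incseq) auto
  have A_le: "prob A \<le> t" by (rule LIMSEQ_le_const2[OF lim]) (use le_t in auto)
  \<comment> \<open>If room were left, a small set C outside A would be admissible at every stage.
    Each greedy step would then gain at least half of its probability, against the convergence of
    the probabilities.\<close>
  have "prob A = t"
  proof (rule ccontr)
    assume "prob A \<noteq> t"
    then have lt: "prob A < t" using A_le by simp
    have "prob (B - A) = prob B - prob A" using A B by (intro finite_measure_Diff)
    then have pos: "prob (B - A) > 0" using lt t by simp
    obtain n where n: "(1/2) ^ n < t - prob A" using real_arch_pow_inv[of "t - prob A" "1/2"] lt by auto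
    obtain C where C: "C \<in> sets M" "C \<subseteq> B - A" "0 < prob C" "prob C \<le> prob (B - A) / 2 ^ n"
      using atomless_small_subset[OF atomless _ pos, of n] A B by auto
    have "prob (B - A) / 2 ^ n \<le> 1 / 2 ^ n" by (intro divide_right_mono) auto
    then have C_le: "prob C \<le> t - prob A" using C n by (simp add: power_divide)
    have "prob C \<le> 2 * (prob (S (Suc m)) - prob (S m))" for m
    proof -
      have "prob (S m) \<le> prob A" using A sets by (intro finite_measure_mono) (auto simp: A_def)
      moreover have "C \<subseteq> B - S m" using C by (auto simp: A_def)
      ultimately show ?thesis using Q[of m] C C_le by (auto simp: Q_def)
    qed
    moreover have "(\<lambda>m. 2 * (prob (S (Suc m)) - prob (S m))) \<longlonglongrightarrow> 2 * (prob A - prob A)"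
      by (intro tendsto_intros LIMSEQ_Suc[OF lim] lim)
    ultimately have "prob C \<le> 2 * (prob A - prob A)" by (intro LIMSEQ_le_const) auto
    then show False using C by simp
  qed
  then show ?thesis using A by blast
qed

text \<open>The complement always has enough probability for the next event, so increasing sets with
  the cumulative probabilities can be built; their successive differences form the family.\<close>

lemma atomless_disjoint_family:
  fixes q :: "nat \<Rightarrow> real"
  assumes atomless: "atomless M" and q: "\<And>n. 0 \<le> q n" "\<And>n. (\<Sum>i<n. q i) \<le> 1"
  shows "\<exists>A. disjoint_family A \<and> (\<forall>n. A n \<in> sets M \<and> prob (A n) = q n)"
proof -
  have "\<exists>U. \<forall>n. (U n \<in> sets M \<and> prob (U n) = (\<Sum>i<n. q i)) \<and> U n \<subseteq> U (Suc n)"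
  proof (rule dependent_nat_choice)
    show "\<exists>U. U \<in> sets M \<and> prob U = (\<Sum>i<0. q i)" by (intro exI[of _ "{}"]) simp
    fix U and n :: nat assume U: "U \<in> sets M \<and> prob U = (\<Sum>i<n. q i)"
    have "prob (space M - U) = 1 - (\<Sum>i<n. q i)" using U by (simp add: prob_compl)
    then have "q n \<le> prob (space M - U)" using q(2)[of "Suc n"] by simp
    then obtain C where C: "C \<in> sets M" "C \<subseteq> space M - U" "prob C = q n"
      using atomless_intermediate[OF atomless, of "space M - U" "q n"] U q by auto
    have "prob (U \<union> C) = prob U + prob C" using C U by (intro finite_measure_Union) auto
    then show "\<exists>U'. (U' \<in> sets M \<and> prob U' = (\<Sum>i<Suc n. q i)) \<and> U \<subseteq> U'"
      using C U by (intro exI[of _ "U \<union> C"]) auto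
  qed
  then obtain U where U: "\<forall>n. (U n \<in> sets M \<and> prob (U n) = (\<Sum>i<n. q i)) \<and> U n \<subseteq> U (Suc n)" ..
  then have mono: "U m \<subseteq> U n" if "m \<le> n" for m n using lift_Suc_mono_le[of U] that by blast
  have "disjoint_family (\<lambda>n. U (Suc n) - U n)"
    unfolding disjoint_family_on_def
  proof (intro ballI impI)
    fix m n :: nat assume "m \<noteq> n"
    then consider "Suc m \<le> n" | "Suc n \<le> m" by linarith
    then show "(U (Suc m) - U m) \<inter> (U (Suc n) - U n) = {}"
      by cases (use mono in blast)+
  qed
  moreover have "U (Suc n) - U n \<in> sets M \<and> prob (U (Suc n) - U n) = q n" for n
    using U finite_measure_Diff[of "U (Suc n)" "U n"] by auto
  ultimately show ?thesis by (intro exI[of _ "\<lambda>n. U (Suc n) - U n"]) blast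
qed

end

section \<open>Failure of the growth condition\<close>

text \<open>The mass of \<xi> n sits on A n and escapes along the disjoint events. Averaging with
  weights of sum 1 keeps the pairing with the total function at 1 / 2, while the pairing with each
  single piece dies out. Each of the three kinds of convergence or boundedness would contradict
  this.\<close>

locale disjoint_counterexample = young_duality M \<Phi> \<Psi> for M :: "'a measure" and \<Phi> \<Psi> +
  fixes A :: "nat \<Rightarrow> 'a set" and y :: "nat \<Rightarrow> real" and \<xi> :: "nat \<Rightarrow> 'a \<Rightarrow> real"
  assumes disjoint: "disjoint_family A" and A [measurable]: "\<And>n. A n \<in> sets M"
    and total_space: "(\<lambda>w. \<Sum>n. y n * indicator (A n) w) \<in> L \<Phi>"
    and piece_space: "\<And>n. (\<lambda>w. y n * indicator (A n) w) \<in> L \<Phi>"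
    and \<xi>_ball: "\<And>n. \<xi> n \<in> orlicz_ball M \<Psi>"
    and \<xi>_off: "\<And>n w. w \<notin> A n \<Longrightarrow> \<xi> n w = 0"
    and piece_pairing: "\<And>n. pairing M (\<lambda>w. y n * indicator (A n) w) (\<xi> n) = 1 / 2"
begin

abbreviation piece :: "nat \<Rightarrow> 'a \<Rightarrow> real" where
  "piece n \<equiv> \<lambda>w. y n * indicator (A n) w"

definition total :: "'a \<Rightarrow> real" where
  "total w = (\<Sum>n. piece n w)"

lemma total_in_space: "total \<in> L \<Phi>"
  using total_space by (simp add: total_def[abs_def])

lemma only: "w \<in> A m \<Longrightarrow> w \<in> A n \<Longrightarrow> m = n"
  using disjoint unfolding disjoint_family_on_def by blast

lemma total_on: "w \<in> A n \<Longrightarrow> total w = y n"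
proof -
  assume "w \<in> A n"
  then have "total w = (\<Sum>m\<in>{n}. piece m w)"
    unfolding total_def by (intro suminf_finite) (use only in \<open>auto simp: indicator_def\<close>)
  with \<open>w \<in> A n\<close> show ?thesis by simp
qed

lemma norm_bounded: "norm_bounded_seq M \<Psi> \<xi>"
  by (rule dual.norm_bounded_seqI) (rule \<xi>_ball)

lemma \<xi>_space: "\<xi> n \<in> L \<Psi>"
  using norm_bounded by (simp add: norm_bounded_seq_def)

lemma piece_pairing_eq: "pairing M (piece m) (\<xi> n) = (if m = n then 1 / 2 else 0)"
proof (cases "m = n")
  case False
  then have "(\<lambda>w. piece m w * \<xi> n w) = (\<lambda>_. 0)"
    using only[of _ m n] \<xi>_off[of _ n] by (force simp: indicator_def)
  then show ?thesis using False by (simp only: pairing_def if_False) simp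
qed (use piece_pairing in simp)

lemma total_pairing: "pairing M total (\<xi> n) = 1 / 2"
proof -
  have "total w * \<xi> n w = piece n w * \<xi> n w" for w
    using \<xi>_off[of w n] by (cases "w \<in> A n") (auto simp: total_on)
  then show ?thesis using piece_pairing[of n] by (simp only: pairing_def)
qed

lemma conv_tail_total_pairing:
  assumes "\<zeta> \<in> conv_tail \<xi> n"
  shows "pairing M total \<zeta> = 1 / 2"
proof -
  obtain F c where F: "\<zeta> = (\<lambda>w. \<Sum>k\<in>F. c k * \<xi> k w)" "finite F" "(\<Sum>k\<in>F. c k) = (1::real)"
    using assms by (auto simp: conv_tail_def)
  have "pairing M total \<zeta> = (\<Sum>k\<in>F. c k * (1 / 2))"
    unfolding F(1) pairing_lincomb[OF total_in_space F(2) \<xi>_space] total_pairing ..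
  then show ?thesis using F(3) by (simp flip: sum_divide_distrib)
qed

lemma conv_tail_off:
  assumes "\<zeta> \<in> conv_tail \<xi> n" "m < n" "w \<in> A m"
  shows "\<zeta> w = 0"
proof -
  obtain F c where F: "\<zeta> = (\<lambda>w. \<Sum>k\<in>F. c k * \<xi> k w)" "F \<subseteq> {n..}"
    using assms by (auto simp: conv_tail_def)
  have "\<xi> k w = 0" if "k \<in> F" for k
    using \<xi>_off[of w k] only[of w m k] assms F(2) that by fastforce
  then show ?thesis by (simp add: F(1))
qed

text \<open>The product of the total function and z is integrable. On each event a partial sum of
  the pieces times z is either this product or 0, so dominated convergence makes the pairing with z
  countably additive over the pieces: 1 / 2 would be a sum of zeros.\<close>

lemma no_weak_limit:
  assumes lim: "limitin weak_topo \<zeta> z sequentially"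
    and half: "\<And>n. pairing M total (\<zeta> n) = 1 / 2"
    and pieces: "\<And>m. (\<lambda>n. pairing M (piece m) (\<zeta> n)) \<longlonglongrightarrow> 0"
  shows False
proof -
  have z: "z \<in> L \<Psi>" by (rule limitin_weak_topologyD(1)[OF lim total_in_space])
  have "pairing M total z = 1 / 2"
    using limitin_weak_topologyD(2)[OF lim total_in_space] unfolding half LIMSEQ_const_iff by (rule sym)
  moreover have zero: "pairing M (piece m) z = 0" for m
    using LIMSEQ_unique[OF limitin_weak_topologyD(2)[OF lim piece_space] pieces] .
  note [measurable] = dual.orlicz_space_measurable[OF z] orlicz_space_measurable[OF total_in_space]
  have "(\<lambda>N. \<integral>w. (\<Sum>m<N. piece m w * z w) \<partial>M) \<longlonglongrightarrow> (\<integral>w. total w * z w \<partial>M)"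
  proof (rule integral_dominated_convergence[where w="\<lambda>w. \<bar>total w * z w\<bar>"])
    show "integrable M (\<lambda>w. \<bar>total w * z w\<bar>)"
      by (intro integrable_abs integrable_pairing total_in_space z)
    have eq: "(\<Sum>m<N. piece m w * z w) = (if n < N then total w * z w else 0)" if "w \<in> A n" for n N w
    proof -
      have "piece m w * z w = (if m = n then total w * z w else 0)" for m
      proof (cases "m = n")
        case False
        then have "w \<notin> A m" using only[OF that, of m] by blast
        then show ?thesis using False by simp
      qed (use that in \<open>simp add: total_on[OF that]\<close>)
      then show ?thesis by (simp add: sum.delta)
    qed
    have off: "piece m w = 0" "total w = 0" if "\<nexists>n. w \<in> A n" for w m
      using that by (auto simp: total_def)
    show "AE w in M. (\<lambda>N. \<Sum>m<N. piece m w * z w) \<longlonglongrightarrow> total w * z w"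
    proof (rule AE_I2)
      fix w
      show "(\<lambda>N. \<Sum>m<N. piece m w * z w) \<longlonglongrightarrow> total w * z w"
      proof (cases "\<exists>n. w \<in> A n")
        case True
        then obtain n where n: "w \<in> A n" ..
        have "eventually (\<lambda>N. (\<Sum>m<N. piece m w * z w) = total w * z w) sequentially"
          using eventually_gt_at_top[of n] by eventually_elim (simp add: eq[OF n])
        then show ?thesis by (rule tendsto_eventually)
      qed (simp add: off)
    qed
    show "AE w in M. norm (\<Sum>m<N. piece m w * z w) \<le> \<bar>total w * z w\<bar>" for N
    proof (rule AE_I2)
      fix w
      show "norm (\<Sum>m<N. piece m w * z w) \<le> \<bar>total w * z w\<bar>"
        by (cases "\<exists>n. w \<in> A n") (auto simp: eq off)
    qed
  qed measurable
  moreover have "(\<integral>w. (\<Sum>m<N. piece m w * z w) \<partial>M) = 0" for N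
    using zero integrable_pairing[OF piece_space z]
    by (simp add: Bochner_Integration.integral_sum pairing_def)
  ultimately show False by (simp add: pairing_def LIMSEQ_const_iff)
qed

lemma no_weakly_convergent_forward:
  assumes "forward_convex_combinations \<xi> \<zeta>"
  shows "\<not> converges_in weak_topo \<zeta>"
proof
  assume "converges_in weak_topo \<zeta>"
  then obtain z where z: "limitin weak_topo \<zeta> z sequentially"
    by (auto simp: converges_in_def)
  have \<zeta>: "\<zeta> n \<in> conv_tail \<xi> n" for n using assms by (simp add: forward_convex_combinations_def)
  show False
  proof (rule no_weak_limit[OF z])
    fix m
    have zero: "pairing M (piece m) (\<zeta> n) = 0" if "n > m" for n
    proof -
      have "piece m w * \<zeta> n w = 0" for w
        using conv_tail_off[OF \<zeta>[of n] that] by (cases "w \<in> A m") auto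
      then show ?thesis unfolding pairing_def by (simp only: Bochner_Integration.integral_zero)
    qed
    have "eventually (\<lambda>n. pairing M (piece m) (\<zeta> n) = 0) sequentially"
      using eventually_gt_at_top[of m] by eventually_elim (rule zero)
    then show "(\<lambda>n. pairing M (piece m) (\<zeta> n)) \<longlonglongrightarrow> 0" by (rule tendsto_eventually)
  qed (rule conv_tail_total_pairing[OF \<zeta>])
qed

text \<open>The means keep their early terms and do not vanish on the early events. Still only one
  index i can give a nonzero pairing with a fixed piece, so the averaged pairings tend to 0, and a
  Mackey limit is also a weak limit.\<close>

lemma no_mackey_convergent_cesaro:
  assumes r: "strict_mono r"
  shows "\<not> converges_in mackey_topo (cesaro_means (\<xi> \<circ> r))"
proof
  assume "converges_in mackey_topo (cesaro_means (\<xi> \<circ> r))"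
  then obtain z where z: "limitin mackey_topo (cesaro_means (\<xi> \<circ> r)) z sequentially"
    by (auto simp: converges_in_def)
  have space: "cesaro_means (\<xi> \<circ> r) N \<in> L \<Psi>" for N
    by (rule dual.cesaro_means_orlicz) (simp add: \<xi>_space)
  have pairing: "pairing M h (cesaro_means (\<xi> \<circ> r) N) = (\<Sum>i\<le>N. pairing M h (\<xi> (r i))) / real (Suc N)"
    if "h \<in> L \<Phi>" for h N
  proof -
    have "cesaro_means (\<xi> \<circ> r) N = (\<lambda>w. \<Sum>i\<le>N. (1 / real (Suc N)) * \<xi> (r i) w)"
      by (simp add: cesaro_means_def sum_divide_distrib)
    then show ?thesis
      using pairing_lincomb[OF that, of "{..N}" "\<lambda>i. \<xi> (r i)" "\<lambda>_. 1 / real (Suc N)"] \<xi>_space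
      by (simp add: sum_divide_distrib del: of_nat_Suc)
  qed
  show False
  proof (rule no_weak_limit[OF limitin_mackey_topologyD[OF space z]])
    show "pairing M total (cesaro_means (\<xi> \<circ> r) n) = 1 / 2" for n
      by (simp add: pairing[OF total_in_space] total_pairing del: of_nat_Suc)
    fix m
    have "eventually (\<lambda>i. pairing M (piece m) (\<xi> (r i)) = 0) sequentially"
      using eventually_gt_at_top[of m]
    proof eventually_elim
      case (elim i)
      then have "m \<noteq> r i" using seq_suble[OF r, of i] by simp
      then show ?case by (simp only: piece_pairing_eq if_False)
    qed
    then have "(\<lambda>i. pairing M (piece m) (\<xi> (r i))) \<longlonglongrightarrow> 0" by (rule tendsto_eventually)
    then show "(\<lambda>n. pairing M (piece m) (cesaro_means (\<xi> \<circ> r) n)) \<longlonglongrightarrow> 0"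
      unfolding pairing[OF piece_space] by (rule cesaro_null)
  qed
qed

text \<open>Forward combinations vanish eventually at each point of the events. An order bound g
  would allow dominated convergence with majorant |total * g| and send the constant pairings 1 / 2
  to 0.\<close>

lemma no_order_bounded_forward:
  assumes "forward_convex_combinations \<xi> \<zeta>"
  shows "\<not> order_bounded_seq M \<Psi> \<zeta>"
proof
  assume "order_bounded_seq M \<Psi> \<zeta>"
  then obtain g where g: "g \<in> L \<Psi>" "AE w in M. (SUP n. ereal \<bar>\<zeta> n w\<bar>) = ereal (g w)"
    and \<zeta>_space: "\<And>n. \<zeta> n \<in> L \<Psi>"
    by (auto simp: order_bounded_seq_def)
  have \<zeta>: "\<zeta> n \<in> conv_tail \<xi> n" for n using assms by (simp add: forward_convex_combinations_def)
  note [measurable] = dual.orlicz_space_measurable[OF \<zeta>_space] orlicz_space_measurable[OF total_in_space]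
  have "(\<lambda>n. \<integral>w. total w * \<zeta> n w \<partial>M) \<longlonglongrightarrow> (\<integral>w. 0 \<partial>M)"
  proof (rule integral_dominated_convergence[where w="\<lambda>w. \<bar>total w * g w\<bar>"])
    show "integrable M (\<lambda>w. \<bar>total w * g w\<bar>)"
      by (intro integrable_abs integrable_pairing total_in_space g)
    show "AE w in M. (\<lambda>n. total w * \<zeta> n w) \<longlonglongrightarrow> 0"
    proof (rule AE_I2)
      fix w
      show "(\<lambda>n. total w * \<zeta> n w) \<longlonglongrightarrow> 0"
      proof (cases "\<exists>m. w \<in> A m")
        case True
        then obtain m where m: "w \<in> A m" ..
        have "eventually (\<lambda>n. total w * \<zeta> n w = 0) sequentially"
          using eventually_gt_at_top[of m] by eventually_elim (simp add: conv_tail_off[OF \<zeta> _ m])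
        then show ?thesis by (rule tendsto_eventually)
      qed (simp add: total_def)
    qed
    show "AE w in M. norm (total w * \<zeta> n w) \<le> \<bar>total w * g w\<bar>" for n
      using g(2)
    proof eventually_elim
      case (elim w)
      have "ereal \<bar>\<zeta> n w\<bar> \<le> ereal (g w)" unfolding elim[symmetric] by (rule SUP_upper) simp
      then show ?case by (auto simp: abs_mult intro!: mult_left_mono)
    qed
  qed measurable
  then have "(\<lambda>n. pairing M total (\<zeta> n)) \<longlonglongrightarrow> 0" by (simp add: pairing_def)
  then show False by (simp add: conv_tail_total_pairing[OF \<zeta>] LIMSEQ_const_iff)
qed

end

context young_duality
begin

lemma not_delta2_counterexample:
  assumes atomless: "atomless M" and "\<not> delta2 \<Phi>"
  shows "\<exists>A y \<xi>. disjoint_counterexample M \<Phi> \<Psi> A y \<xi>"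
proof -
  \<comment> \<open>Beyond k the function \<Phi> dominates the identity, so y n \<ge> k + 1 gives
    \<Phi>(y n) \<ge> 1 and \<Phi>(2 y n) > 2^(n + 1). The probabilities 1 / \<Phi>(2 y n) then add
    up to at most 1, and disjoint events of these sizes fit.\<close>
  obtain k :: nat where k: "\<And>x. \<bar>x\<bar> > real k \<Longrightarrow> \<bar>x\<bar> \<le> 1 * \<Phi> x"
    using abs_le_eps_large[of 1] by auto
  have "\<forall>n. \<exists>y. y \<ge> real k + 1 \<and> y > 0 \<and> \<Phi> y > 0 \<and> \<Phi> (2 * y) > 2 ^ Suc n * \<Phi> y"
    using not_delta2D[OF assms(2), of "real k + 1"] by blast
  from choice[OF this] obtain y where y: "\<forall>n. y n \<ge> real k + 1 \<and> y n > 0 \<and> \<Phi> (y n) > 0 \<and>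
      \<Phi> (2 * y n) > 2 ^ Suc n * \<Phi> (y n)" ..
  have y_pos: "y n > 0" and y_ratio: "\<Phi> (2 * y n) > 2 ^ Suc n * \<Phi> (y n)" for n using y by auto
  have y_ge: "\<Phi> (y n) \<ge> 1" for n
    using k[of "y n"] y[rule_format, of n] by simp
  have big: "\<Phi> (2 * y n) > 2 ^ Suc n" for n
  proof -
    have "(2::real) ^ Suc n * 1 \<le> 2 ^ Suc n * \<Phi> (y n)" using y_ge by (intro mult_left_mono) auto
    then show ?thesis using y_ratio[of n] by linarith
  qed
  have big_pos: "\<Phi> (2 * y n) > 0" for n using big[of n] by (rule less_trans[rotated]) simp
  define q where "q = (\<lambda>n. 1 / \<Phi> (2 * y n))"
  have q_nn: "0 \<le> q n" for n using big_pos by (simp add: q_def)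
  have geo: "(\<Sum>i<n. (1/2 :: real) ^ Suc i) \<le> 1" for n
  proof -
    have "(\<Sum>i<n. (1/2 :: real) ^ Suc i) = 1 - (1/2) ^ n" by (induction n) (auto simp: field_simps)
    then show ?thesis by simp
  qed
  have q_le: "q n \<le> (1/2) ^ Suc n" for n
    using big[of n] big_pos[of n] unfolding q_def power_one_over
    by (intro divide_left_mono mult_pos_pos) auto
  have "(\<Sum>i<n. q i) \<le> 1" for n
    using sum_mono[of "{..<n}" q "\<lambda>i. (1/2) ^ Suc i"] q_le geo[of n] by fastforce
  then obtain A where A: "disjoint_family A" "\<And>n. A n \<in> sets M" "\<And>n. prob (A n) = q n"
    using atomless_disjoint_family[OF atomless, of q] q_nn by blast
  note [measurable] = A(2)
  have only: "w \<in> A m \<Longrightarrow> w \<in> A n \<Longrightarrow> m = n" for w m n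
    using A(1) unfolding disjoint_family_on_def by blast
  define \<eta> where "\<eta> = (\<lambda>w. \<Sum>n. y n * indicator (A n) w)"
  have \<eta>_on: "\<eta> w = y n" if "w \<in> A n" for w n
  proof -
    have "\<eta> w = (\<Sum>m\<in>{n}. y m * indicator (A m) w)"
      unfolding \<eta>_def by (rule suminf_finite) (use only[OF that] in \<open>auto simp: indicator_def\<close>)
    then show ?thesis using that by simp
  qed
  have \<eta>_off: "\<eta> w = 0" if "\<And>n. w \<notin> A n" for w
    using that by (simp add: \<eta>_def)
  have \<eta>_meas: "\<eta> \<in> borel_measurable M" unfolding \<eta>_def by measurable
  \<comment> \<open>The failure of doubling enters here: \<Phi>(y n) / \<Phi>(2 y n) is below 2^-(n
    + 1), so the modular of the total function is at most 1.\<close>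
  have y_sum: "(\<integral>\<^sup>+w. ennreal (\<Phi> (\<eta> w)) \<partial>M) \<le> 1"
  proof -
    have "(\<integral>\<^sup>+w. ennreal (\<Phi> (\<eta> w)) \<partial>M) \<le> (\<integral>\<^sup>+w. (\<Sum>n. ennreal (\<Phi> (y n)) * indicator (A n) w) \<partial>M)"
    proof (rule nn_integral_mono)
      fix w
      show "ennreal (\<Phi> (\<eta> w)) \<le> (\<Sum>n. ennreal (\<Phi> (y n)) * indicator (A n) w)"
      proof (cases "\<exists>n. w \<in> A n")
        case True
        then obtain n where n: "w \<in> A n" ..
        have "(\<Sum>m\<in>{n}. ennreal (\<Phi> (y m)) * indicator (A m) w) \<le> (\<Sum>n. ennreal (\<Phi> (y n)) * indicator (A n) w)"
          by (rule sum_le_suminf) auto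
        then show ?thesis using n by (simp add: \<eta>_on)
      next
        case False
        then show ?thesis by (simp add: \<eta>_off)
      qed
    qed
    also have "\<dots> = (\<Sum>n. ennreal (\<Phi> (y n)) * emeasure M (A n))"
      by (subst nn_integral_suminf) (auto simp: nn_integral_cmult_indicator A(2))
    also have "\<dots> = (\<Sum>n. ennreal (\<Phi> (y n) * q n))"
      using q_nn by (simp add: emeasure_eq_measure A(3) ennreal_mult)
    also have "\<dots> \<le> 1"
    proof (rule suminf_le_const)
      show "(\<Sum>i<n. ennreal (\<Phi> (y i) * q i)) \<le> 1" for n
      proof -
        have "\<Phi> (y i) * q i \<le> (1/2) ^ Suc i" for i
        proof -
          have "2 ^ Suc i * \<Phi> (y i) / \<Phi> (2 * y i) \<le> 1"
            using y_ratio[of i] big_pos[of i] by simp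
          then have "\<Phi> (y i) * q i * 2 ^ Suc i \<le> 1" by (simp add: q_def mult.commute)
          then show ?thesis by (simp add: power_one_over pos_le_divide_eq del: power_Suc)
        qed
        then have "(\<Sum>i<n. \<Phi> (y i) * q i) \<le> (\<Sum>i<n. (1/2) ^ Suc i)" by (intro sum_mono)
        then have "(\<Sum>i<n. \<Phi> (y i) * q i) \<le> 1" using geo[of n] by linarith
        then show ?thesis using q_nn by (subst sum_ennreal) (auto simp: ennreal_le_1)
      qed
    qed auto
    finally show ?thesis .
  qed
  have \<eta>_space: "\<eta> \<in> L \<Phi>"
  proof -
    have "\<eta> \<in> orlicz_ball M \<Phi>" using y_sum \<eta>_meas by (simp add: orlicz_ball_def)
    then have "\<eta> \<in> scaled_orlicz_ball M \<Phi> 1" by (simp add: scaled_orlicz_ball_iff)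
    then show ?thesis by (auto simp: orlicz_space_def)
  qed
  have y_space: "(\<lambda>w. y n * indicator (A n) w) \<in> L \<Phi>" for n
  proof (rule orlicz_space_solid[OF \<eta>_space])
    have "\<bar>y n * indicator (A n) w\<bar> \<le> \<bar>\<eta> w\<bar>" for w
      by (cases "w \<in> A n") (auto simp: \<eta>_on)
    then show "AE w in M. \<bar>y n * indicator (A n) w\<bar> \<le> \<bar>\<eta> w\<bar>" by simp
  qed measurable
  \<comment> \<open>The secant slope at 2 y n has conjugate value at most \<Phi>(2 y n), the
    reciprocal of the probability of the event, so the modular of \<open>\<xi> n\<close> is at most
    1.\<close>
  define a where "a = (\<lambda>n. \<Phi> (2 * y n) / (2 * y n))"
  define \<xi> where "\<xi> = (\<lambda>n w. a n * indicator (A n) w)"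
  have "\<xi> n \<in> orlicz_ball M \<Psi>" for n
  proof -
    have "(\<integral>\<^sup>+w. ennreal (\<Psi> (\<xi> n w)) \<partial>M) = (\<integral>\<^sup>+w. ennreal (\<Psi> (a n)) * indicator (A n) w \<partial>M)"
      by (rule nn_integral_cong) (auto simp: \<xi>_def indicator_def)
    also have "\<dots> = ennreal (\<Psi> (a n) * q n)"
      using q_nn by (simp add: nn_integral_cmult_indicator A(2) emeasure_eq_measure A(3) ennreal_mult)
    also have "\<dots> \<le> 1"
    proof -
      have "\<Psi> (a n) * q n \<le> \<Phi> (2 * y n) * q n"
        unfolding a_def conjugate using y_pos q_nn
        by (intro mult_right_mono conjugate_slope_le) auto
      also have "\<dots> = 1" using big_pos[of n] by (simp add: q_def)
      finally show ?thesis by (simp add: ennreal_le_1)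
    qed
    finally show ?thesis by (simp add: orlicz_ball_def \<xi>_def)
  qed
  moreover have "pairing M (\<lambda>w. y n * indicator (A n) w) (\<xi> n) = 1 / 2" for n
  proof -
    have "pairing M (\<lambda>w. y n * indicator (A n) w) (\<xi> n) = (\<integral>w. (y n * a n) * indicator (A n) w \<partial>M)"
      unfolding pairing_def \<xi>_def by (intro Bochner_Integration.integral_cong) (auto simp: indicator_def)
    also have "\<dots> = y n * a n * q n" using A(2,3) by simp
    also have "\<dots> = 1 / 2" using y_pos[of n] big_pos[of n] by (simp add: a_def q_def)
    finally show ?thesis .
  qed
  moreover have "w \<notin> A n \<Longrightarrow> \<xi> n w = 0" for n w by (simp add: \<xi>_def)
  ultimately have "disjoint_counterexample M \<Phi> \<Psi> A y \<xi>"
    using A(1,2) \<eta>_space y_space unfolding \<eta>_def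
    by (intro disjoint_counterexample.intro young_duality_axioms disjoint_counterexample_axioms.intro)
  then show ?thesis by (intro exI)
qed

end

section \<open>Equivalence of the growth condition with the three compactness properties\<close>

theorem theorem3p11:
  fixes M :: "'a measure" and \<Phi> :: "real \<Rightarrow> real"
  assumes "prob_space M"
    and "atomless M"
    and "young_function \<Phi>"
  shows "(delta2 \<Phi> \<longleftrightarrow>
            (\<forall>\<xi>. norm_bounded_seq M (young_conjugate \<Phi>) \<xi> \<longrightarrow>
               (\<exists>r :: nat \<Rightarrow> nat. strict_mono r \<and>
                  converges_in
                    (mackey_topology M (orlicz_space M (young_conjugate \<Phi>)) (orlicz_space M \<Phi>))
                    (cesaro_means (\<xi> \<circ> r))))) \<and>
         (delta2 \<Phi> \<longleftrightarrow>
            (\<forall>\<xi>. norm_bounded_seq M (young_conjugate \<Phi>) \<xi> \<longrightarrow>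
               (\<exists>\<zeta>. forward_convex_combinations \<xi> \<zeta> \<and>
                  converges_in
                    (weak_topology M (orlicz_space M (young_conjugate \<Phi>)) (orlicz_space M \<Phi>)) \<zeta>))) \<and>
         (delta2 \<Phi> \<longleftrightarrow>
            (\<forall>\<xi>. norm_bounded_seq M (young_conjugate \<Phi>) \<xi> \<longrightarrow>
               (\<exists>\<zeta>. forward_convex_combinations \<xi> \<zeta> \<and>
                  order_bounded_seq M (young_conjugate \<Phi>) \<zeta>)))"
proof -
  interpret young_duality M \<Phi> "young_conjugate \<Phi>"
    using assms by (simp add: young_duality_def young_space_def young_def young_duality_axioms_def)
  let ?\<Psi> = "young_conjugate \<Phi>"
  \<comment> \<open>One sequence \<zeta> of block averages serves both for the weak limit and for
    the order bound.\<close>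
  have forward:
    "(\<exists>r :: nat \<Rightarrow> nat. strict_mono r \<and>
        converges_in mackey_topo (cesaro_means (\<xi> \<circ> r))) \<and>
     (\<exists>\<zeta>. forward_convex_combinations \<xi> \<zeta> \<and>
        converges_in weak_topo \<zeta> \<and>
        order_bounded_seq M ?\<Psi> \<zeta>)"
    if "delta2 \<Phi>" and \<xi>: "norm_bounded_seq M ?\<Psi> \<xi>" for \<xi>
  proof -
    from dual.komlos_modular[OF \<xi> delta2_conjugate[OF that(1)]] obtain r f c where
      *: "strict_mono (r :: nat \<Rightarrow> nat) \<and> f \<in> L ?\<Psi> \<and> c > 0 \<and>
        (\<lambda>N. dual.modular c (\<lambda>w. cesaro_means (\<xi> \<circ> r) N w - f w)) \<longlonglongrightarrow> 0"
      by (elim exE)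
    then have r: "strict_mono r" and f: "f \<in> L ?\<Psi>" and c: "c > 0"
      and lim: "(\<lambda>N. dual.modular c (\<lambda>w. cesaro_means (\<xi> \<circ> r) N w - f w)) \<longlonglongrightarrow> 0"
      by simp_all
    have "cesaro_means (\<xi> \<circ> r) N \<in> L ?\<Psi>" for N
      using \<xi> by (intro dual.cesaro_means_orlicz) (simp add: norm_bounded_seq_def)
    from limitin_mackey_topologyI[OF this f c lim]
    have mackey: "converges_in mackey_topo (cesaro_means (\<xi> \<circ> r))"
      unfolding converges_in_def by (rule exI[of _ f])
    from dual.forward_modular[OF \<xi> r f c lim] obtain \<zeta> where \<zeta>: "forward_convex_combinations \<xi> \<zeta> \<and>
      (\<forall>n. \<zeta> n \<in> L ?\<Psi>) \<and> (\<forall>n. dual.modular (c / 4) (\<lambda>w. \<zeta> n w - f w) \<le> ennreal ((1/2) ^ n))" ..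
    then have \<zeta>_space: "\<zeta> n \<in> L ?\<Psi>"
      and fast: "dual.modular (c / 4) (\<lambda>w. \<zeta> n w - f w) \<le> ennreal ((1/2) ^ n)" for n by simp_all
    have c4: "c / 4 > 0" using c by simp
    have "(\<lambda>n. dual.modular (c / 4) (\<lambda>w. \<zeta> n w - f w)) \<longlonglongrightarrow> 0"
    proof (rule tendsto_sandwich[OF _ _ tendsto_const])
      have "(\<lambda>n. ennreal ((1/2) ^ n)) \<longlonglongrightarrow> ennreal 0"
        by (intro tendsto_ennrealI LIMSEQ_realpow_zero) auto
      then show "(\<lambda>n. ennreal ((1/2) ^ n)) \<longlonglongrightarrow> 0" by simp
    qed (use fast in \<open>auto intro!: always_eventually\<close>)
    from limitin_weak_of_modular[OF \<zeta>_space f c4 this]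
    have "converges_in weak_topo \<zeta>"
      unfolding converges_in_def by (rule exI[of _ f])
    moreover have "order_bounded_seq M ?\<Psi> \<zeta>"
      by (rule dual.order_bounded_of_modular[OF \<zeta>_space f c4 fast])
    ultimately show ?thesis using r mackey \<zeta> by (intro conjI exI[of _ r] exI[of _ \<zeta>]) simp_all
  qed
  \<comment> \<open>One bounded sequence refutes all three properties, so each of them separately
    implies the growth condition.\<close>
  have backward: "\<exists>\<xi>. norm_bounded_seq M ?\<Psi> \<xi> \<and>
     (\<forall>r :: nat \<Rightarrow> nat. strict_mono r \<longrightarrow>
       \<not> converges_in mackey_topo (cesaro_means (\<xi> \<circ> r))) \<and>
     (\<forall>\<zeta>. forward_convex_combinations \<xi> \<zeta> \<longrightarrow>
       \<not> converges_in weak_topo \<zeta> \<and>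
       \<not> order_bounded_seq M ?\<Psi> \<zeta>)" if "\<not> delta2 \<Phi>"
  proof -
    from not_delta2_counterexample[OF assms(2) that] obtain A y \<xi>
      where "disjoint_counterexample M \<Phi> ?\<Psi> A y \<xi>" by (elim exE)
    then interpret disjoint_counterexample M \<Phi> ?\<Psi> A y \<xi> .
    show ?thesis
      using norm_bounded no_mackey_convergent_cesaro no_weakly_convergent_forward no_order_bounded_forward
      by (intro exI[of _ \<xi>] conjI allI impI)
  qed
  show ?thesis
    using forward backward by metis
qed

end
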